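(* Let $d\ge1$ and $n\ge2$, let $(p_j)_{1\le j\le n}$ be a Hölder tuple of exponents, and let $B$ be a real constant. Then there is a constant $C$, depending only on $n$, $d$, $B$ and $(p_j)_{1\le j\le n}$, such that the following holds. Let $\Lambda$ be a perfect $n$-linear Calderón--Zygmund form in $\mathbb{R}^d$, and let $b_1,\dots,b_n$ be real-valued measurable functions on $\mathbb{R}^d$ such that: 1. (Pseudo-accretivity condition) $|[b_j]_Q|\ge 1$ for all dyadic cubes $Q$ and all $1\le j\le n$. 2. (Norm bound condition) $\|b_j\|_\infty\le B$ for all $1\le j\le n$. 3. (Weak boundedness condition) For all dyadic cubes $Q$, $|\Lambda(b_1\mathbf{1}_Q,\dots,b_n\mathbf{1}_Q)|\le B\,|Q|$. 4. (BMO condition) For any $1\le k\le n$ and any dyadic test function $g$, $$|\Lambda(f_1,\dots,f_n)|\le B\,\|g\|_{H_1},$$ where $f_k=g$ and $f_j=b_j$ for $j\ne k$. Then $$|\Lambda(f_1,\dots,f_n)|\le C\prod_{j=1}^n\|f_j\|_{p_j}$$ for every $n$-tuple $(f_j)_{1\le j\le n}$ of dyadic test functions.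
   Context: A dyadic interval is an interval $[2^m l,2^m(l+1))$ with $m,l\in\mathbb{Z}$; a dyadic cube in $\mathbb{R}^d$ is a cube whose sides are dyadic intervals. A dyadic child of a dyadic cube $P$ is a dyadic subcube of $P$ of half the sidelength. A dyadic test function is a finite (real) linear combination of characteristic functions of dyadic cubes. $|Q|$ denotes Lebesgue measure, $\mathbf{1}_Q$ the characteristic function of $Q$, $[g]_Q=|Q|^{-1}\int_Q g$, and $\|\cdot\|_p$ the $L^p(\mathbb{R}^d)$ norm. A Hölder tuple of exponents is a tuple $(p_j)_{1\le j\le n}$ with $1<p_j<\infty$ for all $j$ and $\sum_{j=1}^n 1/p_j=1$. A perfect $n$-linear Calderón--Zygmund form in $\mathbb{R}^d$ is an $n$-linear form $\Lambda$ mapping $n$-tuples of dyadic test functions on $\mathbb{R}^d$ to $\mathbb{R}$ such that: (i) (Dyadic decay) If the dyadic test functions $f_1,\dots,f_n$ are all supported on the same dyadic cube $P$, and two of these functions are supported on different dyadic children of $P$, then $|\Lambda(f_1,\dots,f_n)|\le\prod_{j=1}^n\|f_j\|_{p_j}$ for any Hölder tuple $(p_j)_{1\le j\le n}$. (ii) (Perfect smoothness) If one of the functions $f_j$ is supported on some dyadic cube $P$ and has mean zero, and another one of the functions vanishes on $P$, then $\Lambda(f_1,\dots,f_n)=0$. (iii) (Qualitative truncation) The integral kernel of $\Lambda$ is a dyadic test function on $\mathbb{R}^{dn}$, i.e. $\Lambda(f_1,\dots,f_n)=\int_{\mathbb{R}^{dn}}K(x_1,\dots,x_n)\prod_{j=1}^n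 f_j(x_j)\,dx_1\cdots dx_n$ with $K$ a dyadic test function on $\mathbb{R}^{dn}$. Through the formula in (iii), $\Lambda$ is also evaluated on tuples of locally integrable functions. $\|g\|_{H_1}$ is the norm of the dyadic Hardy space, the predual of dyadic BMO. Concretely one may take the atomic norm: the infimum of $\sum_i|\lambda_i|$ over representations $g=\sum_i\lambda_i a_i$ (convergent in $L^1$), where each $a_i$ is supported on a dyadic cube $Q_i$, has $\int a_i=0$ and $\|a_i\|_\infty\le|Q_i|^{-1}$; $\|g\|_{H_1}=\infty$ (so the BMO condition is vacuous) if there is no such representation with $\sum_i|\lambda_i|<\infty$. *)

theory Defs
  imports "HOL-Analysis.Analysis" "HOL-Probability.Essential_Supremum"
begin

text \<open>All notions are set up over an arbitrary Euclidean space, so that the same definitions serve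
  for \<open>\<real>\<^sup>d\<close>, rendered as \<open>real ^ 'd\<close>, and for \<open>\<real>\<^sup>d\<^sup>n\<close>, rendered as \<open>(real ^ 'd) ^ 'n\<close>. In a cube the
  scale \<open>m\<close> is common to all coordinates, only the position \<open>l\<close> depends on the coordinate.\<close>

definition dyadic_cube :: "int \<Rightarrow> ('a::euclidean_space \<Rightarrow> int) \<Rightarrow> 'a set" where
  "dyadic_cube m l =
     {x. \<forall>e\<in>Basis. 2 powi m * real_of_int (l e) \<le> x \<bullet> e \<and>
                   x \<bullet> e < 2 powi m * (real_of_int (l e) + 1)}"

definition dyadic_cubes :: "'a::euclidean_space set set" where
  "dyadic_cubes = {dyadic_cube m l | m l. True}"

definition dyadic_child :: "'a::euclidean_space set \<Rightarrow> 'a set \<Rightarrow> bool" where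
  "dyadic_child R P \<longleftrightarrow>
     (\<exists>m l l'. P = dyadic_cube m l \<and> R = dyadic_cube (m - 1) l' \<and> R \<subseteq> P)"

definition dyadic_test :: "('a::euclidean_space \<Rightarrow> real) \<Rightarrow> bool" where
  "dyadic_test f \<longleftrightarrow>
     (\<exists>\<Q> c. finite \<Q> \<and> \<Q> \<subseteq> dyadic_cubes \<and> f = (\<lambda>x. \<Sum>Q\<in>\<Q>. c Q * indicator Q x))"

definition supported_on :: "('a \<Rightarrow> real) \<Rightarrow> 'a set \<Rightarrow> bool" where
  "supported_on f P \<longleftrightarrow> (\<forall>x. x \<notin> P \<longrightarrow> f x = 0)"

definition locally_integrable :: "('a::euclidean_space \<Rightarrow> real) \<Rightarrow> bool" where
  "locally_integrable f \<longleftrightarrow> (\<forall>S. compact S \<longrightarrow> set_integrable lebesgue S f)"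

definition mean_on :: "('a::euclidean_space \<Rightarrow> real) \<Rightarrow> 'a set \<Rightarrow> real" where
  "mean_on g Q = (LINT x:Q|lebesgue. g x) / measure lebesgue Q"

definition Lp_norm :: "real \<Rightarrow> ('a::euclidean_space \<Rightarrow> real) \<Rightarrow> real" where
  "Lp_norm p f = (LINT x|lebesgue. \<bar>f x\<bar> powr p) powr (1 / p)"

definition Linf_norm :: "('a::euclidean_space \<Rightarrow> real) \<Rightarrow> ereal" where
  "Linf_norm f = esssup lebesgue (\<lambda>x. ereal \<bar>f x\<bar>)"

definition hoelder_tuple :: "('n::finite \<Rightarrow> real) \<Rightarrow> bool" where
  "hoelder_tuple p \<longleftrightarrow> (\<forall>j. 1 < p j) \<and> (\<Sum>j\<in>UNIV. 1 / p j) = 1"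

definition H1_atom :: "('a::euclidean_space \<Rightarrow> real) \<Rightarrow> bool" where
  "H1_atom a \<longleftrightarrow>
     (\<exists>Q\<in>dyadic_cubes. a \<in> borel_measurable lebesgue \<and> supported_on a Q \<and>
        (LINT x|lebesgue. a x) = 0 \<and> Linf_norm a \<le> ereal (1 / measure lebesgue Q))"

definition H1_representation ::
    "('a::euclidean_space \<Rightarrow> real) \<Rightarrow> (nat \<Rightarrow> real) \<Rightarrow> (nat \<Rightarrow> 'a \<Rightarrow> real) \<Rightarrow> bool" where
  "H1_representation g c a \<longleftrightarrow>
     (\<forall>i. H1_atom (a i)) \<and> summable (\<lambda>i. \<bar>c i\<bar>) \<and>
     (\<lambda>N. \<integral>\<^sup>+x. ennreal \<bar>g x - (\<Sum>i<N. c i * a i x)\<bar> \<partial>lebesgue) \<longlonglongrightarrow> 0"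

text \<open>Finite representations are included, by padding with \<open>c i = 0\<close>. The infimum of the empty set
  is \<open>\<infinity>\<close>.\<close>

definition H1_norm :: "('a::euclidean_space \<Rightarrow> real) \<Rightarrow> ereal" where
  "H1_norm g = Inf {ereal (\<Sum>i. \<bar>c i\<bar>) | c a. H1_representation g c a}"

definition multilinear_on_tests ::
    "(('n::finite \<Rightarrow> 'a::euclidean_space \<Rightarrow> real) \<Rightarrow> real) \<Rightarrow> bool" where
  "multilinear_on_tests \<Lambda> \<longleftrightarrow>
     (\<forall>f k u v \<alpha> \<beta>. (\<forall>j. dyadic_test (f j)) \<and> dyadic_test u \<and> dyadic_test v \<longrightarrow>
        \<Lambda> (f(k := (\<lambda>x. \<alpha> * u x + \<beta> * v x))) = \<alpha> * \<Lambda> (f(k := u)) + \<beta> * \<Lambda> (f(k := v)))"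

definition dyadic_decay ::
    "(('n::finite \<Rightarrow> 'a::euclidean_space \<Rightarrow> real) \<Rightarrow> real) \<Rightarrow> bool" where
  "dyadic_decay \<Lambda> \<longleftrightarrow>
     (\<forall>f. \<forall>P\<in>dyadic_cubes.
        (\<forall>j. dyadic_test (f j) \<and> supported_on (f j) P) \<and>
        (\<exists>j k R S. j \<noteq> k \<and> dyadic_child R P \<and> dyadic_child S P \<and> R \<noteq> S \<and>
           supported_on (f j) R \<and> supported_on (f k) S) \<longrightarrow>
        (\<forall>p. hoelder_tuple p \<longrightarrow> \<bar>\<Lambda> f\<bar> \<le> (\<Prod>j\<in>UNIV. Lp_norm (p j) (f j))))"

definition perfect_smoothness ::
    "(('n::finite \<Rightarrow> 'a::euclidean_space \<Rightarrow> real) \<Rightarrow> real) \<Rightarrow> bool" where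
  "perfect_smoothness \<Lambda> \<longleftrightarrow>
     (\<forall>f j k. \<forall>P\<in>dyadic_cubes.
        (\<forall>i. dyadic_test (f i)) \<and> j \<noteq> k \<and>
        supported_on (f j) P \<and> (LINT x|lebesgue. f j x) = 0 \<and> (\<forall>x\<in>P. f k x = 0) \<longrightarrow>
        \<Lambda> f = 0)"

text \<open>A form on tuples of dyadic test functions whose kernel is a dyadic test function is evaluated
  on tuples of locally integrable functions through its kernel. Here \<open>\<Lambda>\<close> stands for the form so
  extended, hence the kernel formula is required on all such tuples, which include the tuples of
  dyadic test functions. The values of \<open>\<Lambda>\<close> on other tuples are never used.\<close>

definition qualitative_truncation ::
    "(('n::finite \<Rightarrow> 'a::euclidean_space \<Rightarrow> real) \<Rightarrow> real) \<Rightarrow> bool" where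
  "qualitative_truncation \<Lambda> \<longleftrightarrow>
     (\<exists>K :: 'a ^ 'n \<Rightarrow> real. dyadic_test K \<and>
        (\<forall>f. (\<forall>j. locally_integrable (f j)) \<longrightarrow>
           \<Lambda> f = (LINT x|lebesgue. K x * (\<Prod>j\<in>UNIV. f j (x $ j)))))"

definition perfect_CZ_form ::
    "(('n::finite \<Rightarrow> 'a::euclidean_space \<Rightarrow> real) \<Rightarrow> real) \<Rightarrow> bool" where
  "perfect_CZ_form \<Lambda> \<longleftrightarrow>
     multilinear_on_tests \<Lambda> \<and> dyadic_decay \<Lambda> \<and> perfect_smoothness \<Lambda> \<and> qualitative_truncation \<Lambda>"

end

theory Submission
  imports Defs
begin

text \<open>
  The kernel of \<open>\<Lambda>\<close> is a dyadic test function, so \<open>\<Lambda>\<close> only sees averages over cubes above some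
  finest scale \<open>m\<close>, inside some region of scale \<open>M\<close>; there the functions \<open>b\<^sub>j\<close> may be replaced by their
  averages on cubes of scale \<open>m\<close>. Parts of the \<open>f\<^sub>j\<close> in different root cubes (orthants) do not interact.

  On a root cube put \<open>\<phi>\<^sub>j(Q) = [f\<^sub>j]\<^sub>Q / [b\<^sub>j]\<^sub>Q\<close> and
  \<open>G(Q) = \<Lambda>(f\<^sub>1 1\<^sub>Q, \<dots>, f\<^sub>n 1\<^sub>Q) - (\<Prod>\<^sub>j \<phi>\<^sub>j(Q)) \<Lambda>(b\<^sub>1 1\<^sub>Q, \<dots>, b\<^sub>n 1\<^sub>Q)\<close>, which vanishes at the finest scale.
  By perfect smoothness, \<open>G(P) - \<Sum>\<^sub>R G(R)\<close>, summed over the children \<open>R\<close> of \<open>P\<close>, equals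
  \<open>\<Sum>\<^sub>\<rho> \<lambda>\<^sub>\<rho> (\<Prod>\<^sub>j \<phi>\<^sub>j(\<rho>\<^sub>j) - \<Prod>\<^sub>j \<phi>\<^sub>j(P))\<close> over all tuples \<open>\<rho>\<close> of children, with
  \<open>\<lambda>\<^sub>\<rho> = \<Lambda>(b\<^sub>1 1\<^bsub>\<rho>\<^sub>1\<^esub>, \<dots>, b\<^sub>n 1\<^bsub>\<rho>\<^sub>n\<^esub>)\<close> and \<open>\<bar>\<lambda>\<^sub>\<rho>\<bar> \<le> C \<bar>P\<bar>\<close> by decay and weak boundedness. The terms of order at least
  two in the increments of the \<open>\<phi>\<^sub>j\<close> are bounded by squares of increments. The linear terms are paired
  with the increments of \<open>\<psi>\<^sub>j(Q) = [(\<beta>\<^sub>j - c) b\<^sub>j]\<^sub>Q / [b\<^sub>j]\<^sub>Q\<close>, where \<open>\<beta>\<^sub>j\<close> represents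
  \<open>g \<mapsto> \<Lambda>(b\<^sub>1, \<dots>, g, \<dots>, b\<^sub>n)\<close>.

  Below \<open>Q\<^sub>0\<close> stop at the first cubes where the average of some \<open>\<bar>f\<^sub>j\<bar>\<close>, or of some \<open>\<bar>\<beta>\<^sub>j - c\<bar>\<close>, exceeds \<open>4n\<close>
  times its natural bound; these cover at most half of \<open>Q\<^sub>0\<close>. Above them all averages are bounded and the
  increments are square summable by orthogonality. Hence
  \<open>\<bar>G(Q)\<bar> \<le> C \<Sum>\<^sub>j (\<integral>\<^sub>Q \<bar>f\<^sub>j\<bar>\<^sup>p - 2\<^bsup>1-p\<^esup> \<bar>Q\<bar> [\<bar>f\<^sub>j\<bar>]\<^sub>Q\<^sup>p)\<close> with \<open>p = p\<^sub>j\<close> propagates from smaller to larger cubes: by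
  convexity the subtracted term leaves room for the contribution \<open>C \<bar>Q\<^sub>0\<bar> \<Prod>\<^sub>j [\<bar>f\<^sub>j\<bar>]\<^bsub>Q\<^sub>0\<^esub>\<close> of the cubes above the
  stopping cubes. Homogeneity finally turns the sum of powers into the product of norms.
\<close>

section \<open>A stopping time argument on a weighted tree\<close>

text \<open>The remainder of order two in the expansion of a product. A further factor
  \<open>k\<close> turns it into \<open>(q k + \<delta> k) * Rm + \<delta> k * L\<close>, with
  \<open>Rm\<close> and \<open>L\<close> the previous remainder and linear part; the mixed products
  in the second term are dominated by sums of squares.\<close>

lemma prod_remainder_bound:
  fixes I :: "'n set" and c :: real
  assumes "finite I" "c \<ge> 0"
  shows "\<exists>C\<ge>0. \<forall>q \<delta>. (\<forall>j\<in>I. \<bar>q j\<bar> \<le> c \<and> \<bar>\<delta> j\<bar> \<le> c) \<longrightarrow>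
    \<bar>(\<Prod>j\<in>I. q j + \<delta> j) - (\<Prod>j\<in>I. q j) - (\<Sum>j\<in>I. \<delta> j * (\<Prod>i\<in>I - {j}. q i))\<bar> \<le> C * (\<Sum>j\<in>I. (\<delta> j)\<^sup>2)"
  using assms(1)
proof (induction I rule: finite_induct)
  case empty
  then show ?case by auto
next
  case (insert k I)
  then obtain C where C: "C \<ge> 0" "\<And>q \<delta>. (\<forall>j\<in>I. \<bar>q j\<bar> \<le> c \<and> \<bar>\<delta> j\<bar> \<le> c) \<Longrightarrow>
    \<bar>(\<Prod>j\<in>I. q j + \<delta> j) - (\<Prod>j\<in>I. q j) - (\<Sum>j\<in>I. \<delta> j * (\<Prod>i\<in>I - {j}. q i))\<bar> \<le> C * (\<Sum>j\<in>I. (\<delta> j)\<^sup>2)"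
    by blast
  let ?c = "c ^ (card I - 1)"
  let ?C = "2 * c * C + real (card I) * ?c + ?c"
  have "\<bar>(\<Prod>j\<in>insert k I. q j + \<delta> j) - (\<Prod>j\<in>insert k I. q j) - (\<Sum>j\<in>insert k I. \<delta> j * (\<Prod>i\<in>insert k I - {j}. q i))\<bar>
      \<le> ?C * (\<Sum>j\<in>insert k I. (\<delta> j)\<^sup>2)"
    if b: "\<forall>j\<in>insert k I. \<bar>q j\<bar> \<le> c \<and> \<bar>\<delta> j\<bar> \<le> c" for q \<delta>
  proof -
    define L where "L = (\<Sum>j\<in>I. \<delta> j * (\<Prod>i\<in>I - {j}. q i))"
    define Rm where "Rm = (\<Prod>j\<in>I. q j + \<delta> j) - (\<Prod>j\<in>I. q j) - L"
    define S where "S = (\<Sum>j\<in>I. (\<delta> j)\<^sup>2)"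
    have S0: "S \<ge> 0" unfolding S_def by (simp add: sum_nonneg)
    have Rm: "\<bar>Rm\<bar> \<le> C * S" unfolding Rm_def L_def S_def using C(2) b by blast
    have "(\<Sum>j\<in>insert k I. \<delta> j * (\<Prod>i\<in>insert k I - {j}. q i)) = \<delta> k * (\<Prod>i\<in>I. q i) + (\<Sum>j\<in>I. \<delta> j * (\<Prod>i\<in>insert k I - {j}. q i))"
      using insert.hyps by simp
    also have "(\<Sum>j\<in>I. \<delta> j * (\<Prod>i\<in>insert k I - {j}. q i)) = (\<Sum>j\<in>I. q k * (\<delta> j * (\<Prod>i\<in>I - {j}. q i)))"
    proof (rule sum.cong[OF refl])
      fix j assume "j \<in> I"
      then have "insert k I - {j} = insert k (I - {j})" using insert.hyps by auto
      then show "\<delta> j * (\<Prod>i\<in>insert k I - {j}. q i) = q k * (\<delta> j * (\<Prod>i\<in>I - {j}. q i))"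
        using insert.hyps by simp
    qed
    finally have e: "(\<Sum>j\<in>insert k I. \<delta> j * (\<Prod>i\<in>insert k I - {j}. q i)) = \<delta> k * (\<Prod>i\<in>I. q i) + q k * L"
      by (simp add: L_def sum_distrib_left)
    have id: "(\<Prod>j\<in>insert k I. q j + \<delta> j) - (\<Prod>j\<in>insert k I. q j) - (\<Sum>j\<in>insert k I. \<delta> j * (\<Prod>i\<in>insert k I - {j}. q i))
       = (q k + \<delta> k) * Rm + \<delta> k * L"
      unfolding e Rm_def using insert.hyps by (simp add: algebra_simps)
    have "\<bar>(q k + \<delta> k) * Rm\<bar> \<le> (2 * c) * (C * S)"
      unfolding abs_mult by (intro mult_mono Rm) (use b assms(2) in \<open>auto intro: order_trans[OF abs_triangle_ineq]\<close>)
    moreover have "\<bar>\<delta> k * L\<bar> \<le> ?c * (\<Sum>j\<in>I. (\<delta> j)\<^sup>2 + (\<delta> k)\<^sup>2)"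
    proof -
      have "\<bar>\<delta> k * L\<bar> \<le> (\<Sum>j\<in>I. \<bar>\<delta> k\<bar> * \<bar>\<delta> j * (\<Prod>i\<in>I - {j}. q i)\<bar>)"
        unfolding L_def abs_mult[of "\<delta> k"] sum_distrib_left[symmetric] by (intro mult_left_mono sum_abs) auto
      also have "\<dots> \<le> (\<Sum>j\<in>I. ?c * ((\<delta> j)\<^sup>2 + (\<delta> k)\<^sup>2))"
      proof (rule sum_mono)
        fix j assume j: "j \<in> I"
        have "\<bar>\<Prod>i\<in>I - {j}. q i\<bar> \<le> (\<Prod>i\<in>I - {j}. c)"
          unfolding abs_prod by (intro prod_mono) (use b in auto)
        then have p: "\<bar>\<Prod>i\<in>I - {j}. q i\<bar> \<le> ?c" using j insert.hyps by simp
        have "0 \<le> (\<bar>\<delta> k\<bar> - \<bar>\<delta> j\<bar>)\<^sup>2" "0 \<le> (\<delta> k)\<^sup>2 + (\<delta> j)\<^sup>2" by simp_all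
        then have "\<bar>\<delta> k\<bar> * \<bar>\<delta> j\<bar> \<le> (\<delta> j)\<^sup>2 + (\<delta> k)\<^sup>2" unfolding power2_diff power2_abs by linarith
        then have "(\<bar>\<delta> k\<bar> * \<bar>\<delta> j\<bar>) * \<bar>\<Prod>i\<in>I - {j}. q i\<bar> \<le> ((\<delta> j)\<^sup>2 + (\<delta> k)\<^sup>2) * ?c"
          by (intro mult_mono p) auto
        then show "\<bar>\<delta> k\<bar> * \<bar>\<delta> j * (\<Prod>i\<in>I - {j}. q i)\<bar> \<le> ?c * ((\<delta> j)\<^sup>2 + (\<delta> k)\<^sup>2)"
          by (simp only: abs_mult mult.assoc mult.commute[of ?c])
      qed
      finally show ?thesis by (simp add: sum_distrib_left)
    qed
    moreover have h3: "(\<Sum>j\<in>I. (\<delta> j)\<^sup>2 + (\<delta> k)\<^sup>2) = S + card I * (\<delta> k)\<^sup>2" by (simp add: S_def sum.distrib)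
    moreover have h4: "(\<Sum>j\<in>insert k I. (\<delta> j)\<^sup>2) = S + (\<delta> k)\<^sup>2" using insert.hyps by (simp add: S_def)
    moreover have "(2 * c) * (C * S) + ?c * (S + card I * (\<delta> k)\<^sup>2) \<le> ?C * (S + (\<delta> k)\<^sup>2)"
    proof -
      have "0 \<le> 2 * c * C * (\<delta> k)\<^sup>2" "0 \<le> real (card I) * ?c * S" "0 \<le> ?c * (\<delta> k)\<^sup>2"
        using S0 C(1) assms(2) by auto
      then show ?thesis unfolding distrib_left distrib_right
        by (simp only: mult.assoc mult.left_commute[of ?c "real (card I)"])
    qed
    ultimately show ?thesis unfolding id h3 h4 using abs_triangle_ineq[of "(q k + \<delta> k) * Rm" "\<delta> k * L"] by linarith
  qed
  moreover have "?C \<ge> 0" using C(1) assms(2) by simp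
  ultimately show ?case by blast
qed

text \<open>With \<open>s\<close> the sum on the right, each \<open>a j\<close> is at most
  \<open>s powr (1 / p j)\<close>, and these exponents add up to 1.\<close>

lemma prod_le_sum_powr:
  fixes p :: "'n::finite \<Rightarrow> real"
  assumes "hoelder_tuple p" "\<And>j. a j \<ge> 0"
  shows "(\<Prod>j\<in>UNIV. a j) \<le> (\<Sum>j\<in>UNIV. a j powr p j)"
proof -
  define s where "s = (\<Sum>j\<in>UNIV. a j powr p j)"
  have p: "\<And>j. p j > 1" "(\<Sum>j\<in>UNIV. 1 / p j) = 1" using assms(1) by (auto simp: hoelder_tuple_def)
  have "a j \<le> s powr (1 / p j)" for j
  proof -
    have "a j powr p j \<le> s" unfolding s_def by (rule member_le_sum) auto
    then have "(a j powr p j) powr (1 / p j) \<le> s powr (1 / p j)" using p(1)[of j] by (intro powr_mono2) auto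
    then show ?thesis using assms(2)[of j] p(1)[of j] by (simp add: powr_powr)
  qed
  then have "(\<Prod>j\<in>UNIV. a j) \<le> (\<Prod>j\<in>UNIV. s powr (1 / p j))" using assms(2) by (intro prod_mono) auto
  also have "\<dots> = s"
  proof (cases "s = 0")
    case True then show ?thesis by simp
  next
    case False
    have "s \<ge> 0" unfolding s_def by (simp add: sum_nonneg)
    then show ?thesis using False p(2) by (simp add: powr_sum[symmetric])
  qed
  finally show ?thesis by (simp add: s_def)
qed

text \<open>Convexity: the right side is the tangent line of the power at \<open>a\<close>. Young's
  inequality with the conjugate exponent \<open>q\<close> yields it without derivatives, and so also
  at \<open>a = 0\<close>.\<close>

lemma powr_ge_tangent:
  fixes x a p :: real
  assumes "x \<ge> 0" "a \<ge> 0" "p > 1"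
  shows "x powr p \<ge> p * a powr (p - 1) * x - (p - 1) * a powr p"
proof -
  define q where "q = p / (p - 1)"
  have "p > 0" "q > 0" "1/p + 1/q = 1" using assms by (auto simp: q_def divide_simps)
  then have "x * a powr (p - 1) \<le> x powr p / p + (a powr (p - 1)) powr q / q"
    using assms by (intro Youngs_inequality) (auto simp: q_def)
  moreover have "(a powr (p - 1)) powr q = a powr p" using assms by (simp add: powr_powr q_def)
  ultimately have "x * a powr (p - 1) \<le> x powr p / p + a powr p * (p - 1) / p" by (simp add: q_def)
  then have "p * (x * a powr (p - 1)) \<le> p * (x powr p / p + a powr p * (p - 1) / p)"
    using assms by (intro mult_left_mono) auto
  also have "\<dots> = x powr p + a powr p * (p - 1)" using assms by (simp add: field_simps)
  finally show ?thesis by (simp add: algebra_simps)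
qed

text \<open>Since \<open>y\<close> is at least 1 in absolute value, an increment of
  \<open>x / y\<close> is controlled by the increments of \<open>x\<close> and \<open>y\<close>. By
  the variance identity \<open>var\<close>, the weighted squares of the latter are a difference of
  energies between children and parent, a form that telescopes along a tree.\<close>

lemma quotient_energy:
  fixes w x y :: "'q \<Rightarrow> real"
  assumes "\<And>R. R \<in> Ch \<Longrightarrow> w R \<ge> 0" and W: "wP = (\<Sum>R\<in>Ch. w R)"
    and X: "wP * xP = (\<Sum>R\<in>Ch. w R * x R)" and Y: "wP * yP = (\<Sum>R\<in>Ch. w R * y R)"
    and y: "\<And>R. R \<in> Ch \<Longrightarrow> \<bar>y R\<bar> \<ge> 1" "\<bar>yP\<bar> \<ge> 1" and xP: "\<bar>xP\<bar> \<le> k"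
  shows "(\<Sum>R\<in>Ch. w R * (x R / y R - xP / yP)\<^sup>2)
    \<le> (\<Sum>R\<in>Ch. w R * (2 * (x R)\<^sup>2 + 2 * k\<^sup>2 * (y R)\<^sup>2)) - wP * (2 * xP\<^sup>2 + 2 * k\<^sup>2 * yP\<^sup>2)"
proof -
  have var: "(\<Sum>R\<in>Ch. w R * (u R - uP)\<^sup>2) = (\<Sum>R\<in>Ch. w R * (u R)\<^sup>2) - wP * uP\<^sup>2"
    if "wP * uP = (\<Sum>R\<in>Ch. w R * u R)" for u uP
  proof -
    have "(\<Sum>R\<in>Ch. w R * (u R - uP)\<^sup>2) = (\<Sum>R\<in>Ch. w R * (u R)\<^sup>2 - 2 * uP * (w R * u R) + uP\<^sup>2 * w R)"
      by (rule sum.cong) (auto simp: power2_eq_square algebra_simps)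
    also have "\<dots> = (\<Sum>R\<in>Ch. w R * (u R)\<^sup>2) - 2 * uP * (wP * uP) + uP\<^sup>2 * wP"
      unfolding that unfolding W sum.distrib sum_subtractf sum_distrib_left[symmetric] ..
    finally show ?thesis by (simp add: power2_eq_square algebra_simps)
  qed
  have "(x R / y R - xP / yP)\<^sup>2 \<le> 2 * (x R - xP)\<^sup>2 + 2 * k\<^sup>2 * (y R - yP)\<^sup>2" if R: "R \<in> Ch" for R
  proof -
    have nz: "y R \<noteq> 0" "yP \<noteq> 0" using y(1)[OF R] y(2) by auto
    have "x R / y R - xP / yP = (x R - xP) / y R - (xP / yP) * (y R - yP) / y R"
      using nz by (simp add: field_simps)
    moreover have "\<bar>(x R - xP) / y R\<bar> \<le> \<bar>x R - xP\<bar>"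
      using y(1)[OF R] by (simp add: divide_le_eq mult_le_cancel_left1 zero_less_abs_iff[symmetric] del: zero_less_abs_iff)
    moreover have "\<bar>(xP / yP) * (y R - yP) / y R\<bar> \<le> k * \<bar>y R - yP\<bar>"
    proof -
      have a: "\<bar>xP / yP\<bar> \<le> \<bar>xP\<bar> / 1" unfolding abs_divide by (rule divide_left_mono) (use y(2) in auto)
      have "\<bar>(xP / yP) * (y R - yP)\<bar> \<le> k * \<bar>y R - yP\<bar>"
        unfolding abs_mult by (rule mult_right_mono) (use a xP in auto)
      moreover have "\<bar>(xP / yP) * (y R - yP)\<bar> / \<bar>y R\<bar> \<le> \<bar>(xP / yP) * (y R - yP)\<bar> / 1"
        by (rule divide_left_mono) (use y(1)[OF R] in auto)
      ultimately show ?thesis unfolding abs_divide[of "xP / yP * (y R - yP)"] by linarith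
    qed
    ultimately have "\<bar>x R / y R - xP / yP\<bar> \<le> \<bar>x R - xP\<bar> + k * \<bar>y R - yP\<bar>" by linarith
    then have "(x R / y R - xP / yP)\<^sup>2 \<le> (\<bar>x R - xP\<bar> + k * \<bar>y R - yP\<bar>)\<^sup>2"
      by (metis abs_ge_zero power2_abs power_mono)
    also have "\<dots> \<le> 2 * (x R - xP)\<^sup>2 + 2 * k\<^sup>2 * (y R - yP)\<^sup>2"
    proof -
      have "0 \<le> (\<bar>x R - xP\<bar> - k * \<bar>y R - yP\<bar>)\<^sup>2" by simp
      then have "2 * \<bar>x R - xP\<bar> * (k * \<bar>y R - yP\<bar>) \<le> (x R - xP)\<^sup>2 + k\<^sup>2 * (y R - yP)\<^sup>2"
        unfolding power2_diff[of "\<bar>x R - xP\<bar>"] power_mult_distrib power2_abs by linarith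
      then show ?thesis unfolding power2_sum power_mult_distrib power2_abs by linarith
    qed
    finally show ?thesis .
  qed
  then have "(\<Sum>R\<in>Ch. w R * (x R / y R - xP / yP)\<^sup>2) \<le> (\<Sum>R\<in>Ch. w R * (2 * (x R - xP)\<^sup>2 + 2 * k\<^sup>2 * (y R - yP)\<^sup>2))"
    using assms(1) by (intro sum_mono mult_left_mono) auto
  also have "\<dots> = 2 * (\<Sum>R\<in>Ch. w R * (x R - xP)\<^sup>2) + 2 * k\<^sup>2 * (\<Sum>R\<in>Ch. w R * (y R - yP)\<^sup>2)"
    by (simp add: sum.distrib sum_distrib_left algebra_simps)
  also have "\<dots> = (\<Sum>R\<in>Ch. w R * (2 * (x R)\<^sup>2 + 2 * k\<^sup>2 * (y R)\<^sup>2)) - wP * (2 * xP\<^sup>2 + 2 * k\<^sup>2 * yP\<^sup>2)"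
    unfolding var[OF X] var[OF Y] by (simp add: sum.distrib sum_distrib_left algebra_simps)
  finally show ?thesis .
qed

text \<open>A predicate, so that the constant can be fixed before the form and the tree are given. The type
  arguments only record the types of the nodes and of the indices of the functions.\<close>

definition step_constant :: "'q itself \<Rightarrow> 'n::finite itself \<Rightarrow> real \<Rightarrow> real \<Rightarrow> real \<Rightarrow> nat \<Rightarrow> real \<Rightarrow> bool" where
  "step_constant _ _ K B B1 N C \<longleftrightarrow> (\<forall>(Ch :: 'q set) (w :: 'q \<Rightarrow> real) wP (A :: 'n::finite \<Rightarrow> real) \<phi> \<phi>P \<psi> \<psi>P lam.
    card Ch = N \<longrightarrow> (\<forall>R\<in>Ch. w R > 0 \<and> wP = N * w R) \<longrightarrow>
    (\<forall>j. A j \<ge> 0 \<and> \<bar>\<phi>P j\<bar> \<le> K * A j \<and> (\<forall>R\<in>Ch. \<bar>\<phi> j R\<bar> \<le> N * K * A j)) \<longrightarrow>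
    (\<forall>\<rho>\<in>PiE UNIV (\<lambda>_. Ch). \<bar>lam \<rho>\<bar> \<le> B1 * wP) \<longrightarrow>
    (\<forall>j. \<bar>\<Sum>\<rho>\<in>PiE UNIV (\<lambda>_. Ch). lam \<rho> * (\<phi> j (\<rho> j) - \<phi>P j)\<bar>
          \<le> B * (\<Sum>R\<in>Ch. w R * (\<bar>\<phi> j R - \<phi>P j\<bar> * \<bar>\<psi> j R - \<psi>P j\<bar>))) \<longrightarrow>
    \<bar>\<Sum>\<rho>\<in>PiE UNIV (\<lambda>_. Ch). lam \<rho> * ((\<Prod>j\<in>UNIV. \<phi> j (\<rho> j)) - (\<Prod>j\<in>UNIV. \<phi>P j))\<bar>
      \<le> C * (\<Prod>j\<in>UNIV. A j) * (\<Sum>j\<in>UNIV. \<Sum>R\<in>Ch. w R * (((\<phi> j R - \<phi>P j) / A j)\<^sup>2 + (\<psi> j R - \<psi>P j)\<^sup>2)))"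

text \<open>After division by \<open>A j\<close> all values and increments are bounded by
  \<open>c\<close>. The remainder of order two is summed over the \<open>N ^ n\<close> tuples with
  the bound on \<open>lam\<close>. The linear terms are covered by the assumption that pairs
  \<open>\<phi>\<close> with \<open>\<psi>\<close>, where each product of increments is split into
  squares.\<close>

lemma step_constant_exists:
  fixes K B B1 :: real and N :: nat
  assumes "K \<ge> 1" "B \<ge> 0" "B1 \<ge> 0" "N > 0"
  shows "\<exists>C\<ge>0. step_constant TYPE('q) TYPE('n::finite) K B B1 N C"
proof -
  \<comment> \<open>A child value is at most \<open>N * K * A j\<close>, and so is the parent value;
    hence the factor 2 for an increment.\<close>
  define c where "c = 2 * N * K"
  have N1: "real N \<ge> 1" using assms by simp
  have NK: "K \<le> real N * K" using N1 assms(1) by (simp add: mult_le_cancel_right1)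
  have c: "c \<ge> K" "c \<ge> 0" using NK assms by (auto simp: c_def)
  obtain C1 where C1: "C1 \<ge> 0" "\<And>(q :: 'n \<Rightarrow> real) \<delta>. (\<forall>j. \<bar>q j\<bar> \<le> c \<and> \<bar>\<delta> j\<bar> \<le> c) \<Longrightarrow>
    \<bar>(\<Prod>j\<in>UNIV. q j + \<delta> j) - (\<Prod>j\<in>UNIV. q j) - (\<Sum>j\<in>UNIV. \<delta> j * (\<Prod>i\<in>UNIV - {j}. q i))\<bar> \<le> C1 * (\<Sum>j\<in>UNIV. (\<delta> j)\<^sup>2)"
    using prod_remainder_bound[of "UNIV :: 'n set" c] c by auto
  define n where "n = CARD('n)"
  define C where "C = N ^ n * (B1 * N * C1) + c ^ (n - 1) * B"
  have "C \<ge> 0" using assms C1 c by (simp add: C_def)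
  show ?thesis unfolding step_constant_def
  proof (intro exI[of _ C] conjI allI impI)
    show "C \<ge> 0" by fact
  next
    fix Ch :: "'q set" and w :: "'q \<Rightarrow> real" and wP and A :: "'n \<Rightarrow> real" and \<phi> :: "'n \<Rightarrow> 'q \<Rightarrow> real" and \<phi>P and \<psi> :: "'n \<Rightarrow> 'q \<Rightarrow> real"
      and \<psi>P lam
    assume card: "card Ch = N" and w: "\<forall>R\<in>Ch. w R > 0 \<and> wP = N * w R"
      and A: "\<forall>j. A j \<ge> 0 \<and> \<bar>\<phi>P j\<bar> \<le> K * A j \<and> (\<forall>R\<in>Ch. \<bar>\<phi> j R\<bar> \<le> N * K * A j)"
      and lam: "\<forall>\<rho>\<in>PiE UNIV (\<lambda>_. Ch). \<bar>lam \<rho>\<bar> \<le> B1 * wP"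
      and lin: "\<forall>j. \<bar>\<Sum>\<rho>\<in>PiE UNIV (\<lambda>_. Ch). lam \<rho> * (\<phi> j (\<rho> j) - \<phi>P j)\<bar>
          \<le> B * (\<Sum>R\<in>Ch. w R * (\<bar>\<phi> j R - \<phi>P j\<bar> * \<bar>\<psi> j R - \<psi>P j\<bar>))"
    have fin: "finite Ch" using card assms(4) by (simp add: card_ge_0_finite)
    let ?P = "PiE (UNIV :: 'n set) (\<lambda>_. Ch)"
    have finP: "finite ?P" by (intro finite_PiE) (auto simp: fin)
    define q where "q j = \<phi>P j / A j" for j
    define d where "d j R = (\<phi> j R - \<phi>P j) / A j" for j R
    define D where "D = (\<Sum>j\<in>UNIV. \<Sum>R\<in>Ch. w R * ((d j R)\<^sup>2 + (\<psi> j R - \<psi>P j)\<^sup>2))"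
    define PA where "PA = (\<Prod>j\<in>UNIV. A j)"
    have PA: "PA \<ge> 0" unfolding PA_def using A by (simp add: prod_nonneg)
    \<comment> \<open>If \<open>A j = 0\<close>, all values vanish by assumption and division by
      zero gives 0, so these factorisations hold in that case too.\<close>
    have \<phi>P: "\<phi>P j = A j * q j" for j
      using A[rule_format, of j] by (cases "A j = 0") (auto simp: q_def)
    have \<phi>: "\<phi> j R = A j * (q j + d j R)" if "R \<in> Ch" for j R
      using A[rule_format, of j] that by (cases "A j = 0") (auto simp: q_def d_def field_simps)
    have qK: "\<bar>q j\<bar> \<le> K" for j
      using A[rule_format, of j] assms(1) by (cases "A j = 0") (auto simp: q_def field_simps)
    have dc: "\<bar>d j R\<bar> \<le> c" if "R \<in> Ch" for j R
    proof (cases "A j = 0")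
      case False
      then have Aj: "A j > 0" using A by (metis less_eq_real_def)
      have "\<bar>\<phi> j R - \<phi>P j\<bar> \<le> \<bar>\<phi> j R\<bar> + \<bar>\<phi>P j\<bar>" by simp
      also have "\<dots> \<le> N * K * A j + N * K * A j" 
        using A that mult_right_mono[OF NK, of "A j"] Aj by (intro add_mono) (auto intro: order_trans)
      finally have "\<bar>\<phi> j R - \<phi>P j\<bar> \<le> c * A j" unfolding c_def by linarith
      then show ?thesis using Aj by (simp add: d_def abs_divide divide_le_eq)
    qed (use c in \<open>auto simp: d_def\<close>)
    define r where "r \<rho> = (\<Prod>j\<in>UNIV. q j + d j (\<rho> j)) - (\<Prod>j\<in>UNIV. q j) - (\<Sum>j\<in>UNIV. d j (\<rho> j) * (\<Prod>i\<in>UNIV - {j}. q i))" for \<rho>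
    have "(\<Sum>\<rho>\<in>?P. lam \<rho> * ((\<Prod>j\<in>UNIV. \<phi> j (\<rho> j)) - (\<Prod>j\<in>UNIV. \<phi>P j)))
       = (\<Sum>\<rho>\<in>?P. PA * (lam \<rho> * r \<rho> + (\<Sum>j\<in>UNIV. (\<Prod>i\<in>UNIV - {j}. q i) * (lam \<rho> * d j (\<rho> j)))))"
    proof (rule sum.cong[OF refl])
      fix \<rho> assume "\<rho> \<in> ?P"
      then have "\<And>j. \<rho> j \<in> Ch" by auto
      then have "(\<Prod>j\<in>UNIV. \<phi> j (\<rho> j)) = PA * (\<Prod>j\<in>UNIV. q j + d j (\<rho> j))"
        by (simp add: \<phi> prod.distrib PA_def)
      moreover have "(\<Prod>j\<in>UNIV. \<phi>P j) = PA * (\<Prod>j\<in>UNIV. q j)" by (simp add: \<phi>P prod.distrib PA_def)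
      moreover have "(\<Prod>j\<in>UNIV. q j + d j (\<rho> j)) = r \<rho> + (\<Prod>j\<in>UNIV. q j) + (\<Sum>j\<in>UNIV. d j (\<rho> j) * (\<Prod>i\<in>UNIV - {j}. q i))"
        by (simp add: r_def)
      moreover have "lam \<rho> * (\<Sum>j\<in>UNIV. d j (\<rho> j) * (\<Prod>i\<in>UNIV - {j}. q i)) = (\<Sum>j\<in>UNIV. (\<Prod>i\<in>UNIV - {j}. q i) * (lam \<rho> * d j (\<rho> j)))"
        by (simp add: sum_distrib_left algebra_simps)
      ultimately show "lam \<rho> * ((\<Prod>j\<in>UNIV. \<phi> j (\<rho> j)) - (\<Prod>j\<in>UNIV. \<phi>P j)) =
        PA * (lam \<rho> * r \<rho> + (\<Sum>j\<in>UNIV. (\<Prod>i\<in>UNIV - {j}. q i) * (lam \<rho> * d j (\<rho> j))))"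
        by (simp add: algebra_simps)
    qed
    also have "\<dots> = PA * ((\<Sum>\<rho>\<in>?P. lam \<rho> * r \<rho>) + (\<Sum>j\<in>UNIV. (\<Prod>i\<in>UNIV - {j}. q i) * (\<Sum>\<rho>\<in>?P. lam \<rho> * d j (\<rho> j))))"
      unfolding sum_distrib_left[symmetric] sum.distrib
      by (subst sum.swap) (simp add: sum_distrib_left)
    finally have eq: "(\<Sum>\<rho>\<in>?P. lam \<rho> * ((\<Prod>j\<in>UNIV. \<phi> j (\<rho> j)) - (\<Prod>j\<in>UNIV. \<phi>P j))) = \<dots>" .
    have "\<bar>\<Sum>\<rho>\<in>?P. lam \<rho> * r \<rho>\<bar> \<le> (\<Sum>\<rho>\<in>?P. B1 * N * C1 * D)"
    proof (rule order_trans[OF sum_abs], rule sum_mono)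
      fix \<rho> assume \<rho>: "\<rho> \<in> ?P"
      then have \<rho>': "\<And>j. \<rho> j \<in> Ch" by auto
      then have wP: "wP = N * w (\<rho> j)" for j using w by blast
      have wP0: "wP \<ge> 0" unfolding wP[of undefined] using w \<rho>'[of undefined] by (meson less_imp_le mult_nonneg_nonneg of_nat_0_le_iff)
      have "\<bar>r \<rho>\<bar> \<le> C1 * (\<Sum>j\<in>UNIV. (d j (\<rho> j))\<^sup>2)"
        unfolding r_def using qK c dc \<rho>' by (intro C1(2)) (auto intro: order_trans)
      then have "\<bar>lam \<rho> * r \<rho>\<bar> \<le> (B1 * wP) * (C1 * (\<Sum>j\<in>UNIV. (d j (\<rho> j))\<^sup>2))"
        unfolding abs_mult using lam \<rho> wP0 assms C1 by (intro mult_mono) (auto intro!: mult_nonneg_nonneg sum_nonneg)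
      also have "\<dots> = B1 * C1 * (\<Sum>j\<in>UNIV. wP * (d j (\<rho> j))\<^sup>2)" by (simp add: sum_distrib_left algebra_simps)
      also have "\<dots> = B1 * N * C1 * (\<Sum>j\<in>UNIV. w (\<rho> j) * (d j (\<rho> j))\<^sup>2)"
      proof -
        have "(\<Sum>j\<in>UNIV. wP * (d j (\<rho> j))\<^sup>2) = (\<Sum>j\<in>UNIV. N * (w (\<rho> j) * (d j (\<rho> j))\<^sup>2))"
          by (rule sum.cong[OF refl]) (simp add: wP mult.assoc)
        then show ?thesis by (simp add: sum_distrib_left[symmetric])
      qed
      also have "\<dots> \<le> B1 * N * C1 * D"
      proof (rule mult_left_mono)
        show "(\<Sum>j\<in>UNIV. w (\<rho> j) * (d j (\<rho> j))\<^sup>2) \<le> D" unfolding D_def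
        proof (rule sum_mono)
          fix j
          have "w (\<rho> j) * (d j (\<rho> j))\<^sup>2 \<le> w (\<rho> j) * ((d j (\<rho> j))\<^sup>2 + (\<psi> j (\<rho> j) - \<psi>P j)\<^sup>2)"
            using w \<rho>' by (intro mult_left_mono) (auto intro: less_imp_le)
          also have "\<dots> \<le> (\<Sum>R\<in>Ch. w R * ((d j R)\<^sup>2 + (\<psi> j R - \<psi>P j)\<^sup>2))"
            using w \<rho>' by (intro member_le_sum[where f = "\<lambda>R. w R * ((d j R)\<^sup>2 + (\<psi> j R - \<psi>P j)\<^sup>2)"] fin) (auto intro!: mult_nonneg_nonneg intro: less_imp_le)
          finally show "w (\<rho> j) * (d j (\<rho> j))\<^sup>2 \<le> (\<Sum>R\<in>Ch. w R * ((d j R)\<^sup>2 + (\<psi> j R - \<psi>P j)\<^sup>2))" .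
        qed
      qed (use assms C1 in auto)
      finally show "\<bar>lam \<rho> * r \<rho>\<bar> \<le> B1 * N * C1 * D" .
    qed
    also have "\<dots> = N ^ n * (B1 * N * C1) * D" by (simp add: card_PiE card n_def)
    finally have b1: "\<bar>\<Sum>\<rho>\<in>?P. lam \<rho> * r \<rho>\<bar> \<le> N ^ n * (B1 * N * C1) * D" .
    have "\<bar>\<Sum>j\<in>UNIV. (\<Prod>i\<in>UNIV - {j}. q i) * (\<Sum>\<rho>\<in>?P. lam \<rho> * d j (\<rho> j))\<bar>
      \<le> (\<Sum>j\<in>UNIV. c ^ (n - 1) * (B * (\<Sum>R\<in>Ch. w R * ((d j R)\<^sup>2 + (\<psi> j R - \<psi>P j)\<^sup>2))))"
    proof (rule order_trans[OF sum_abs], rule sum_mono)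
      fix j
      have "\<bar>\<Prod>i\<in>UNIV - {j}. q i\<bar> \<le> (\<Prod>i\<in>UNIV - {j}. c)"
        unfolding abs_prod using qK c by (intro prod_mono) (auto intro: order_trans)
      then have 1: "\<bar>\<Prod>i\<in>UNIV - {j}. q i\<bar> \<le> c ^ (n - 1)" by (simp add: n_def)
      have "(\<Sum>\<rho>\<in>?P. lam \<rho> * d j (\<rho> j)) = (\<Sum>\<rho>\<in>?P. lam \<rho> * (\<phi> j (\<rho> j) - \<phi>P j)) / A j"
        by (simp add: d_def sum_divide_distrib)
      then have "\<bar>\<Sum>\<rho>\<in>?P. lam \<rho> * d j (\<rho> j)\<bar> \<le> B * (\<Sum>R\<in>Ch. w R * (\<bar>\<phi> j R - \<phi>P j\<bar> * \<bar>\<psi> j R - \<psi>P j\<bar>)) / A j"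
        using lin[rule_format, of j] A by (simp add: divide_right_mono abs_divide)
      also have "\<dots> = B * (\<Sum>R\<in>Ch. w R * (\<bar>d j R\<bar> * \<bar>\<psi> j R - \<psi>P j\<bar>))"
        using A by (simp add: d_def abs_divide sum_divide_distrib sum_distrib_left)
      also have "\<dots> \<le> B * (\<Sum>R\<in>Ch. w R * ((d j R)\<^sup>2 + (\<psi> j R - \<psi>P j)\<^sup>2))"
      proof (intro mult_left_mono sum_mono)
        fix R assume "R \<in> Ch"
        then show "0 \<le> w R" using w by (auto intro: less_imp_le)
        have "0 \<le> (\<bar>d j R\<bar> - \<bar>\<psi> j R - \<psi>P j\<bar>)\<^sup>2" "0 \<le> (d j R)\<^sup>2 + (\<psi> j R - \<psi>P j)\<^sup>2" by simp_all
        then show "\<bar>d j R\<bar> * \<bar>\<psi> j R - \<psi>P j\<bar> \<le> (d j R)\<^sup>2 + (\<psi> j R - \<psi>P j)\<^sup>2"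
          unfolding power2_diff[of "\<bar>d j R\<bar>"] power2_abs by linarith
      qed fact
      finally show "\<bar>(\<Prod>i\<in>UNIV - {j}. q i) * (\<Sum>\<rho>\<in>?P. lam \<rho> * d j (\<rho> j))\<bar> \<le> c ^ (n - 1) * (B * (\<Sum>R\<in>Ch. w R * ((d j R)\<^sup>2 + (\<psi> j R - \<psi>P j)\<^sup>2)))"
        unfolding abs_mult using 1 c by (intro mult_mono) auto
    qed
    also have "\<dots> = c ^ (n - 1) * B * D" by (simp add: D_def sum_distrib_left mult.assoc)
    finally have b2: "\<bar>\<Sum>j\<in>UNIV. (\<Prod>i\<in>UNIV - {j}. q i) * (\<Sum>\<rho>\<in>?P. lam \<rho> * d j (\<rho> j))\<bar> \<le> c ^ (n - 1) * B * D" .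
    have "\<bar>(\<Sum>\<rho>\<in>?P. lam \<rho> * r \<rho>) + (\<Sum>j\<in>UNIV. (\<Prod>i\<in>UNIV - {j}. q i) * (\<Sum>\<rho>\<in>?P. lam \<rho> * d j (\<rho> j)))\<bar> \<le> C * D"
      using b1 b2 unfolding C_def distrib_right by linarith
    then have "\<bar>\<Sum>\<rho>\<in>?P. lam \<rho> * ((\<Prod>j\<in>UNIV. \<phi> j (\<rho> j)) - (\<Prod>j\<in>UNIV. \<phi>P j))\<bar> \<le> PA * (C * D)"
      unfolding eq abs_mult using PA by (simp add: mult_left_mono)
    then show "\<bar>\<Sum>\<rho>\<in>?P. lam \<rho> * ((\<Prod>j\<in>UNIV. \<phi> j (\<rho> j)) - (\<Prod>j\<in>UNIV. \<phi>P j))\<bar>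
      \<le> C * (\<Prod>j\<in>UNIV. A j) * (\<Sum>j\<in>UNIV. \<Sum>R\<in>Ch. w R * (((\<phi> j R - \<phi>P j) / A j)\<^sup>2 + (\<psi> j R - \<psi>P j)\<^sup>2))"
      by (simp add: PA_def D_def d_def mult.assoc mult.left_commute)
  qed
qed

section \<open>Weighted trees and martingales\<close>

text \<open>Children are constrained only above level 0: the dyadic tree is cut off at a finest
  scale, whose cubes still have dyadic children outside the tree.\<close>

locale weighted_tree =
  fixes Qs :: "'q set" and lev :: "'q \<Rightarrow> nat" and ch :: "'q \<Rightarrow> 'q set" and w :: "'q \<Rightarrow> real" and N :: nat
  assumes w_pos: "Q \<in> Qs \<Longrightarrow> w Q > 0"
    and ch_sub: "P \<in> Qs \<Longrightarrow> lev P > 0 \<Longrightarrow> R \<in> ch P \<Longrightarrow> R \<in> Qs"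
    and lev_ch: "P \<in> Qs \<Longrightarrow> lev P > 0 \<Longrightarrow> R \<in> ch P \<Longrightarrow> lev R < lev P"
    and card_ch: "P \<in> Qs \<Longrightarrow> lev P > 0 \<Longrightarrow> card (ch P) = N"
    and w_ch: "P \<in> Qs \<Longrightarrow> lev P > 0 \<Longrightarrow> R \<in> ch P \<Longrightarrow> w P = N * w R"
    and N_pos: "N > 0"
begin

text \<open>The martingale property in integrated form: \<open>w Q * u Q\<close> plays the part of
  an integral over \<open>Q\<close>, which is additive over the children.\<close>

definition mart :: "('q \<Rightarrow> real) \<Rightarrow> bool" where
  "mart u \<longleftrightarrow> (\<forall>P\<in>Qs. lev P > 0 \<longrightarrow> w P * u P = (\<Sum>R\<in>ch P. w R * u R))"

lemma martD: "mart u \<Longrightarrow> P \<in> Qs \<Longrightarrow> lev P > 0 \<Longrightarrow> w P * u P = (\<Sum>R\<in>ch P. w R * u R)"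
  by (simp add: mart_def)

lemma finite_ch: "P \<in> Qs \<Longrightarrow> lev P > 0 \<Longrightarrow> finite (ch P)"
  using card_ch N_pos by (metis card_ge_0_finite)

lemma w_sum: "P \<in> Qs \<Longrightarrow> lev P > 0 \<Longrightarrow> w P = (\<Sum>R\<in>ch P. w R)"
proof -
  assume P: "P \<in> Qs" "lev P > 0"
  have "N * (\<Sum>R\<in>ch P. w R) = (\<Sum>R\<in>ch P. w P)"
    unfolding sum_distrib_left by (rule sum.cong) (use P w_ch in auto)
  then show ?thesis using card_ch[OF P] N_pos by simp
qed

lemma mart_const: "mart (\<lambda>Q. c)"
  by (auto simp: mart_def w_sum sum_distrib_right)

lemma mart_add: "mart u \<Longrightarrow> mart v \<Longrightarrow> mart (\<lambda>Q. u Q + v Q)"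
  by (auto simp: mart_def distrib_left sum.distrib)

lemma mart_cmult: "mart u \<Longrightarrow> mart (\<lambda>Q. c * u Q)"
  by (auto simp: mart_def mult.left_commute[of _ c] sum_distrib_left[symmetric])

lemma mart_diff: "mart u \<Longrightarrow> mart v \<Longrightarrow> mart (\<lambda>Q. u Q - v Q)"
  by (auto simp: mart_def right_diff_distrib sum_subtractf)

lemma mart_sum: "(\<And>i. i \<in> I \<Longrightarrow> mart (u i)) \<Longrightarrow> mart (\<lambda>Q. \<Sum>i\<in>I. u i Q)"
  by (induction I rule: infinite_finite_induct) (auto intro: mart_add mart_const)

text \<open>The child contributes one summand of a nonnegative sum and carries the fraction
  \<open>1 / N\<close> of the weight. This keeps averages bounded on the first stopping cubes, whose
  parents are still good.\<close>

lemma mart_child_le: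
  assumes "mart u" "P \<in> Qs" "lev P > 0" "R \<in> ch P" "\<And>Q. Q \<in> Qs \<Longrightarrow> u Q \<ge> (0::real)"
  shows "u R \<le> real N * u P"
proof -
  have "w R * u R \<le> (\<Sum>R\<in>ch P. w R * u R)"
    using assms by (intro member_le_sum[where f = "\<lambda>R. w R * u R"] finite_ch)
      (auto intro!: mult_nonneg_nonneg less_imp_le[OF w_pos] dest: ch_sub)
  also have "\<dots> = N * w R * u P" using martD assms w_ch by (metis)
  finally have "w R * u R \<le> w R * (N * u P)" by (simp add: mult.assoc mult.left_commute)
  then show ?thesis using w_pos[OF ch_sub[OF assms(2-4)]] by simp
qed

end

section \<open>The stopping time induction\<close>

text \<open>In the application \<open>x\<close>, \<open>X\<close>, \<open>F\<close>,
  \<open>y\<close>, \<open>z\<close> are the averages of \<open>f j\<close>, of its absolute value,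
  of the power \<open>p j\<close> of that, of \<open>b j\<close> and of
  \<open>\<beta> j * b j\<close>, and \<open>G\<close> is the defect. In \<open>bmo\<close>,
  \<open>c\<close> is the mean of \<open>\<beta> j\<close> over \<open>Q\<close> and
  \<open>t\<close> averages the distance to it. In \<open>step\<close> the \<open>A j\<close> and
  \<open>c j\<close> stay free, since they are fixed only once a top cube \<open>Q0\<close> is
  chosen.\<close>

locale tb_tree = weighted_tree Qs lev ch w N
  for Qs :: "'q set" and lev ch w N +
  fixes p :: "'n::finite \<Rightarrow> real" and x X F y z :: "'n \<Rightarrow> 'q \<Rightarrow> real" and G :: "'q \<Rightarrow> real"
    and K B Cs :: real
  assumes p: "hoelder_tuple p"
    and K_def: "K = 4 * CARD('n)" and B: "B \<ge> 1" and Cs: "Cs \<ge> 0"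
    and marts: "mart (x j)" "mart (X j)" "mart (F j)" "mart (y j)" "mart (z j)"
    and xX: "Q \<in> Qs \<Longrightarrow> \<bar>x j Q\<bar> \<le> X j Q"
    and y: "Q \<in> Qs \<Longrightarrow> 1 \<le> \<bar>y j Q\<bar>" "Q \<in> Qs \<Longrightarrow> \<bar>y j Q\<bar> \<le> B"
    and bmo: "Q \<in> Qs \<Longrightarrow> \<exists>c t. mart t \<and> t Q \<le> 2 * B \<and> (\<forall>R\<in>Qs. t R \<ge> 0 \<and> \<bar>z j R - c * y j R\<bar> \<le> B * t R)"
    and leaf: "Q \<in> Qs \<Longrightarrow> lev Q = 0 \<Longrightarrow> G Q = 0" "Q \<in> Qs \<Longrightarrow> lev Q = 0 \<Longrightarrow> F j Q = X j Q powr p j"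
    and step: "\<And>P A c. P \<in> Qs \<Longrightarrow> lev P > 0 \<Longrightarrow>
      (\<And>j. \<bar>x j P\<bar> \<le> K * A j) \<Longrightarrow> (\<And>j R. R \<in> ch P \<Longrightarrow> \<bar>x j R\<bar> \<le> N * K * A j) \<Longrightarrow>
      \<bar>G P - (\<Sum>R\<in>ch P. G R)\<bar> \<le> Cs * (\<Prod>j\<in>UNIV. A j) *
        (\<Sum>j\<in>UNIV. \<Sum>R\<in>ch P. w R * (((x j R / y j R - x j P / y j P) / A j)\<^sup>2
           + ((z j R - c j * y j R) / y j R - (z j P - c j * y j P) / y j P)\<^sup>2))"
begin

text \<open>Bounds the energy \<open>V\<close> of the induction at the good nodes and at their
  children; the four terms bound its four squares.\<close>

definition E :: real where
  "E = CARD('n) * (2 * (N * K)\<^sup>2 + 2 * K\<^sup>2 * B\<^sup>2 + 2 * (N * (2 * K * B\<^sup>2))\<^sup>2 + 2 * (2 * K * B\<^sup>2)\<^sup>2 * B\<^sup>2)"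

text \<open>The gain from convexity: at the top cube the affine majorant leaves the coefficient
  \<open>(2/3) powr (p j - 1)\<close>, while \<open>H\<close> asks only for
  \<open>(1/2) powr (p j - 1)\<close>.\<close>

definition eps :: "'n \<Rightarrow> real" where
  "eps j = (2/3) powr (p j - 1) - (1/2) powr (p j - 1)"

text \<open>Chosen so that \<open>C' * eps j\<close> dominates \<open>Cs * E\<close> for every
  \<open>j\<close>. It depends only on \<open>N\<close>, \<open>p\<close>, \<open>K\<close>,
  \<open>B\<close> and \<open>Cs\<close>, so it is uniform in the form and in the tree.\<close>

definition C' :: real where
  "C' = Cs * E * (\<Sum>j\<in>UNIV. 1 / eps j)"

definition H :: "'q \<Rightarrow> real" where
  "H Q = C' * (\<Sum>j\<in>UNIV. F j Q - (1/2) powr (p j - 1) * X j Q powr p j)"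

lemma p1: "p j > 1" using p by (simp add: hoelder_tuple_def)

lemma K: "K \<ge> 4"
  unfolding K_def using zero_less_card_finite[where 'a='n] by (simp add: Suc_leI)

lemma eps_pos: "eps j > 0"
  unfolding eps_def using p1[of j] by (simp add: powr_less_mono2)

lemma E_nonneg: "E \<ge> 0" by (simp add: E_def)

lemma C'_nonneg: "C' \<ge> 0"
  unfolding C'_def using Cs E_nonneg eps_pos by (intro mult_nonneg_nonneg sum_nonneg) (auto intro: less_imp_le)

lemma C'_eps: "C' * eps j \<ge> Cs * E"
proof -
  have "1 / eps j \<le> (\<Sum>j\<in>UNIV. 1 / eps j)"
    by (rule member_le_sum) (auto intro: less_imp_le eps_pos)
  then have "Cs * E * (1 / eps j) \<le> C'"
    unfolding C'_def using Cs E_nonneg by (intro mult_left_mono) auto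
  then have "Cs * E * (1 / eps j) * eps j \<le> C' * eps j"
    using eps_pos[of j] by (intro mult_right_mono) auto
  then show ?thesis using eps_pos[of j] by simp
qed

lemma X_nonneg: "Q \<in> Qs \<Longrightarrow> X j Q \<ge> 0"
  using xX[of Q j] by linarith

text \<open>Induction on the level of \<open>Q0\<close>. Bad nodes below \<open>Q0\<close> have
  smaller level, so the bound by \<open>H\<close> is known for them. A second induction,
  \<open>main\<close>, climbs from the leaves and the first bad nodes to \<open>Q0\<close> with a
  bound that is additive over children up to an energy term, and this term pays for the error of
  each step.\<close>

lemma G_le_H:
  assumes "Q0 \<in> Qs"
  shows "\<bar>G Q0\<bar> \<le> w Q0 * H Q0"
  using assms
proof (induction "lev Q0" arbitrary: Q0 rule: less_induct)
  case less
  define A where "A j = X j Q0" for j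
  \<comment> \<open>At \<open>Q0\<close> one has \<open>1 + S Q0 \<le> 3 / 2\<close>. The tangent
    point \<open>2 / 3 * A j\<close> maximises
    \<open>p * a powr (p - 1) * A - 3 / 2 * (p - 1) * a powr p\<close>, with maximum
    \<open>(2/3) powr (p - 1) * A powr p\<close>.\<close>
  define a where "a j = 2 / 3 * A j" for j
  have "\<forall>j. \<exists>c t. mart t \<and> t Q0 \<le> 2 * B \<and> (\<forall>R\<in>Qs. t R \<ge> 0 \<and> \<bar>z j R - c * y j R\<bar> \<le> B * t R)"
    using bmo[OF less.prems] by blast
  then obtain c t where ct: "\<And>j. mart (t j)" "\<And>j. t j Q0 \<le> 2 * B" "\<And>j R. R \<in> Qs \<Longrightarrow> t j R \<ge> 0"
    "\<And>j R. R \<in> Qs \<Longrightarrow> \<bar>z j R - c j * y j R\<bar> \<le> B * t j R" by metis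
  have A0: "A j \<ge> 0" "a j \<ge> 0" for j using X_nonneg[OF less.prems] by (auto simp: A_def a_def)
  define S where "S Q = (\<Sum>i\<in>UNIV. 1 / (K * A i) * X i Q + 1 / (K * (2 * B)) * t i Q)" for Q
  \<comment> \<open>\<open>S\<close> dominates the indicator of the bad cubes and \<open>L\<close> is an affine majorant of the summands of \<open>H\<close> on
    them (tangent at \<open>2 * a j\<close>) and a nonnegative function on the leaves (tangent at \<open>a j\<close>), so that both
    add up over the children. The increments of \<open>V\<close> dominate the squares in the assumption \<open>step\<close>.\<close>
  define L where "L j Q = F j Q - p j * a j powr (p j - 1) * X j Q + (p j - 1) * a j powr p j * (1 + S Q)" for j Q
  define V where "V Q = (\<Sum>j\<in>UNIV. 2 * (x j Q / A j)\<^sup>2 + 2 * K\<^sup>2 * (y j Q)\<^sup>2 + 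
      (2 * (z j Q - c j * y j Q)\<^sup>2 + 2 * (2 * K * B\<^sup>2)\<^sup>2 * (y j Q)\<^sup>2))" for Q
  define PA where "PA = (\<Prod>j\<in>UNIV. A j)"
  define good where "good Q \<longleftrightarrow> (\<forall>j. X j Q \<le> K * A j \<and> t j Q \<le> K * (2 * B))" for Q
  have PA: "PA \<ge> 0" using A0 by (auto simp: PA_def intro: prod_nonneg)
  have S0: "S Q \<ge> 0" if "Q \<in> Qs" for Q
    unfolding S_def using A0 K B X_nonneg[OF that] ct(3)[OF that] by (intro sum_nonneg add_nonneg_nonneg mult_nonneg_nonneg) auto
  have mart_L: "mart (L j)" for j
    unfolding L_def S_def by (intro mart_add mart_diff mart_cmult mart_const mart_sum marts ct)
  have bad: "C' * (\<Sum>j\<in>UNIV. L j Q) \<ge> H Q"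
    if Q: "Q \<in> Qs" "\<And>j. X j Q \<le> N * K * A j" "\<not> good Q" for Q
  proof -
    have "S Q \<ge> 1"
    proof -
      obtain j where j: "X j Q > K * A j \<or> t j Q > K * (2 * B)" using Q(3) by (auto simp: good_def not_le)
      have "1 \<le> 1 / (K * A j) * X j Q + 1 / (K * (2 * B)) * t j Q"
      proof (cases "X j Q > K * A j")
        case True
        \<comment> \<open>With \<open>A j = 0\<close> the upper bound would give
          \<open>X j Q \<le> 0\<close>, against \<open>X j Q > K * A j\<close>.\<close>
        then have "A j \<noteq> 0" using Q(2)[of j] by auto
        then have "A j > 0" using A0[of j] by auto
        then have "1 \<le> 1 / (K * A j) * X j Q" using True K by (simp add: field_simps)
        moreover have "0 \<le> 1 / (K * (2 * B)) * t j Q" using K B ct(3)[OF Q(1)] by simp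
        ultimately show ?thesis by linarith
      next
        case False
        then have "t j Q > K * (2 * B)" using j by simp
        then have "1 \<le> 1 / (K * (2 * B)) * t j Q" using K B by (simp add: field_simps)
        moreover have "0 \<le> 1 / (K * A j) * X j Q" using K A0[of j] X_nonneg[OF Q(1), of j] by simp
        ultimately show ?thesis by linarith
      qed
      also have "\<dots> \<le> S Q" unfolding S_def
        using A0 K B X_nonneg[OF Q(1)] ct(3)[OF Q(1)]
        by (intro member_le_sum[where f = "\<lambda>j. 1 / (K * A j) * X j Q + 1 / (K * (2 * B)) * t j Q"] add_nonneg_nonneg mult_nonneg_nonneg) auto
      finally show ?thesis .
    qed
    have "F j Q - (1/2) powr (p j - 1) * X j Q powr p j \<le> L j Q" for j
    proof -
      let ?c = "(1/2) powr (p j - 1)"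
      have "?c * (X j Q powr p j) \<ge> ?c * (p j * (2 * a j) powr (p j - 1) * X j Q - (p j - 1) * (2 * a j) powr p j)"
        using A0 X_nonneg[OF Q(1)] p1 by (intro mult_left_mono powr_ge_tangent) auto
      moreover have e1: "?c * (2 * a j) powr (p j - 1) = a j powr (p j - 1)"
        using A0[of j] by (simp add: powr_mult[symmetric])
      moreover have "?c * (2 * a j) powr p j = 2 * a j powr p j"
      proof (cases "a j = 0")
        case False
        then have "a j > 0" using A0[of j] by simp
        then have "u powr p j = u powr (p j - 1) * u" if "u > 0" for u using that by (simp add: powr_diff)
        then have "?c * (2 * a j) powr p j = (?c * (2 * a j) powr (p j - 1)) * (2 * a j)" "a j powr p j = a j powr (p j - 1) * a j"
          using \<open>a j > 0\<close> by auto
        then show ?thesis unfolding e1 by simp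
      qed simp
      ultimately have "?c * X j Q powr p j \<ge> p j * a j powr (p j - 1) * X j Q - (p j - 1) * (2 * a j powr p j)"
        by (simp only: right_diff_distrib mult.assoc mult.left_commute[of ?c]) (metis mult.assoc mult.left_commute)
      moreover have "(p j - 1) * a j powr p j * (1 + S Q) \<ge> (p j - 1) * a j powr p j * 2"
        using \<open>S Q \<ge> 1\<close> p1[of j] by (intro mult_left_mono) auto
      ultimately show ?thesis unfolding L_def by linarith
    qed
    then show ?thesis unfolding H_def using C'_nonneg by (intro mult_left_mono sum_mono) auto
  qed
  have V_le: "V Q \<le> E" if Q: "Q \<in> Qs" "\<And>j. X j Q \<le> N * K * A j" "\<And>j. t j Q \<le> N * (K * (2 * B))" for Q
  proof -
    have "V Q \<le> (\<Sum>j\<in>(UNIV::'n set). 2 * (N * K)\<^sup>2 + 2 * K\<^sup>2 * B\<^sup>2 + (2 * (N * (2 * K * B\<^sup>2))\<^sup>2 + 2 * (2 * K * B\<^sup>2)\<^sup>2 * B\<^sup>2))"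
      unfolding V_def
    proof (intro sum_mono add_mono mult_left_mono)
      fix j
      have "\<bar>x j Q / A j\<bar> \<le> \<bar>N * K\<bar>"
      proof (cases "A j = 0")
        case False
        then have "A j > 0" using A0[of j] by simp
        moreover have "\<bar>x j Q\<bar> \<le> N * K * A j" using xX[OF Q(1), of j] Q(2)[of j] by linarith
        ultimately show ?thesis using K by (simp add: divide_le_eq abs_divide abs_mult)
      qed simp
      then show "(x j Q / A j)\<^sup>2 \<le> (N * K)\<^sup>2" by (simp only: abs_le_square_iff)
      have "\<bar>y j Q\<bar> \<le> \<bar>B\<bar>" using y(2)[OF Q(1), of j] by simp
      then show "(y j Q)\<^sup>2 \<le> B\<^sup>2" "(y j Q)\<^sup>2 \<le> B\<^sup>2" by (simp_all only: abs_le_square_iff)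
      have "B * t j Q \<le> B * (N * (K * (2 * B)))" using Q(3) B by (intro mult_left_mono) auto
      then have "\<bar>z j Q - c j * y j Q\<bar> \<le> \<bar>N * (2 * K * B\<^sup>2)\<bar>"
        using ct(4)[OF Q(1), of j] K by (simp add: power2_eq_square algebra_simps)
      then show "(z j Q - c j * y j Q)\<^sup>2 \<le> (N * (2 * K * B\<^sup>2))\<^sup>2" by (simp only: abs_le_square_iff)
    qed auto
    then show ?thesis by (simp add: E_def add.assoc)
  qed
  \<comment> \<open>The alternative \<open>lev Q < lev Q0 \<or> good Q\<close> makes the outer
    induction hypothesis available at every bad node; \<open>Q0\<close> itself enters as a good one.
    The summand with \<open>E - V Q\<close> is nonnegative and absorbs the squares of
    increments.\<close>
  have main: "\<bar>G Q\<bar> \<le> w Q * (C' * (\<Sum>j\<in>UNIV. L j Q) + Cs * PA * (E - V Q))"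
    if "Q \<in> Qs" "\<And>j. X j Q \<le> N * K * A j" "\<And>j. t j Q \<le> N * (K * (2 * B))"
      "lev Q < lev Q0 \<or> good Q" "lev Q \<le> lev Q0" for Q
    using that
  proof (induction "lev Q" arbitrary: Q rule: less_induct)
    case (less Q)
    have V: "Cs * PA * (E - V Q) \<ge> 0" using V_le[OF less.prems(1,2,3)] Cs PA by simp
    have wQ: "w Q > 0" using w_pos less.prems(1) by simp
    show ?case
    proof (cases "good Q")
      case False
      then have "lev Q < lev Q0" using less.prems(4) by simp
      then have "\<bar>G Q\<bar> \<le> w Q * H Q" using less.prems(1) \<open>\<And>Q0'. lev Q0' < lev Q0 \<Longrightarrow> Q0' \<in> Qs \<Longrightarrow> \<bar>G Q0'\<bar> \<le> w Q0' * H Q0'\<close> by blast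
      also have "\<dots> \<le> w Q * (C' * (\<Sum>j\<in>UNIV. L j Q) + Cs * PA * (E - V Q))"
        using bad[OF less.prems(1,2) False] V wQ by (intro mult_left_mono) auto
      finally show ?thesis .
    next
      case good: True
      show ?thesis
      proof (cases "lev Q = 0")
        case True
        have "L j Q \<ge> 0" for j
        proof -
          have "X j Q powr p j \<ge> p j * a j powr (p j - 1) * X j Q - (p j - 1) * a j powr p j"
            using A0 X_nonneg[OF less.prems(1)] p1 by (intro powr_ge_tangent) auto
          moreover have "(p j - 1) * a j powr p j * (1 + S Q) \<ge> (p j - 1) * a j powr p j * 1"
            using S0[OF less.prems(1)] p1[of j] by (intro mult_left_mono) auto
          ultimately show ?thesis unfolding L_def leaf(2)[OF less.prems(1) True] by linarith
        qed
        then show ?thesis using leaf(1)[OF less.prems(1) True] wQ V C'_nonneg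
          by (auto intro!: mult_nonneg_nonneg add_nonneg_nonneg sum_nonneg)
      next
        case False
        then have lev: "lev Q > 0" by simp
        have xQ: "\<bar>x j Q\<bar> \<le> K * A j" for j
          using xX[OF less.prems(1), of j] good unfolding good_def by (meson order_trans)
        have child: "R \<in> Qs" "X j R \<le> N * K * A j" "t j R \<le> N * (K * (2 * B))" "\<bar>x j R\<bar> \<le> N * K * A j" "lev R < lev Q"
          if R: "R \<in> ch Q" for R j
        proof -
          show RQ: "R \<in> Qs" by (rule ch_sub[OF less.prems(1) lev R])
          show "lev R < lev Q" by (rule lev_ch[OF less.prems(1) lev R])
          have "X j R \<le> N * X j Q" by (rule mart_child_le[OF marts(2) less.prems(1) lev R X_nonneg])
          also have "\<dots> \<le> N * (K * A j)" using good by (intro mult_left_mono) (auto simp: good_def)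
          finally show XR: "X j R \<le> N * K * A j" by (simp add: mult.assoc)
          then show "\<bar>x j R\<bar> \<le> N * K * A j" using xX[OF RQ, of j] by linarith
          have "t j R \<le> N * t j Q" by (rule mart_child_le[OF ct(1) less.prems(1) lev R ct(3)])
          also have "\<dots> \<le> N * (K * (2 * B))" using good by (intro mult_left_mono) (auto simp: good_def)
          finally show "t j R \<le> N * (K * (2 * B))" .
        qed
        have "\<bar>G Q - (\<Sum>R\<in>ch Q. G R)\<bar> \<le> Cs * PA *
          (\<Sum>j\<in>UNIV. \<Sum>R\<in>ch Q. w R * (((x j R / y j R - x j Q / y j Q) / A j)\<^sup>2
           + ((z j R - c j * y j R) / y j R - (z j Q - c j * y j Q) / y j Q)\<^sup>2))"
          unfolding PA_def by (rule step[OF less.prems(1) lev xQ child(4)])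
        \<comment> \<open>\<open>quotient_energy\<close> is applied to \<open>x j / A j\<close> with
          bound \<open>K\<close> and to \<open>z j - c j * y j\<close> with bound
          \<open>2 * K * B\<^sup>2\<close>; both bounds hold because \<open>Q\<close> is
          good.\<close>
        also have "\<dots> \<le> Cs * PA * ((\<Sum>R\<in>ch Q. w R * V R) - w Q * V Q)"
        proof (rule mult_left_mono)
          have "(\<Sum>R\<in>ch Q. w R * (((x j R / y j R - x j Q / y j Q) / A j)\<^sup>2
             + ((z j R - c j * y j R) / y j R - (z j Q - c j * y j Q) / y j Q)\<^sup>2))
            \<le> (\<Sum>R\<in>ch Q. w R * (2 * (x j R / A j)\<^sup>2 + 2 * K\<^sup>2 * (y j R)\<^sup>2)) - w Q * (2 * (x j Q / A j)\<^sup>2 + 2 * K\<^sup>2 * (y j Q)\<^sup>2)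
            + ((\<Sum>R\<in>ch Q. w R * (2 * (z j R - c j * y j R)\<^sup>2 + 2 * (2 * K * B\<^sup>2)\<^sup>2 * (y j R)\<^sup>2)) 
                - w Q * (2 * (z j Q - c j * y j Q)\<^sup>2 + 2 * (2 * K * B\<^sup>2)\<^sup>2 * (y j Q)\<^sup>2))" for j
          proof -
            have m: "mart (\<lambda>Q. 1 / A j * x j Q)" "mart (\<lambda>Q. z j Q - c j * y j Q)"
              by (intro mart_cmult mart_diff marts)+
            have w0: "\<And>R. R \<in> ch Q \<Longrightarrow> w R \<ge> 0" using child(1) w_pos by (meson less_imp_le)
            have yR: "\<And>R. R \<in> ch Q \<Longrightarrow> 1 \<le> \<bar>y j R\<bar>" using child(1) y(1) by blast
            have "\<bar>x j Q / A j\<bar> \<le> K"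
              using xQ[of j] A0[of j] K by (cases "A j = 0") (auto simp: divide_le_eq abs_divide)
            then have 1: "(\<Sum>R\<in>ch Q. w R * ((x j R / A j) / y j R - (x j Q / A j) / y j Q)\<^sup>2)
              \<le> (\<Sum>R\<in>ch Q. w R * (2 * (x j R / A j)\<^sup>2 + 2 * K\<^sup>2 * (y j R)\<^sup>2)) - w Q * (2 * (x j Q / A j)\<^sup>2 + 2 * K\<^sup>2 * (y j Q)\<^sup>2)"
              using martD[OF m(1) less.prems(1) lev] martD[OF marts(4) less.prems(1) lev]
              by (intro quotient_energy w0 w_sum[OF less.prems(1) lev] yR y(1)[OF less.prems(1)]) auto
            have "B * t j Q \<le> B * (K * (2 * B))" using good B by (intro mult_left_mono) (auto simp: good_def)
            then have "\<bar>z j Q - c j * y j Q\<bar> \<le> 2 * K * B\<^sup>2"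
              using ct(4)[OF less.prems(1), of j] by (simp add: power2_eq_square algebra_simps)
            then have 2: "(\<Sum>R\<in>ch Q. w R * ((z j R - c j * y j R) / y j R - (z j Q - c j * y j Q) / y j Q)\<^sup>2)
              \<le> (\<Sum>R\<in>ch Q. w R * (2 * (z j R - c j * y j R)\<^sup>2 + 2 * (2 * K * B\<^sup>2)\<^sup>2 * (y j R)\<^sup>2)) 
                - w Q * (2 * (z j Q - c j * y j Q)\<^sup>2 + 2 * (2 * K * B\<^sup>2)\<^sup>2 * (y j Q)\<^sup>2)"
              using martD[OF m(2) less.prems(1) lev] martD[OF marts(4) less.prems(1) lev]
              by (intro quotient_energy w0 w_sum[OF less.prems(1) lev] yR y(1)[OF less.prems(1)]) auto
            have e: "(x j R / y j R - x j Q / y j Q) / A j = (x j R / A j) / y j R - (x j Q / A j) / y j Q" for R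
              by (simp add: diff_divide_distrib mult.commute)
            show ?thesis unfolding e distrib_left[of "w _" "(_ - _)\<^sup>2" "(_ - _)\<^sup>2"] sum.distrib[of "\<lambda>R. w R * (_ R - _)\<^sup>2"]
              using add_mono[OF 1 2] by (simp add: sum.distrib)
          qed
          then have "(\<Sum>j\<in>UNIV. \<Sum>R\<in>ch Q. w R * (((x j R / y j R - x j Q / y j Q) / A j)\<^sup>2
             + ((z j R - c j * y j R) / y j R - (z j Q - c j * y j Q) / y j Q)\<^sup>2))
            \<le> (\<Sum>j\<in>UNIV. (\<Sum>R\<in>ch Q. w R * (2 * (x j R / A j)\<^sup>2 + 2 * K\<^sup>2 * (y j R)\<^sup>2)) - w Q * (2 * (x j Q / A j)\<^sup>2 + 2 * K\<^sup>2 * (y j Q)\<^sup>2)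
            + ((\<Sum>R\<in>ch Q. w R * (2 * (z j R - c j * y j R)\<^sup>2 + 2 * (2 * K * B\<^sup>2)\<^sup>2 * (y j R)\<^sup>2)) 
                - w Q * (2 * (z j Q - c j * y j Q)\<^sup>2 + 2 * (2 * K * B\<^sup>2)\<^sup>2 * (y j Q)\<^sup>2)))"
            by (rule sum_mono)
          also have "\<dots> = (\<Sum>R\<in>ch Q. w R * V R) - w Q * V Q"
          proof -
            have sw: "(\<Sum>R\<in>ch Q. w R * (\<Sum>j\<in>(UNIV::'n set). v j R)) = (\<Sum>j\<in>UNIV. \<Sum>R\<in>ch Q. w R * v j R)" for v
              unfolding sum_distrib_left by (rule sum.swap)
            show ?thesis unfolding V_def sw
              by (simp add: sum.distrib sum_subtractf sum_distrib_left distrib_left)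
          qed
          finally show "(\<Sum>j\<in>UNIV. \<Sum>R\<in>ch Q. w R * (((x j R / y j R - x j Q / y j Q) / A j)\<^sup>2
             + ((z j R - c j * y j R) / y j R - (z j Q - c j * y j Q) / y j Q)\<^sup>2)) \<le> (\<Sum>R\<in>ch Q. w R * V R) - w Q * V Q" .
        qed (use Cs PA in auto)
        finally have e1: "\<bar>G Q - (\<Sum>R\<in>ch Q. G R)\<bar> \<le> Cs * PA * ((\<Sum>R\<in>ch Q. w R * V R) - w Q * V Q)" .
        have "\<bar>\<Sum>R\<in>ch Q. G R\<bar> \<le> (\<Sum>R\<in>ch Q. w R * (C' * (\<Sum>j\<in>UNIV. L j R) + Cs * PA * (E - V R)))"
        proof (rule order_trans[OF sum_abs], rule sum_mono)
          fix R assume R: "R \<in> ch Q"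
          show "\<bar>G R\<bar> \<le> w R * (C' * (\<Sum>j\<in>UNIV. L j R) + Cs * PA * (E - V R))"
            using child[OF R] less.prems(5) by (intro less.hyps) auto
        qed
        also have "\<dots> = (\<Sum>R\<in>ch Q. w R * (C' * (\<Sum>j\<in>UNIV. L j R) + Cs * PA * E)) - Cs * PA * (\<Sum>R\<in>ch Q. w R * V R)"
          unfolding sum_distrib_left[of "Cs * PA"] sum_subtractf[symmetric] by (rule sum.cong) (auto simp: algebra_simps)
        also have "(\<Sum>R\<in>ch Q. w R * (C' * (\<Sum>j\<in>UNIV. L j R) + Cs * PA * E)) = w Q * (C' * (\<Sum>j\<in>UNIV. L j Q) + Cs * PA * E)"
        proof -
          \<comment> \<open>All of the bound except the energy is a martingale, so its sum over the
            children is exactly its value at \<open>Q\<close>; the energies of the children cancel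
            against the error of the step.\<close>
          have "mart (\<lambda>Q. C' * (\<Sum>j\<in>UNIV. L j Q) + Cs * PA * E)"
            by (intro mart_add mart_cmult mart_sum mart_L mart_const)
          from martD[OF this less.prems(1) lev] show ?thesis by simp
        qed
        finally have "\<bar>G Q\<bar> \<le> Cs * PA * ((\<Sum>R\<in>ch Q. w R * V R) - w Q * V Q)
          + (w Q * (C' * (\<Sum>j\<in>UNIV. L j Q) + Cs * PA * E) - Cs * PA * (\<Sum>R\<in>ch Q. w R * V R))"
          using e1 by linarith
        also have "\<dots> = w Q * (C' * (\<Sum>j\<in>UNIV. L j Q) + Cs * PA * (E - V Q))" by (simp add: algebra_simps)
        finally show ?thesis .
      qed
    qed
  qed
  have N1: "real N \<ge> 1" using N_pos by simp
  have AK: "A j \<le> K * A j" "2 * B \<le> K * (2 * B)" for j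
    using A0[of j] K B by (auto simp: mult_le_cancel_right1)
  have goodQ0: "good Q0" unfolding good_def using AK by (auto simp: A_def[symmetric] intro: order_trans[OF ct(2)])
  have NN: "v \<le> N * v" if "v \<ge> 0" for v :: real using N1 that by (simp add: mult_le_cancel_right1)
  have "\<bar>G Q0\<bar> \<le> w Q0 * (C' * (\<Sum>j\<in>UNIV. L j Q0) + Cs * PA * (E - V Q0))"
  proof (rule main[OF less.prems])
    fix j
    have "A j \<le> N * (K * A j)" using AK(1)[of j] A0[of j] by (intro order_trans[OF _ NN]) auto
    then have "A j \<le> N * K * A j" by (simp add: mult.assoc)
    then show "X j Q0 \<le> N * K * A j" by (simp only: A_def)
    show "t j Q0 \<le> N * (K * (2 * B))"
      using K B by (intro order_trans[OF ct(2)] order_trans[OF AK(2) NN]) auto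
  qed (use goodQ0 in auto)
  also have "\<dots> \<le> w Q0 * H Q0"
  proof (rule mult_left_mono)
    have "V Q0 \<ge> 0" unfolding V_def by (intro sum_nonneg) auto
    then have "Cs * PA * (E - V Q0) \<le> Cs * PA * E" using Cs PA by (intro mult_left_mono) auto
    \<comment> \<open>The total cost of the nodes above the stopping nodes becomes a sum of powers,
      which the gap \<open>eps j\<close> then pays for.\<close>
    also have "\<dots> \<le> Cs * E * (\<Sum>j\<in>UNIV. A j powr p j)"
    proof -
      have "PA \<le> (\<Sum>j\<in>UNIV. A j powr p j)" unfolding PA_def by (rule prod_le_sum_powr[OF p]) (rule A0)
      then have "Cs * E * PA \<le> Cs * E * (\<Sum>j\<in>UNIV. A j powr p j)"
        using Cs E_nonneg by (intro mult_left_mono) auto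
      then show ?thesis by (simp only: mult.assoc mult.commute[of PA])
    qed
    also have "\<dots> \<le> (\<Sum>j\<in>UNIV. C' * (eps j * A j powr p j))"
      unfolding sum_distrib_left mult.assoc[symmetric] by (intro sum_mono mult_right_mono C'_eps) auto
    finally have 1: "Cs * PA * (E - V Q0) \<le> (\<Sum>j\<in>UNIV. C' * (eps j * A j powr p j))" .
    have "S Q0 \<le> (\<Sum>i\<in>(UNIV::'n set). 1 / K + 1 / K)" unfolding S_def
    proof (intro sum_mono add_mono)
      fix i
      show "1 / (K * A i) * X i Q0 \<le> 1 / K" using K by (cases "A i = 0") (auto simp: A_def[symmetric])
      show "1 / (K * (2 * B)) * t i Q0 \<le> 1 / K" using ct(2)[of i] K B by (simp add: field_simps)
    qed
    \<comment> \<open>There are \<open>2 * CARD('n)\<close> summands \<open>1 / K\<close>, and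
      \<open>K = 4 * CARD('n)\<close>.\<close>
    also have "\<dots> = 1 / 2" by (simp add: K_def)
    finally have S: "S Q0 \<le> 1 / 2" .
    have "L j Q0 \<le> F j Q0 - (2/3) powr (p j - 1) * A j powr p j" for j
    proof -
      have "(p j - 1) * a j powr p j * (1 + S Q0) \<le> (p j - 1) * a j powr p j * (3 / 2)"
        using S p1[of j] by (intro mult_left_mono) auto
      moreover have "a j powr (p j - 1) * A j = (2/3) powr (p j - 1) * A j powr p j"
        "a j powr p j * (3 / 2) = (2/3) powr (p j - 1) * A j powr p j"
      proof -
        show 1: "a j powr (p j - 1) * A j = (2/3) powr (p j - 1) * A j powr p j"
        proof (cases "A j = 0")
          case False
          then have "a j powr (p j - 1) = (2/3) powr (p j - 1) * A j powr (p j - 1)" "A j powr p j = A j powr (p j - 1) * A j"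
            using A0[of j] unfolding a_def by (simp_all only: powr_mult[of "2/3" "A j"] powr_diff) auto
          then show ?thesis by simp
        qed simp
        have "a j powr p j = a j powr (p j - 1) * a j"
          using A0[of j] by (cases "a j = 0") (auto simp: powr_diff)
        then show "a j powr p j * (3 / 2) = (2/3) powr (p j - 1) * A j powr p j"
          unfolding 1[symmetric] by (simp add: a_def)
      qed
      ultimately have "(p j - 1) * a j powr p j * (1 + S Q0) \<le> (p j - 1) * ((2/3) powr (p j - 1) * A j powr p j)"
        "p j * a j powr (p j - 1) * A j = p j * ((2/3) powr (p j - 1) * A j powr p j)" by (simp_all only: mult.assoc)
      then show ?thesis unfolding L_def A_def[symmetric] left_diff_distrib by linarith
    qed
    then have "C' * (\<Sum>j\<in>UNIV. L j Q0) \<le> C' * (\<Sum>j\<in>UNIV. F j Q0 - (2/3) powr (p j - 1) * A j powr p j)"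
      using C'_nonneg by (intro mult_left_mono sum_mono) auto
    also have "\<dots> = H Q0 - (\<Sum>j\<in>UNIV. C' * (eps j * A j powr p j))"
      unfolding H_def sum_distrib_left sum_subtractf[symmetric]
      by (rule sum.cong) (auto simp: eps_def A_def algebra_simps)
    finally show "C' * (\<Sum>j\<in>UNIV. L j Q0) + Cs * PA * (E - V Q0) \<le> H Q0" using 1 by linarith
  qed (use w_pos[OF less.prems] in auto)
  finally show ?case .
qed

lemma G_bound:
  assumes "Q \<in> Qs"
  shows "\<bar>G Q\<bar> \<le> C' * w Q * (\<Sum>j\<in>UNIV. F j Q)"
proof -
  have "H Q \<le> C' * (\<Sum>j\<in>UNIV. F j Q)"
    unfolding H_def using C'_nonneg by (intro mult_left_mono sum_mono) auto
  then have "w Q * H Q \<le> w Q * (C' * (\<Sum>j\<in>UNIV. F j Q))"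
    using w_pos[OF assms] by (intro mult_left_mono) auto
  then show ?thesis using G_le_H[OF assms] by (simp add: algebra_simps)
qed

end

section \<open>Integrals of products on powers of a Euclidean space\<close>

text \<open>A cube of the power space is a product of cubes of one common scale. This is what splits
  the kernel into tensor products.\<close>

lemma dyadic_cube_vec:
  fixes x :: "'a::euclidean_space ^ 'n::finite"
  shows "x \<in> dyadic_cube m l \<longleftrightarrow> (\<forall>j. x $ j \<in> dyadic_cube m (\<lambda>e. l (axis j e)))"
  by (auto simp: dyadic_cube_def Basis_vec_def inner_axis)

lemma measurable_vec_lambda [measurable]:
  "(\<lambda>f. \<chi> i. f i) \<in> measurable (PiM UNIV (\<lambda>_::'n::finite. lborel :: 'a::euclidean_space measure)) (borel :: ('a ^ 'n) measure)"
proof (rule borel_measurable_euclidean_space[THEN iffD2], rule ballI)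
  fix b :: "'a ^ 'n" assume "b \<in> Basis"
  then obtain i u where b: "b = axis i u" "u \<in> Basis" by (auto simp: Basis_vec_def)
  have "(\<lambda>f. f i \<bullet> u) \<in> borel_measurable (PiM UNIV (\<lambda>_::'n. lborel :: 'a measure))" by measurable
  then show "(\<lambda>f. (\<chi> i. f i) \<bullet> b) \<in> borel_measurable (PiM UNIV (\<lambda>_::'n. lborel :: 'a measure))"
    by (simp add: b inner_axis)
qed

lemma prod_Basis_vec:
  fixes h :: "('a::euclidean_space ^ 'n::finite) \<Rightarrow> 'b::comm_monoid_mult"
  shows "(\<Prod>b\<in>Basis. h b) = (\<Prod>i\<in>UNIV. \<Prod>u\<in>Basis. h (axis i u))"
proof -
  have inj: "inj_on (\<lambda>(i, u). axis i u) (UNIV \<times> Basis :: ('n \<times> 'a) set)"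
    by (auto simp: inj_on_def axis_eq_axis)
  have B: "Basis = (\<lambda>(i, u). axis i u) ` (UNIV \<times> Basis :: ('n \<times> 'a) set)"
    by (auto simp: Basis_vec_def)
  show ?thesis
    unfolding B by (subst prod.reindex[OF inj]) (simp add: prod.cartesian_product split_def)
qed

text \<open>Both measures agree on boxes. The identification makes Fubini's theorem for finite
  products available on the power space.\<close>

lemma lborel_vec_eq_PiM:
  "(lborel :: ('a::euclidean_space ^ 'n::finite) measure) = distr (PiM UNIV (\<lambda>_. lborel)) borel (\<lambda>f. \<chi> i. f i)"
proof (rule lborel_eqI)
  fix l u :: "'a ^ 'n" assume lu: "\<And>b. b \<in> Basis \<Longrightarrow> l \<bullet> b \<le> u \<bullet> b"
  interpret product_sigma_finite "\<lambda>_::'n. lborel :: 'a measure" ..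
  have lu': "l $ i \<bullet> v \<le> u $ i \<bullet> v" if "v \<in> Basis" for i v
    using lu[of "axis i v"] that by (auto simp: Basis_vec_def inner_axis)
  have "emeasure (distr (PiM UNIV (\<lambda>_. lborel)) borel (\<lambda>f. \<chi> i. f i)) (box l u)
    = emeasure (PiM UNIV (\<lambda>_::'n. lborel :: 'a measure)) (PiE UNIV (\<lambda>i. box (l $ i) (u $ i)))"
    by (subst emeasure_distr) (auto intro!: arg_cong2[where f = emeasure] simp: space_PiM PiE_iff mem_box Basis_vec_def inner_axis)
  also have "\<dots> = (\<Prod>i\<in>UNIV. emeasure lborel (box (l $ i) (u $ i)))" by (rule emeasure_PiM) auto
  also have "\<dots> = (\<Prod>i\<in>UNIV. ennreal (\<Prod>v\<in>Basis. (u $ i - l $ i) \<bullet> v))"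
    using lu' by simp
  also have "\<dots> = ennreal (\<Prod>i\<in>UNIV. \<Prod>v\<in>Basis. (u $ i - l $ i) \<bullet> v)"
    using lu' by (intro prod_ennreal prod_nonneg) (auto simp: inner_diff_left)
  also have "(\<Prod>i\<in>UNIV. \<Prod>v\<in>Basis. (u $ i - l $ i) \<bullet> v) = (\<Prod>b\<in>Basis. (u - l) \<bullet> b)"
    by (simp add: prod_Basis_vec inner_axis)
  finally show "emeasure (distr (PiM UNIV (\<lambda>_. lborel)) borel (\<lambda>f. \<chi> i. f i)) (box l u) = ennreal (\<Prod>b\<in>Basis. (u - l) \<bullet> b)" .
qed simp

text \<open>The preimage of a null set under a coordinate projection is a product with one factor of
  measure zero.\<close>

lemma AE_lborel_vec_component:
  fixes P :: "'a::euclidean_space \<Rightarrow> bool"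
  assumes "AE x in lborel. P x"
  shows "AE x in (lborel :: ('a ^ 'n::finite) measure). P (x $ j)"
proof -
  interpret product_sigma_finite "\<lambda>_::'n. lborel :: 'a measure" ..
  obtain N where N: "N \<in> sets borel" "emeasure lborel N = 0" "{x. \<not> P x} \<subseteq> N"
    using assms by (auto simp: eventually_ae_filter null_sets_def)
  have m: "{x :: 'a ^ 'n. x $ j \<in> N} \<in> sets borel"
    using measurable_sets[OF borel_measurable_continuous_onI N(1), of "\<lambda>x. x $ j"] by (simp add: vimage_def continuous_intros)
  have "emeasure lborel {x :: 'a ^ 'n. x $ j \<in> N} = emeasure (PiM UNIV (\<lambda>_::'n. lborel :: 'a measure)) (PiE UNIV (\<lambda>i. if i = j then N else UNIV))"
    unfolding lborel_vec_eq_PiM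
    by (subst emeasure_distr) (use m in \<open>auto intro!: arg_cong2[where f = emeasure] simp: space_PiM PiE_iff split: if_splits\<close>)
  also have "\<dots> = (\<Prod>i\<in>UNIV. emeasure lborel (if i = j then N else UNIV))"
    using N(1) by (intro emeasure_PiM) auto
  also have "\<dots> = 0" using N(2) by (intro prod_zero) auto
  finally have "{x :: 'a ^ 'n. x $ j \<in> N} \<in> null_sets lborel" using m by (simp add: null_sets_def)
  then show ?thesis by (rule AE_I') (use N(3) in auto)
qed

text \<open>The product formula is applied on the Borel side, whereas the functions are only
  Lebesgue measurable. Each is replaced by an almost everywhere equal Borel function
  \<open>h j\<close>, and the equality persists componentwise on the power space.\<close>

lemma integral_prod_components:
  fixes g :: "'n::finite \<Rightarrow> 'a::euclidean_space \<Rightarrow> real"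
  assumes "\<And>j. integrable lebesgue (g j)"
  shows "integrable lebesgue (\<lambda>x :: 'a ^ 'n. \<Prod>j\<in>UNIV. g j (x $ j))"
    and "(LINT x|lebesgue. (\<Prod>j\<in>UNIV. g j ((x :: 'a ^ 'n) $ j))) = (\<Prod>j\<in>UNIV. (LINT x|lebesgue. g j x))"
proof -
  interpret product_sigma_finite "\<lambda>_::'n. lborel :: 'a measure" ..
  have "\<forall>j. \<exists>h. h \<in> borel_measurable lborel \<and> (AE x in lborel. g j x = h x)"
    using completion_ex_borel_measurable_real[OF borel_measurable_integrable[OF assms]] by blast
  from choice[OF this] obtain h where h': "\<forall>j. h j \<in> borel_measurable lborel \<and> (AE x in lborel. g j x = h j x)" ..
  have h [measurable]: "h j \<in> borel_measurable borel" for j using h' by (simp add: measurable_lborel1)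
  have gh: "AE x in lborel. g j x = h j x" for j using h' by blast
  have gh': "AE x in lebesgue. g j x = h j x" for j using gh by (rule AE_completion)
  have gm: "g j \<in> borel_measurable lebesgue" for j using assms by auto
  have "integrable lebesgue (h j)" for j
    by (rule integrable_cong_AE_imp[OF assms _ gh']) (rule measurable_completion, simp)
  then have hi: "integrable lborel (h j)" for j by (simp add: integrable_completion)
  have gh_int: "(LINT x|lebesgue. g j x) = (LINT x|lborel. h j x)" for j
  proof -
    have "(LINT x|lebesgue. g j x) = (LINT x|lebesgue. h j x)"
      using gm gh' by (intro integral_cong_AE) (auto intro: measurable_completion)
    then show ?thesis by (simp add: integral_completion)
  qed
  have "AE x :: 'a ^ 'n in lborel. \<forall>j\<in>UNIV. g j (x $ j) = h j (x $ j)"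
    by (intro AE_finite_allI AE_lborel_vec_component gh) auto
  then have ae: "AE x :: 'a ^ 'n in lebesgue. (\<Prod>j\<in>UNIV. g j (x $ j)) = (\<Prod>j\<in>UNIV. h j (x $ j))"
    by (intro AE_completion) (auto elim: eventually_mono)
  have comp [measurable]: "(\<lambda>x :: 'a ^ 'n. x $ j) \<in> borel_measurable borel" for j
    by (intro borel_measurable_continuous_onI continuous_intros)
  have mh [measurable]: "(\<lambda>x :: 'a ^ 'n. \<Prod>j\<in>UNIV. h j (x $ j)) \<in> borel_measurable borel" by measurable
  have mg: "(\<lambda>x :: 'a ^ 'n. \<Prod>j\<in>UNIV. g j (x $ j)) \<in> borel_measurable lebesgue"
    by (rule borel_measurable_AE[of "\<lambda>x :: 'a ^ 'n. \<Prod>j\<in>UNIV. h j (x $ j)"])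
      (use ae in \<open>auto elim: eventually_mono intro!: measurable_completion\<close>)
  have i: "integrable (PiM UNIV (\<lambda>_::'n. lborel)) (\<lambda>x. \<Prod>j\<in>UNIV. h j (x j))"
    by (rule product_integrable_prod) (auto simp: hi)
  have hint: "integrable lebesgue (\<lambda>x :: 'a ^ 'n. \<Prod>j\<in>UNIV. h j (x $ j))"
    by (subst integrable_completion, measurable, subst lborel_vec_eq_PiM, subst integrable_distr_eq) (use i in auto)
  then show "integrable lebesgue (\<lambda>x :: 'a ^ 'n. \<Prod>j\<in>UNIV. g j (x $ j))"
    using integrable_cong_AE[OF mg borel_measurable_integrable[OF hint] ae] by blast
  have "(LINT x|lebesgue. (\<Prod>j\<in>UNIV. g j ((x :: 'a ^ 'n) $ j))) = (LINT x|lebesgue. (\<Prod>j\<in>UNIV. h j ((x :: 'a ^ 'n) $ j)))"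
    by (rule integral_cong_AE[OF mg borel_measurable_integrable[OF hint] ae])
  also have "\<dots> = (LINT x|lborel. (\<Prod>j\<in>UNIV. h j ((x :: 'a ^ 'n) $ j)))"
    by (rule integral_completion) measurable
  also have "\<dots> = (LINT x|PiM UNIV (\<lambda>_::'n. lborel). (\<Prod>j\<in>UNIV. h j (x j)))"
    unfolding lborel_vec_eq_PiM by (subst integral_distr) auto
  also have "\<dots> = (\<Prod>j\<in>UNIV. (LINT x|lborel. h j x))"
    by (rule product_integral_prod) (auto simp: hi)
  finally show "(LINT x|lebesgue. (\<Prod>j\<in>UNIV. g j ((x :: 'a ^ 'n) $ j))) = (\<Prod>j\<in>UNIV. (LINT x|lebesgue. g j x))"
    by (simp add: gh_int)
qed

section \<open>Dyadic cubes\<close>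

text \<open>The index of a cube is the floor of the scaled coordinates; passing to a coarser scale
  then becomes integer division of indices.\<close>

lemma mem_dyadic_cube:
  "x \<in> dyadic_cube m l \<longleftrightarrow> (\<forall>e\<in>Basis. \<lfloor>x \<bullet> e / 2 powi m\<rfloor> = l e)"
proof -
  have "(2::real) powi m > 0" by simp
  then have "2 powi m * real_of_int (l e) \<le> x \<bullet> e \<longleftrightarrow> real_of_int (l e) \<le> x \<bullet> e / 2 powi m"
    "x \<bullet> e < 2 powi m * (real_of_int (l e) + 1) \<longleftrightarrow> x \<bullet> e / 2 powi m < real_of_int (l e) + 1" for e
    by (simp_all add: pos_le_divide_eq pos_divide_less_eq mult.commute)
  then show ?thesis by (simp add: dyadic_cube_def floor_eq_iff)
qed

lemma floor_div_powi:
  fixes x :: real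
  assumes "m \<le> m'"
  shows "\<lfloor>x / 2 powi m'\<rfloor> = \<lfloor>x / 2 powi m\<rfloor> div 2 ^ nat (m' - m)"
proof -
  have "(2::real) powi m' = 2 powi m * 2 ^ nat (m' - m)"
    using assms power_int_add[of "2::real" m "m' - m"] by (simp add: power_int_def)
  then have "x / 2 powi m' = (x / 2 powi m) / real_of_int (2 ^ nat (m' - m))" by simp
  moreover have "\<lfloor>(x / 2 powi m) / real_of_int (2 ^ nat (m' - m))\<rfloor> = \<lfloor>x / 2 powi m\<rfloor> div 2 ^ nat (m' - m)"
    by (rule floor_divide_real_eq_div) simp
  ultimately show ?thesis by (simp only:)
qed

definition cubes :: "int \<Rightarrow> 'a::euclidean_space set set" where
  "cubes m = range (dyadic_cube m)"

definition cube_at :: "int \<Rightarrow> 'a::euclidean_space \<Rightarrow> 'a set" where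
  "cube_at m x = dyadic_cube m (\<lambda>e. \<lfloor>x \<bullet> e / 2 powi m\<rfloor>)"

definition subcubes :: "int \<Rightarrow> 'a::euclidean_space set \<Rightarrow> 'a set set" where
  "subcubes m A = {R \<in> cubes m. R \<subseteq> A}"

text \<open>The union of the \<open>2\<^sup>d\<close> dyadic cubes of scale \<open>M\<close> that touch the origin.\<close>

definition region :: "int \<Rightarrow> 'a::euclidean_space set" where
  "region M = {x. \<forall>e\<in>Basis. \<lfloor>x \<bullet> e / 2 powi M\<rfloor> \<in> {-1, 0}}"

lemma dyadic_cubes_eq: "dyadic_cubes = (\<Union>m. cubes m)"
  by (auto simp: dyadic_cubes_def cubes_def)

lemma cubes_imp_dyadic: "Q \<in> cubes m \<Longrightarrow> Q \<in> dyadic_cubes"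
  by (auto simp: dyadic_cubes_eq)

lemma mem_cube_at: "y \<in> cube_at m x \<longleftrightarrow> (\<forall>e\<in>Basis. \<lfloor>y \<bullet> e / 2 powi m\<rfloor> = \<lfloor>x \<bullet> e / 2 powi m\<rfloor>)"
  by (simp add: cube_at_def mem_dyadic_cube)

lemma cube_at_in [simp]: "cube_at m x \<in> cubes m" "x \<in> cube_at m x"
  by (auto simp: mem_cube_at) (simp add: cube_at_def cubes_def)

lemma cubes_eq_cube_at: "Q \<in> cubes m \<Longrightarrow> x \<in> Q \<Longrightarrow> Q = cube_at m x"
  by (auto simp: cubes_def mem_cube_at mem_dyadic_cube)

lemma cubes_disjoint: "Q \<in> cubes m \<Longrightarrow> R \<in> cubes m \<Longrightarrow> Q \<noteq> R \<Longrightarrow> Q \<inter> R = {}"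
  using cubes_eq_cube_at by blast

lemma cube_at_mono: "m \<le> m' \<Longrightarrow> cube_at m x \<subseteq> cube_at m' x"
  by (auto simp: mem_cube_at floor_div_powi)

lemma cubes_nested: "R \<in> cubes m \<Longrightarrow> P \<in> cubes m' \<Longrightarrow> m \<le> m' \<Longrightarrow> R \<subseteq> P \<or> R \<inter> P = {}"
  using cube_at_mono cubes_eq_cube_at by blast

lemma region_cube:
  assumes "R \<in> cubes m" "m \<le> M"
  shows "R \<subseteq> region M \<or> R \<inter> region M = {}"
proof -
  have "y \<in> region M" if "x \<in> R" "x \<in> region M" "y \<in> R" for x y
  proof -
    have "y \<in> cube_at m x" using cubes_eq_cube_at assms(1) that by blast
    then have "y \<in> cube_at M x" using cube_at_mono assms(2) by blast
    then show ?thesis using that(2) by (auto simp: region_def mem_cube_at)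
  qed
  then show ?thesis by blast
qed

lemma Union_subcubes_cube:
  assumes "P \<in> cubes m'" "m \<le> m'"
  shows "\<Union>(subcubes m P) = P"
proof
  show "P \<subseteq> \<Union>(subcubes m P)"
  proof
    fix x assume "x \<in> P"
    then have "cube_at m x \<subseteq> P" using cube_at_mono[OF assms(2)] cubes_eq_cube_at[OF assms(1)] by blast
    then show "x \<in> \<Union>(subcubes m P)" unfolding subcubes_def using cube_at_in(1)[of m x] cube_at_in(2)[of x m] by blast
  qed
qed (auto simp: subcubes_def)

lemma Union_subcubes_region:
  assumes "m \<le> M"
  shows "\<Union>(subcubes m (region M)) = region M"
proof
  show "region M \<subseteq> \<Union>(subcubes m (region M))"
  proof
    fix x assume "x \<in> region M"
    then have "cube_at m x \<subseteq> region M" using region_cube[OF cube_at_in(1)[of m x] assms] cube_at_in(2)[of x m] by blast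
    then show "x \<in> \<Union>(subcubes m (region M))" unfolding subcubes_def using cube_at_in(1)[of m x] cube_at_in(2)[of x m] by blast
  qed
qed (auto simp: subcubes_def)

section \<open>Volumes, counting of subcubes, and exhaustion by regions\<close>

lemma emeasure_dyadic_cube:
  "emeasure lborel (dyadic_cube m l :: 'a::euclidean_space set) = ennreal ((2 powi m) ^ DIM('a))"
proof -
  let ?a = "\<Sum>e\<in>Basis. (2 powi m * real_of_int (l e)) *\<^sub>R e :: 'a"
  let ?b = "\<Sum>e\<in>Basis. (2 powi m * (real_of_int (l e) + 1)) *\<^sub>R e :: 'a"
  have pos: "(2::real) powi m > 0" by simp
  have ab: "?a \<bullet> e = 2 powi m * real_of_int (l e)" "?b \<bullet> e = 2 powi m * (real_of_int (l e) + 1)" if "e \<in> Basis" for e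
    using that by (simp_all add: inner_sum_left_Basis)
  have le: "?a \<bullet> e \<le> ?b \<bullet> e" if "e \<in> Basis" for e unfolding ab[OF that] using pos by (simp add: distrib_left)
  have pr: "(\<Prod>e\<in>Basis. (?b - ?a) \<bullet> e) = (2 powi m) ^ DIM('a)"
  proof -
    have "(?b - ?a) \<bullet> e = 2 powi m" if "e \<in> Basis" for e
      unfolding inner_diff_left ab[OF that] by (simp add: distrib_left)
    then show ?thesis by simp
  qed
  have 1: "box ?a ?b \<subseteq> dyadic_cube m l" unfolding dyadic_cube_def box_def by (auto simp: ab)
  have 2: "dyadic_cube m l \<subseteq> cbox ?a ?b" unfolding dyadic_cube_def cbox_def by (auto simp: ab)
  have meas: "dyadic_cube m l \<in> sets (lborel :: 'a measure)" unfolding dyadic_cube_def by measurable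
  have "emeasure lborel (box ?a ?b) \<le> emeasure lborel (dyadic_cube m l :: 'a set)"
    using 1 meas by (intro emeasure_mono) auto
  moreover have "emeasure lborel (dyadic_cube m l :: 'a set) \<le> emeasure lborel (cbox ?a ?b)"
    using 2 meas by (intro emeasure_mono) auto
  ultimately show ?thesis
    by (simp add: emeasure_lborel_box[OF le] emeasure_lborel_cbox[OF le] pr)
qed

lemma cubes_borel [measurable]: "Q \<in> cubes m \<Longrightarrow> Q \<in> sets borel"
  by (auto simp: cubes_def dyadic_cube_def)

lemma cubes_sets [simp]: "Q \<in> cubes m \<Longrightarrow> Q \<in> sets lebesgue"
  using cubes_borel by auto

lemma measure_cube: "Q \<in> cubes m \<Longrightarrow> measure lebesgue Q = (2 powi m) ^ DIM('a)"
  for Q :: "'a::euclidean_space set"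
proof -
  assume "Q \<in> cubes m"
  then obtain l where "Q = dyadic_cube m l" "Q \<in> sets borel" using cubes_borel by (auto simp: cubes_def)
  then show ?thesis by (simp add: measure_def emeasure_dyadic_cube)
qed

lemma measure_cube_pos: "Q \<in> cubes m \<Longrightarrow> measure lebesgue Q > 0"
  using measure_cube[of Q m] by simp

lemma cube_lmeasurable: "Q \<in> cubes m \<Longrightarrow> Q \<in> lmeasurable"
  unfolding cubes_def using cubes_borel[of Q m] by (auto simp: fmeasurable_def emeasure_dyadic_cube cubes_def)

lemma cubes_nonempty: "Q \<in> cubes m \<Longrightarrow> Q \<noteq> {}"
  using measure_cube_pos by fastforce

text \<open>The volume determines the scale; \<open>scale_of\<close> rests on this.\<close>

lemma cubes_scale_unique:
  assumes "Q \<in> cubes m" "Q \<in> cubes m'"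
  shows "m = m'"
proof -
  have "((2::real) powi m) ^ DIM('a) = (2 powi m') ^ DIM('a)"
    using measure_cube assms by metis
  then have "(2::real) powi m = 2 powi m'" by (rule power_eq_imp_eq_base) auto
  then show ?thesis by (metis linorder_neqE power_int_strict_increasing one_less_numeral_iff semiring_norm(76) less_irrefl)
qed

lemma pairwise_disjnt_subcubes: "T \<subseteq> subcubes m A \<Longrightarrow> pairwise disjnt T"
  unfolding pairwise_def disjnt_def subcubes_def using cubes_disjoint by blast

text \<open>The cubes are disjoint and of equal volume, so too many of them would exceed the measure
  of \<open>A\<close>.\<close>

lemma finite_subcubes:
  fixes A :: "'a::euclidean_space set"
  assumes "A \<in> lmeasurable"
  shows "finite (subcubes m A)"
proof (rule ccontr)
  assume inf: "infinite (subcubes m A)"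
  define v :: real where "v = (2 powi m) ^ DIM('a)"
  have v: "v > 0" by (simp add: v_def)
  obtain k :: nat where k: "measure lebesgue A < k * v" using reals_Archimedean3[OF v] by blast
  obtain T where T: "T \<subseteq> subcubes m A" "finite T" "card T = k" using infinite_arbitrarily_large[OF inf] by blast
  have "measure lebesgue (\<Union>T) = (\<Sum>R\<in>T. measure lebesgue R)"
    using T(1) by (intro measure_Union' T(2) pairwise_disjnt_subcubes[of T m A]) (auto simp: subcubes_def intro: cube_lmeasurable)
  also have "\<dots> = k * v"
  proof -
    have "(\<Sum>R\<in>T. measure lebesgue R) = (\<Sum>R\<in>T. v)"
      by (rule sum.cong[OF refl]) (use T(1) measure_cube[of _ m] in \<open>auto simp: v_def subcubes_def\<close>)
    then show ?thesis by (simp add: T(3))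
  qed
  moreover have "measure lebesgue (\<Union>T) \<le> measure lebesgue A"
  proof (rule measure_mono_fmeasurable[OF _ _ assms])
    show "\<Union>T \<in> sets lebesgue" using T(1) by (intro sets.finite_Union T(2)) (auto simp: subcubes_def)
  qed (use T(1) in \<open>auto simp: subcubes_def\<close>)
  ultimately have "k * v \<le> measure lebesgue A" by simp
  with k show False by simp
qed

lemma mem_region: "x \<in> region M \<longleftrightarrow> (\<forall>e\<in>Basis. -1 \<le> x \<bullet> e / 2 powi M \<and> x \<bullet> e / 2 powi M < 1)"
proof -
  have "\<lfloor>t\<rfloor> \<in> {-1, 0} \<longleftrightarrow> -1 \<le> t \<and> t < 1" for t :: real by auto linarith+
  then show ?thesis by (simp add: region_def)
qed

lemma bounded_region: "bounded (region M :: 'a::euclidean_space set)"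
proof -
  have "region M \<subseteq> cbox (\<Sum>e\<in>Basis. (- (2 powi M)) *\<^sub>R e) (\<Sum>e\<in>Basis. (2 powi M) *\<^sub>R e :: 'a)"
  proof
    fix x :: 'a assume x: "x \<in> region M"
    have "- (2 powi M) \<le> x \<bullet> e \<and> x \<bullet> e \<le> 2 powi M" if "e \<in> Basis" for e
    proof -
      have "-1 \<le> x \<bullet> e / 2 powi M \<and> x \<bullet> e / 2 powi M \<le> 1" using x that by (auto simp: mem_region intro: less_imp_le)
      then show ?thesis by (simp add: pos_le_divide_eq pos_divide_le_eq)
    qed
    then show "x \<in> cbox (\<Sum>e\<in>Basis. (- (2 powi M)) *\<^sub>R e) (\<Sum>e\<in>Basis. (2 powi M) *\<^sub>R e :: 'a)"
      by (simp add: mem_box sum_negf)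
  qed
  then show ?thesis by (rule bounded_subset[OF bounded_cbox])
qed

lemma region_borel [measurable]: "(region M :: 'a::euclidean_space set) \<in> sets borel"
proof -
  have "region M = {x :: 'a. \<forall>e\<in>Basis. -1 \<le> x \<bullet> e / 2 powi M \<and> x \<bullet> e / 2 powi M < 1}" by (auto simp: mem_region)
  then show ?thesis by simp
qed

lemma region_lmeasurable: "region M \<in> lmeasurable"
  using bounded_region by (rule bounded_set_imp_lmeasurable) simp

lemma finite_subcubes_region [simp]: "finite (subcubes m (region M))"
  by (rule finite_subcubes[OF region_lmeasurable])

lemma finite_subcubes_cube: "P \<in> cubes m' \<Longrightarrow> finite (subcubes m P)"
  by (rule finite_subcubes[OF cube_lmeasurable])

lemma set_integral_subcubes:
  fixes f :: "'a::euclidean_space \<Rightarrow> real"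
  assumes P: "P \<in> cubes m'" "m \<le> m'" and f: "set_integrable lebesgue P f"
  shows "(LINT x:P|lebesgue. f x) = (\<Sum>R\<in>subcubes m P. LINT x:R|lebesgue. f x)"
proof -
  have "(LINT x:\<Union>(subcubes m P)|lebesgue. f x) = (\<Sum>R\<in>subcubes m P. LINT x:R|lebesgue. f x)"
  proof (rule set_integral_finite_Union[of "subcubes m P" "\<lambda>R. R" lebesgue f, simplified])
    show "disjoint_family_on (\<lambda>R. R) (subcubes m P)"
      using pairwise_disjnt_subcubes[of "subcubes m P" m P] by (auto simp: disjoint_family_on_def pairwise_def disjnt_def)
  qed (use finite_subcubes_cube[OF P(1)] f in \<open>auto simp: subcubes_def intro: set_integrable_subset\<close>)
  then show ?thesis by (simp add: Union_subcubes_cube[OF P])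
qed

text \<open>Comparing volumes counts the children without listing them.\<close>

lemma card_subcubes_Suc:
  fixes P :: "'a::euclidean_space set"
  assumes P: "P \<in> cubes m"
  shows "card (subcubes (m - 1) P) = 2 ^ DIM('a)"
proof -
  have "measure lebesgue P = (\<Sum>R\<in>subcubes (m - 1) P. measure lebesgue R)"
  proof -
    have "measure lebesgue (\<Union>(subcubes (m - 1) P)) = (\<Sum>R\<in>subcubes (m - 1) P. measure lebesgue R)"
      by (intro measure_Union' finite_subcubes_cube[OF P] pairwise_disjnt_subcubes[OF order_refl]) (auto simp: subcubes_def intro: cube_lmeasurable)
    then show ?thesis using Union_subcubes_cube[OF P, of "m - 1"] by simp
  qed
  also have "\<dots> = card (subcubes (m - 1) P) * (2 powi (m - 1)) ^ DIM('a)"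
  proof -
    have "(\<Sum>R\<in>subcubes (m - 1) P. measure lebesgue R) = (\<Sum>R\<in>subcubes (m - 1) P. (2 powi (m - 1)) ^ DIM('a))"
      by (rule sum.cong[OF refl]) (rule measure_cube, simp add: subcubes_def)
    then show ?thesis by simp
  qed
  finally have "(2 powi m) ^ DIM('a) = card (subcubes (m - 1) P) * (2 powi (m - 1) :: real) ^ DIM('a)"
    by (simp add: measure_cube[OF P])
  moreover have "(2 powi m :: real) = 2 * 2 powi (m - 1)" by (simp add: power_int_diff)
  ultimately have "real (card (subcubes (m - 1) P)) = 2 ^ DIM('a)" by (simp add: power_mult_distrib)
  then show ?thesis by (metis of_nat_eq_iff of_nat_numeral of_nat_power)
qed

lemma measure_child:
  fixes P R :: "'a::euclidean_space set"
  assumes "P \<in> cubes m" "R \<in> cubes (m - 1)"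
  shows "measure lebesgue P = 2 ^ DIM('a) * measure lebesgue R"
proof -
  have "(2 powi m :: real) = 2 * 2 powi (m - 1)" by (simp add: power_int_diff)
  then show ?thesis by (simp add: measure_cube[OF assms(1)] measure_cube[OF assms(2)] power_mult_distrib)
qed

text \<open>Passing from scale \<open>m\<close> to \<open>M\<close> divides the index by a power of
  2; once that power exceeds all coordinates of the index, only the quotients -1 and 0
  remain.\<close>

lemma cube_subset_region:
  assumes "Q \<in> cubes m"
  shows "\<exists>M0. \<forall>M\<ge>M0. Q \<subseteq> region M"
proof -
  obtain l where Q: "Q = dyadic_cube m l" using assms by (auto simp: cubes_def)
  define k where "k = (\<Sum>e\<in>Basis. nat \<bar>l e\<bar>)"
  have "Q \<subseteq> region M" if M: "M \<ge> m + int k" for M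
  proof
    fix x assume "x \<in> Q"
    have "\<lfloor>x \<bullet> e / 2 powi M\<rfloor> \<in> {-1, 0}" if e: "e \<in> Basis" for e
    proof -
      have "nat \<bar>l e\<bar> \<le> k" unfolding k_def by (rule member_le_sum) (use e in auto)
      also have "k \<le> nat (M - m)" using M by simp
      finally have "\<bar>l e\<bar> < 2 ^ nat (M - m)" using less_exp[of "nat (M - m)"]
        by (metis abs_ge_zero le_less_trans nat_less_iff of_nat_numeral of_nat_power)
      then have "l e div 2 ^ nat (M - m) \<in> {-1, 0}"
      proof (cases "l e < 0")
        case True
        then have "l e div 2 ^ nat (M - m) = -1"
          using \<open>\<bar>l e\<bar> < 2 ^ nat (M - m)\<close> by (intro int_div_pos_eq[of _ _ _ "l e + 2 ^ nat (M - m)"]) auto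
        then show ?thesis by simp
      next
        case False
        then show ?thesis using \<open>\<bar>l e\<bar> < 2 ^ nat (M - m)\<close> by (simp add: div_pos_pos_trivial)
      qed
      moreover have "\<lfloor>x \<bullet> e / 2 powi m\<rfloor> = l e" using \<open>x \<in> Q\<close> e by (simp add: Q mem_dyadic_cube)
      moreover have "m \<le> M" using M by simp
      ultimately show ?thesis by (simp add: floor_div_powi)
    qed
    then show "x \<in> region M" by (simp add: region_def)
  qed
  then show ?thesis by blast
qed

section \<open>Dyadic step functions\<close>

text \<open>Fixing a resolution \<open>m\<close> and a region \<open>M\<close> leaves finitely many
  cubes to deal with. Every dyadic test function is of this kind for small \<open>m\<close> and
  large \<open>M\<close>.\<close>

definition step_fun :: "int \<Rightarrow> int \<Rightarrow> ('a::euclidean_space \<Rightarrow> real) \<Rightarrow> bool" where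
  "step_fun m M f \<longleftrightarrow> (\<forall>x. \<forall>y\<in>cube_at m x. f y = f x) \<and> supported_on f (region M)"

lemma step_const: "step_fun m M f \<Longrightarrow> Q \<in> cubes m \<Longrightarrow> x \<in> Q \<Longrightarrow> y \<in> Q \<Longrightarrow> f y = f x"
  using cubes_eq_cube_at unfolding step_fun_def by blast

lemma step_supp: "step_fun m M f \<Longrightarrow> x \<notin> region M \<Longrightarrow> f x = 0"
  by (auto simp: step_fun_def supported_on_def)

lemma step_comp: "h 0 = 0 \<Longrightarrow> step_fun m M f \<Longrightarrow> step_fun m M (\<lambda>x. h (f x))"
  by (auto simp: step_fun_def supported_on_def)

lemma step_comp2: "h 0 0 = 0 \<Longrightarrow> step_fun m M f \<Longrightarrow> step_fun m M g \<Longrightarrow> step_fun m M (\<lambda>x. h (f x) (g x))"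
  by (simp add: step_fun_def supported_on_def)

lemma step_zero: "step_fun m M (\<lambda>x. 0)"
  by (auto simp: step_fun_def supported_on_def)

lemma step_add: "step_fun m M f \<Longrightarrow> step_fun m M g \<Longrightarrow> step_fun m M (\<lambda>x. f x + g x)"
  by (rule step_comp2) auto

lemma step_diff: "step_fun m M f \<Longrightarrow> step_fun m M g \<Longrightarrow> step_fun m M (\<lambda>x. f x - g x)"
  by (rule step_comp2) auto

lemma step_mult: "step_fun m M f \<Longrightarrow> step_fun m M g \<Longrightarrow> step_fun m M (\<lambda>x. f x * g x)"
  by (rule step_comp2) auto

lemma step_cmult: "step_fun m M f \<Longrightarrow> step_fun m M (\<lambda>x. c * f x)"
  by (rule step_comp) auto

lemma step_sum: "(\<And>i. i \<in> I \<Longrightarrow> step_fun m M (f i)) \<Longrightarrow> step_fun m M (\<lambda>x. \<Sum>i\<in>I. f i x)"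
  by (induction I rule: infinite_finite_induct) (auto intro: step_zero step_add)

lemma indicator_cube_const:
  assumes "Q \<in> cubes m'" "m \<le> m'" "y \<in> cube_at m x"
  shows "indicator Q y = indicator Q x"
proof -
  have "cube_at m x \<subseteq> Q \<or> cube_at m x \<inter> Q = {}" by (rule cubes_nested[OF cube_at_in(1) assms(1,2)])
  then have "y \<in> Q \<longleftrightarrow> x \<in> Q" using assms(3) cube_at_in(2)[of x m] by blast
  then show ?thesis by (simp add: indicator_def)
qed

lemma step_indicator: "Q \<in> cubes m' \<Longrightarrow> m \<le> m' \<Longrightarrow> Q \<subseteq> region M \<Longrightarrow> step_fun m M (indicator Q)"
  unfolding step_fun_def supported_on_def using indicator_cube_const[of Q m' m] by (auto intro: indicator_simps(2))

lemma step_mult_indicator: "step_fun m M f \<Longrightarrow> Q \<in> cubes m' \<Longrightarrow> m \<le> m' \<Longrightarrow> step_fun m M (\<lambda>x. f x * indicator Q x)"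
  unfolding step_fun_def using indicator_cube_const[of Q m' m] by (auto simp: supported_on_def)

lemma region_mono: "M \<le> M' \<Longrightarrow> region M \<subseteq> region M'"
proof
  fix x assume "M \<le> M'" "x \<in> region M"
  moreover have "(-1::int) div 2 ^ k = -1" for k by (intro int_div_pos_eq[of _ _ _ "2 ^ k - 1"]) auto
  ultimately show "x \<in> region M'" by (auto simp: region_def floor_div_powi)
qed

lemma step_mono: "step_fun m M f \<Longrightarrow> M \<le> M' \<Longrightarrow> step_fun m M' f"
  using region_mono[of M M'] unfolding step_fun_def supported_on_def by blast

lemma step_repr:
  fixes f :: "'a::euclidean_space \<Rightarrow> real"
  assumes "m \<le> M" "step_fun m M f"
  shows "\<exists>c. f = (\<lambda>x. \<Sum>Q\<in>subcubes m (region M). c Q * indicator Q x)"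
proof (intro exI ext)
  fix x :: 'a
  let ?c = "\<lambda>Q. f (SOME y. y \<in> Q)"
  show "f x = (\<Sum>Q\<in>subcubes m (region M). ?c Q * indicator Q x)"
  proof (cases "x \<in> region M")
    case False
    have "(\<Sum>Q\<in>subcubes m (region M). ?c Q * indicator Q x) = 0"
      using False by (intro sum.neutral) (auto simp: subcubes_def indicator_def)
    then show ?thesis using step_supp[OF assms(2) False] by simp
  next
    case True
    then obtain R where R: "R \<in> subcubes m (region M)" "x \<in> R" using Union_subcubes_region[OF assms(1)] by blast
    have "(\<Sum>Q\<in>subcubes m (region M). ?c Q * indicator Q x) = (\<Sum>Q\<in>subcubes m (region M). if Q = R then ?c R else 0)"
    proof (rule sum.cong[OF refl])
      fix Q :: "'a set" assume "Q \<in> subcubes m (region M)"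
      then show "?c Q * indicator Q x = (if Q = R then ?c R else 0)"
        using R cubes_disjoint[of Q m R] by (auto simp: subcubes_def indicator_def)
    qed
    also have "\<dots> = ?c R" using R(1) by simp
    also have "\<dots> = f x" by (rule step_const[OF assms(2) _ R(2) someI[of "\<lambda>y. y \<in> R", OF R(2)]]) (use R(1) in \<open>auto simp: subcubes_def\<close>)
    finally show ?thesis by simp
  qed
qed

lemma step_test: "m \<le> M \<Longrightarrow> step_fun m M f \<Longrightarrow> dyadic_test f" for f :: "'a::euclidean_space \<Rightarrow> real"
proof -
  assume "m \<le> M" "step_fun m M f"
  then obtain c where "f = (\<lambda>x. \<Sum>Q\<in>subcubes m (region M). c Q * indicator Q x)" using step_repr by blast
  moreover have "subcubes m (region M :: 'a set) \<subseteq> dyadic_cubes" by (auto simp: subcubes_def cubes_imp_dyadic)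
  ultimately show ?thesis unfolding dyadic_test_def using finite_subcubes_region by blast
qed

lemma test_step:
  assumes "dyadic_test f"
  shows "\<exists>m0 M0. \<forall>m\<le>m0. \<forall>M\<ge>M0. step_fun m M f"
proof -
  obtain \<Q> c where Q: "finite \<Q>" "\<Q> \<subseteq> dyadic_cubes" "f = (\<lambda>x. \<Sum>Q\<in>\<Q>. c Q * indicator Q x)"
    using assms by (auto simp: dyadic_test_def)
  have "\<exists>m0 M0. \<forall>m\<le>m0. \<forall>M\<ge>M0. step_fun m M (\<lambda>x. \<Sum>Q\<in>\<Q>. c Q * indicator Q x)"
    using Q(1,2)
  proof (induction \<Q>)
    case empty
    then show ?case by (simp add: step_zero)
  next
    case (insert Q \<Q>)
    then obtain m0 M0 where 1: "\<And>m M. m \<le> m0 \<Longrightarrow> M \<ge> M0 \<Longrightarrow> step_fun m M (\<lambda>x. \<Sum>Q\<in>\<Q>. c Q * indicator Q x)" by auto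
    obtain s where s: "Q \<in> cubes s" using insert.prems by (auto simp: dyadic_cubes_eq)
    then obtain M1 where M1: "\<And>M. M \<ge> M1 \<Longrightarrow> Q \<subseteq> region M" using cube_subset_region by blast
    have "step_fun m M (\<lambda>x. \<Sum>Q\<in>insert Q \<Q>. c Q * indicator Q x)" if "m \<le> min m0 s" "M \<ge> max M0 M1" for m M
      unfolding sum.insert[OF insert.hyps] using that
      by (intro step_add step_cmult 1 step_indicator[OF s] M1) auto
    then show ?case by blast
  qed
  then show ?thesis by (simp add: Q(3))
qed

lemma step_integrable:
  assumes "m \<le> M" "step_fun m M f"
  shows "integrable lebesgue f"
proof -
  obtain c where f: "f = (\<lambda>x. \<Sum>Q\<in>subcubes m (region M). c Q * indicator Q x)" using step_repr[OF assms] by blast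
  have "integrable lebesgue (indicator Q :: _ \<Rightarrow> real)" if "Q \<in> subcubes m (region M)" for Q :: "'a set"
    using that cube_lmeasurable by (auto simp: subcubes_def integrable_indicator_iff fmeasurable_def)
  then show ?thesis unfolding f by (intro Bochner_Integration.integrable_sum integrable_mult_right)
qed

lemma integrable_imp_set: "integrable lebesgue f \<Longrightarrow> A \<in> sets lebesgue \<Longrightarrow> set_integrable lebesgue A f"
  for f :: "'a::euclidean_space \<Rightarrow> real"
  unfolding set_integrable_def by (rule integrable_mult_indicator)

lemma step_set_integrable: "m \<le> M \<Longrightarrow> step_fun m M f \<Longrightarrow> A \<in> sets lebesgue \<Longrightarrow> set_integrable lebesgue A f"
  by (intro integrable_imp_set step_integrable)

lemma step_li: "m \<le> M \<Longrightarrow> step_fun m M f \<Longrightarrow> locally_integrable f"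
  unfolding locally_integrable_def by (auto intro!: step_set_integrable dest: compact_imp_closed)

lemma li_set_integrable:
  assumes "locally_integrable f" "Q \<in> cubes m"
  shows "set_integrable lebesgue Q f"
proof -
  obtain M where "Q \<subseteq> region M" using cube_subset_region[OF assms(2)] by blast
  then have "bounded Q" using bounded_region bounded_subset by blast
  then have "compact (closure Q)" by simp
  then have "set_integrable lebesgue (closure Q) f" using assms(1) by (simp add: locally_integrable_def)
  then show ?thesis by (rule set_integrable_subset) (use assms(2) closure_subset in auto)
qed

lemma leaf_integral:
  assumes "step_fun m M f" "Q \<in> cubes m" "x \<in> Q"
  shows "(LINT y:Q|lebesgue. f y) = f x * measure lebesgue Q"
proof -
  have "(LINT y:Q|lebesgue. f y) = (LINT y:Q|lebesgue. f x)"
    using step_const[OF assms(1,2,3)] assms(2) by (intro set_lebesgue_integral_cong) auto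
  then show ?thesis using cube_lmeasurable[OF assms(2)]
    by (simp add: set_lebesgue_integral_def)
qed

lemma supported_integral:
  assumes "supported_on f Q"
  shows "(LINT x:Q|lebesgue. f x) = (LINT x|lebesgue. f x)"
  unfolding set_lebesgue_integral_def using assms
  by (intro Bochner_Integration.integral_cong) (auto simp: supported_on_def indicator_def)

lemma integral_roots:
  assumes "m \<le> M" "step_fun m M f"
  shows "(LINT x|lebesgue. f x) = (\<Sum>Q\<in>subcubes M (region M). LINT x:Q|lebesgue. f x)"
proof -
  have "(LINT x:\<Union>(subcubes M (region M))|lebesgue. f x) = (\<Sum>Q\<in>subcubes M (region M). LINT x:Q|lebesgue. f x)"
  proof (rule set_integral_finite_Union[of "subcubes M (region M)" "\<lambda>R. R" lebesgue f, simplified])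
    show "disjoint_family_on (\<lambda>R. R) (subcubes M (region M))"
      using pairwise_disjnt_subcubes[of "subcubes M (region M)" M "region M"] by (auto simp: disjoint_family_on_def pairwise_def disjnt_def)
  qed (use assms in \<open>auto simp: subcubes_def intro!: step_set_integrable\<close>)
  moreover have "supported_on f (region M)" using assms(2) by (simp add: step_fun_def)
  ultimately show ?thesis by (simp add: Union_subcubes_region supported_integral)
qed

section \<open>Averaging at the finest scale, and the kernel as a finite sum\<close>

text \<open>The conditional expectation on the cubes of scale \<open>m\<close>, cut off to the
  region.\<close>

definition proj :: "int \<Rightarrow> int \<Rightarrow> ('a::euclidean_space \<Rightarrow> real) \<Rightarrow> 'a \<Rightarrow> real" where
  "proj m M b x = (if x \<in> region M then mean_on b (cube_at m x) else 0)"

lemma proj_step: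
  assumes "m \<le> M"
  shows "step_fun m M (proj m M b)"
  unfolding step_fun_def supported_on_def
proof (intro conjI allI ballI impI)
  fix x y :: 'a assume y: "y \<in> cube_at m x"
  have "cube_at m y = cube_at m x" using cubes_eq_cube_at[OF _ y] by simp
  moreover have "y \<in> region M \<longleftrightarrow> x \<in> region M"
    using region_cube[OF cube_at_in(1)[of m x] assms] y cube_at_in(2)[of x m] by blast
  ultimately show "proj m M b y = proj m M b x" by (simp add: proj_def)
qed (simp add: proj_def)

lemma proj_integral:
  assumes "m \<le> M" "Q \<in> cubes s" "m \<le> s" "Q \<subseteq> region M" "set_integrable lebesgue Q b"
  shows "(LINT x:Q|lebesgue. proj m M b x) = (LINT x:Q|lebesgue. b x)"
proof -
  have "(LINT x:Q|lebesgue. proj m M b x) = (\<Sum>R\<in>subcubes m Q. LINT x:R|lebesgue. proj m M b x)"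
    using assms by (intro set_integral_subcubes[of Q s] step_set_integrable[of m M] proj_step) auto
  also have "\<dots> = (\<Sum>R\<in>subcubes m Q. LINT x:R|lebesgue. b x)"
  proof (rule sum.cong[OF refl])
    fix R assume R: "R \<in> subcubes m Q"
    then obtain x where x: "x \<in> R" using cubes_nonempty[of R m] by (auto simp: subcubes_def)
    have "(LINT x:R|lebesgue. proj m M b x) = proj m M b x * measure lebesgue R"
      using R x by (intro leaf_integral[OF proj_step[OF assms(1)]]) (auto simp: subcubes_def)
    also have "proj m M b x = mean_on b R"
    proof -
      have "R = cube_at m x" "x \<in> region M" using R x assms(4) cubes_eq_cube_at[of R m x] unfolding subcubes_def by blast+
      then show ?thesis by (simp add: proj_def)
    qed
    also have "mean_on b R * measure lebesgue R = (LINT x:R|lebesgue. b x)"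
      using measure_cube_pos[of R m] R by (auto simp: mean_on_def subcubes_def)
    finally show "(LINT x:R|lebesgue. proj m M b x) = (LINT x:R|lebesgue. b x)" .
  qed
  also have "\<dots> = (LINT x:Q|lebesgue. b x)" using assms by (intro set_integral_subcubes[symmetric])
  finally show ?thesis .
qed

lemma mean_on_bound:
  assumes "AE x in lebesgue. \<bar>b x\<bar> \<le> B" "set_integrable lebesgue Q b" "Q \<in> cubes m"
  shows "\<bar>mean_on b Q\<bar> \<le> B"
proof -
  have c: "set_integrable lebesgue Q (\<lambda>x. B)"
    using cube_lmeasurable[OF assms(3)]
    by (auto simp: set_integrable_def fmeasurable_def simp del: emeasure_completion intro!: integrable_real_mult_indicator integrable_mult_left integrable_real_indicator)
  have "\<bar>LINT x:Q|lebesgue. b x\<bar> \<le> (LINT x:Q|lebesgue. \<bar>b x\<bar>)"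
    using set_integral_norm_bound[OF assms(2)] by simp
  also have "\<dots> \<le> (LINT x:Q|lebesgue. B)"
    using assms(1) by (intro set_integral_mono_AE set_integrable_abs assms(2) c) auto
  also have "\<dots> = B * measure lebesgue Q"
    using cube_lmeasurable[OF assms(3)] by (simp add: set_lebesgue_integral_def)
  finally show ?thesis using measure_cube_pos[OF assms(3)] by (simp add: mean_on_def abs_divide divide_le_eq)
qed

text \<open>Each cube of the kernel is a product, so Fubini turns the form into a finite combination
  of products of integrals over cubes, valid for all locally integrable arguments. This sum replaces
  the kernel from here on.\<close>

lemma kernel_repr:
  fixes \<Lambda> :: "('n::finite \<Rightarrow> 'a::euclidean_space \<Rightarrow> real) \<Rightarrow> real"
  assumes "qualitative_truncation \<Lambda>"
  shows "\<exists>(I :: ('a ^ 'n) set set) c T s. finite I \<and> (\<forall>k\<in>I. \<forall>j. T k j \<in> cubes (s k)) \<and>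
    (\<forall>f. (\<forall>j. locally_integrable (f j)) \<longrightarrow> \<Lambda> f = (\<Sum>k\<in>I. c k * (\<Prod>j\<in>UNIV. (LINT x:T k j|lebesgue. f j x))))"
proof -
  obtain K :: "'a ^ 'n \<Rightarrow> real" where K: "dyadic_test K"
    "\<And>f. (\<forall>j. locally_integrable (f j)) \<Longrightarrow> \<Lambda> f = (LINT x|lebesgue. K x * (\<Prod>j\<in>UNIV. f j (x $ j)))"
    using assms by (auto simp: qualitative_truncation_def)
  obtain I c where I: "finite I" "I \<subseteq> dyadic_cubes" "K = (\<lambda>x. \<Sum>Q\<in>I. c Q * indicator Q x)"
    using K(1) by (auto simp: dyadic_test_def)
  have "\<forall>Q\<in>I. \<exists>s l. Q = dyadic_cube s l" using I(2) by (auto simp: dyadic_cubes_def)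
  then obtain s l where sl: "\<And>Q. Q \<in> I \<Longrightarrow> Q = dyadic_cube (s Q) (l Q)" by metis
  define T where "T Q j = (dyadic_cube (s Q) (\<lambda>e. l Q (axis j e)) :: 'a set)" for Q and j :: 'n
  have T: "T Q j \<in> cubes (s Q)" for Q j by (simp add: T_def cubes_def)
  have "\<Lambda> f = (\<Sum>k\<in>I. c k * (\<Prod>j\<in>UNIV. (LINT x:T k j|lebesgue. f j x)))"
    if f: "\<forall>j. locally_integrable (f j)" for f
  proof -
    have int: "integrable lebesgue (\<lambda>x. indicator (T Q j) x * f j x)" for Q j
      using li_set_integrable[of "f j", OF _ T[of Q j]] f by (simp add: set_integrable_def)
    have "\<Lambda> f = (LINT x|lebesgue. (\<Sum>Q\<in>I. c Q * (\<Prod>j\<in>UNIV. indicator (T Q j) (x $ j) * f j (x $ j))))"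
      unfolding K(2)[OF f]
    proof (rule Bochner_Integration.integral_cong[OF refl])
      fix x :: "'a ^ 'n"
      have "indicator Q x = (\<Prod>j\<in>UNIV. indicator (T Q j) (x $ j) :: real)" if "Q \<in> I" for Q
      proof -
        have "x \<in> Q \<longleftrightarrow> (\<forall>j. x $ j \<in> T Q j)" using sl[OF that] dyadic_cube_vec[of x "s Q" "l Q"] by (simp add: T_def)
        then show ?thesis by (cases "x \<in> Q") (simp_all add: indicator_def)
      qed
      then show "K x * (\<Prod>j\<in>UNIV. f j (x $ j)) = (\<Sum>Q\<in>I. c Q * (\<Prod>j\<in>UNIV. indicator (T Q j) (x $ j) * f j (x $ j)))"
        unfolding I(3) sum_distrib_right prod.distrib by (intro sum.cong) auto
    qed
    also have "\<dots> = (\<Sum>Q\<in>I. c Q * (\<Prod>j\<in>UNIV. (LINT x|lebesgue. indicator (T Q j) x * f j x)))"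
    proof (subst Bochner_Integration.integral_sum)
      show "integrable lebesgue (\<lambda>x :: 'a ^ 'n. c Q * (\<Prod>j\<in>UNIV. indicator (T Q j) (x $ j) * f j (x $ j)))" for Q
        by (intro integrable_mult_right integral_prod_components(1) int)
      show "(\<Sum>Q\<in>I. LINT x|lebesgue. c Q * (\<Prod>j\<in>UNIV. indicator (T Q j) ((x :: 'a ^ 'n) $ j) * f j (x $ j)))
        = (\<Sum>Q\<in>I. c Q * (\<Prod>j\<in>UNIV. (LINT x|lebesgue. indicator (T Q j) x * f j x)))"
        by (intro sum.cong refl) (simp add: integral_prod_components(2)[OF int])
    qed
    finally show ?thesis by (simp add: set_lebesgue_integral_def)
  qed
  then show ?thesis using I(1) T by blast
qed

section \<open>Perfect forms on step functions\<close>

text \<open>The scale \<open>m\<close> lies at or below that of every cube in the kernel sum, and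
  the region of scale \<open>M\<close> contains them all. The smoothness and decay axioms speak of
  test functions only; \<open>repr\<close> also reaches the functions \<open>b j\<close>.\<close>

locale perfect_form =
  fixes \<Lambda> :: "('n::finite \<Rightarrow> 'a::euclidean_space \<Rightarrow> real) \<Rightarrow> real" and m M :: int
    and I :: "'i set" and c :: "'i \<Rightarrow> real" and T :: "'i \<Rightarrow> 'n \<Rightarrow> 'a set" and s :: "'i \<Rightarrow> int"
  assumes mM: "m \<le> M" and finite_I: "finite I"
    and T: "k \<in> I \<Longrightarrow> T k j \<in> cubes (s k)" "k \<in> I \<Longrightarrow> m \<le> s k" "k \<in> I \<Longrightarrow> T k j \<subseteq> region M"
    and repr: "(\<And>j. locally_integrable (f j)) \<Longrightarrow> \<Lambda> f = (\<Sum>k\<in>I. c k * (\<Prod>j\<in>UNIV. (LINT x:T k j|lebesgue. f j x)))"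
    and decay: "dyadic_decay \<Lambda>" and smooth: "perfect_smoothness \<Lambda>"
begin



text \<open>The kernel sum tests its arguments only against cubes of scale at least \<open>m\<close>
  inside the region. This permits averaging the \<open>b j\<close> at scale
  \<open>m\<close>.\<close>

lemma cong_integrals:
  assumes "\<And>j. locally_integrable (f j)" "\<And>j. locally_integrable (g j)"
    and "\<And>j Q r. Q \<in> cubes r \<Longrightarrow> m \<le> r \<Longrightarrow> Q \<subseteq> region M \<Longrightarrow> (LINT x:Q|lebesgue. f j x) = (LINT x:Q|lebesgue. g j x)"
  shows "\<Lambda> f = \<Lambda> g"
  unfolding repr[OF assms(1)] repr[OF assms(2)]
  by (intro sum.cong refl arg_cong2[where f = "(*)"] prod.cong assms(3)[OF T])

lemma upd_eq:
  assumes "\<And>i. i \<noteq> j \<Longrightarrow> locally_integrable (f i)" "locally_integrable u"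
  shows "\<Lambda> (f(j := u)) = (\<Sum>k\<in>I. c k * (\<Prod>i\<in>UNIV - {j}. (LINT x:T k i|lebesgue. f i x)) * (LINT x:T k j|lebesgue. u x))"
proof -
  have "\<Lambda> (f(j := u)) = (\<Sum>k\<in>I. c k * (\<Prod>i\<in>UNIV. (LINT x:T k i|lebesgue. (f(j := u)) i x)))"
    by (rule repr) (use assms in auto)
  also have "\<dots> = (\<Sum>k\<in>I. c k * (\<Prod>i\<in>UNIV - {j}. (LINT x:T k i|lebesgue. f i x)) * (LINT x:T k j|lebesgue. u x))"
  proof (rule sum.cong[OF refl])
    fix k
    have "(\<Prod>i\<in>UNIV. (LINT x:T k i|lebesgue. (f(j := u)) i x))
      = (LINT x:T k j|lebesgue. u x) * (\<Prod>i\<in>UNIV - {j}. (LINT x:T k i|lebesgue. (f(j := u)) i x))"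
      by (subst prod.remove[of UNIV j]) auto
    also have "(\<Prod>i\<in>UNIV - {j}. (LINT x:T k i|lebesgue. (f(j := u)) i x)) = (\<Prod>i\<in>UNIV - {j}. (LINT x:T k i|lebesgue. f i x))"
      by (intro prod.cong) auto
    finally show "c k * (\<Prod>i\<in>UNIV. (LINT x:T k i|lebesgue. (f(j := u)) i x)) = 
      c k * (\<Prod>i\<in>UNIV - {j}. (LINT x:T k i|lebesgue. f i x)) * (LINT x:T k j|lebesgue. u x)" by simp
  qed
  finally show ?thesis .
qed

lemma upd_diff:
  assumes "\<And>i. i \<noteq> j \<Longrightarrow> locally_integrable (f i)" "locally_integrable u" "locally_integrable v" "locally_integrable (\<lambda>x. u x - v x)"
  shows "\<Lambda> (f(j := \<lambda>x. u x - v x)) = \<Lambda> (f(j := u)) - \<Lambda> (f(j := v))"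
proof -
  have "(LINT x:T k j|lebesgue. u x - v x) = (LINT x:T k j|lebesgue. u x) - (LINT x:T k j|lebesgue. v x)" if "k \<in> I" for k
    using that assms T(1) by (intro set_integral_diff li_set_integrable) auto
  note d = this
  have e: "\<Lambda> (f(j := h)) = (\<Sum>k\<in>I. c k * (\<Prod>i\<in>UNIV - {j}. (LINT x:T k i|lebesgue. f i x)) * (LINT x:T k j|lebesgue. h x))"
    if "locally_integrable h" for h
    by (rule upd_eq) (use assms(1) that in auto)
  show ?thesis
    unfolding e[OF assms(4)] e[OF assms(2)] e[OF assms(3)] sum_subtractf[symmetric]
    by (intro sum.cong refl) (simp only: d right_diff_distrib)
qed

lemma upd_zero:
  assumes "\<And>i. i \<noteq> j \<Longrightarrow> locally_integrable (f i)"
  shows "\<Lambda> (f(j := \<lambda>x. 0)) = 0"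
  using upd_eq[of j f "\<lambda>x. 0", OF assms step_li[OF mM step_zero]] by (simp add: set_lebesgue_integral_def)

text \<open>Multilinearity for finite sums in all arguments at once. It is read off from the kernel
  sum, and so holds for locally integrable pieces.\<close>

lemma expand:
  assumes "\<And>j. finite (A j)" "\<And>j R. R \<in> A j \<Longrightarrow> locally_integrable (g j R)"
    "\<And>j. locally_integrable (\<lambda>x. \<Sum>R\<in>A j. v j R * g j R x)"
  shows "\<Lambda> (\<lambda>j x. \<Sum>R\<in>A j. v j R * g j R x) = (\<Sum>\<rho>\<in>PiE UNIV A. (\<Prod>j\<in>UNIV. v j (\<rho> j)) * \<Lambda> (\<lambda>j. g j (\<rho> j)))"
proof -
  have "\<Lambda> (\<lambda>j x. \<Sum>R\<in>A j. v j R * g j R x)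
     = (\<Sum>k\<in>I. c k * (\<Prod>j\<in>UNIV. (LINT x:T k j|lebesgue. (\<Sum>R\<in>A j. v j R * g j R x))))"
    by (rule repr) (rule assms)
  also have "\<dots> = (\<Sum>k\<in>I. c k * (\<Prod>j\<in>UNIV. \<Sum>R\<in>A j. v j R * (LINT x:T k j|lebesgue. g j R x)))"
  proof (intro sum.cong refl arg_cong2[where f = "(*)"] prod.cong)
    fix k j assume k: "k \<in> I"
    have "(LINT x:T k j|lebesgue. (\<Sum>R\<in>A j. v j R * g j R x)) = (LINT x|lebesgue. (\<Sum>R\<in>A j. v j R * (indicator (T k j) x * g j R x)))"
      unfolding set_lebesgue_integral_def by (intro Bochner_Integration.integral_cong) (auto simp: sum_distrib_left algebra_simps)
    also have "\<dots> = (\<Sum>R\<in>A j. (LINT x|lebesgue. v j R * (indicator (T k j) x * g j R x)))"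
      using li_set_integrable[OF assms(2) T(1)[OF k]]
      by (intro Bochner_Integration.integral_sum integrable_mult_right) (auto simp: set_integrable_def)
    finally show "(LINT x:T k j|lebesgue. (\<Sum>R\<in>A j. v j R * g j R x)) = (\<Sum>R\<in>A j. v j R * (LINT x:T k j|lebesgue. g j R x))"
      by (simp add: set_lebesgue_integral_def)
  qed
  also have "\<dots> = (\<Sum>k\<in>I. c k * (\<Sum>\<rho>\<in>PiE UNIV A. \<Prod>j\<in>UNIV. v j (\<rho> j) * (LINT x:T k j|lebesgue. g j (\<rho> j) x)))"
    by (subst prod_sum_PiE) (use assms(1) in auto)
  also have "\<dots> = (\<Sum>\<rho>\<in>PiE UNIV A. \<Sum>k\<in>I. c k * (\<Prod>j\<in>UNIV. v j (\<rho> j) * (LINT x:T k j|lebesgue. g j (\<rho> j) x)))"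
    unfolding sum_distrib_left by (rule sum.swap)
  also have "\<dots> = (\<Sum>\<rho>\<in>PiE UNIV A. (\<Prod>j\<in>UNIV. v j (\<rho> j)) * \<Lambda> (\<lambda>j. g j (\<rho> j)))"
  proof (rule sum.cong[OF refl])
    fix \<rho> assume "\<rho> \<in> PiE UNIV A"
    then have "\<Lambda> (\<lambda>j. g j (\<rho> j)) = (\<Sum>k\<in>I. c k * (\<Prod>j\<in>UNIV. (LINT x:T k j|lebesgue. g j (\<rho> j) x)))"
      by (intro repr assms(2)) auto
    then show "(\<Sum>k\<in>I. c k * (\<Prod>j\<in>UNIV. v j (\<rho> j) * (LINT x:T k j|lebesgue. g j (\<rho> j) x))) = (\<Prod>j\<in>UNIV. v j (\<rho> j)) * \<Lambda> (\<lambda>j. g j (\<rho> j))"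
      by (simp add: prod.distrib sum_distrib_left algebra_simps)
  qed
  finally show ?thesis .
qed

lemma scale:
  assumes "\<And>j. step_fun m M' (f j)" "m \<le> M'"
  shows "\<Lambda> (\<lambda>j x. v j * f j x) = (\<Prod>j\<in>UNIV. v j) * \<Lambda> f"
proof -
  have "\<Lambda> (\<lambda>j x. v j * f j x) = \<Lambda> (\<lambda>j x. \<Sum>R\<in>{()}. v j * f j x)" by simp
  also have "\<dots> = (\<Sum>\<rho>\<in>PiE (UNIV :: 'n set) (\<lambda>_. {()}). (\<Prod>j\<in>UNIV. v j) * \<Lambda> (\<lambda>j. f j))"
    using expand[of "\<lambda>_. {()}" "\<lambda>j _. f j" "\<lambda>j _. v j"] step_li[OF assms(2) assms(1)] step_li[OF assms(2) step_cmult[OF assms(1)]] by simp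
  also have "\<dots> = (\<Prod>j\<in>UNIV. v j) * \<Lambda> f" by (simp add: card_PiE)
  finally show ?thesis .
qed

text \<open>The arguments are exchanged one at a time: \<open>S\<close> collects those already
  exchanged, and \<open>z\<close> says that the next exchange leaves the form unchanged.\<close>

lemma replace:
  assumes M': "m \<le> M'" and u: "\<And>j. step_fun m M' (u j)" and v: "\<And>j. step_fun m M' (v j)"
    and z: "\<And>S j. j \<notin> S \<Longrightarrow> \<Lambda> ((\<lambda>i. if i \<in> S then v i else u i)(j := \<lambda>x. v j x - u j x)) = 0"
  shows "\<Lambda> u = \<Lambda> v"
proof -
  have "\<Lambda> (\<lambda>i. if i \<in> S then v i else u i) = \<Lambda> u" for S
  proof (induction S rule: finite_induct[OF finite])
    case (2 j S)
    let ?f = "\<lambda>i. if i \<in> S then v i else u i"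
    have A: "(\<lambda>i. if i \<in> insert j S then v i else u i) = ?f(j := v j)" by (auto simp: fun_eq_iff)
    have B: "?f(j := u j) = ?f" using 2(2) by (auto simp: fun_eq_iff)
    have "\<Lambda> (?f(j := \<lambda>x. v j x - u j x)) = \<Lambda> (?f(j := v j)) - \<Lambda> (?f(j := u j))"
      using u v by (intro upd_diff) (auto intro!: step_li[OF M'] step_diff)
    then have "\<Lambda> (?f(j := v j)) = \<Lambda> ?f" unfolding z[OF 2(2)] B by simp
    then show ?case unfolding A 2(3) .
  qed simp
  from this[of UNIV] show ?thesis by simp
qed

lemma smoothD:
  assumes "m \<le> M'" "\<And>i. step_fun m M' (f i)" "P \<in> cubes r" "j \<noteq> k"
    "supported_on (f j) P" "(LINT x|lebesgue. f j x) = 0" "\<And>x. x \<in> P \<Longrightarrow> f k x = 0"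
  shows "\<Lambda> f = 0"
proof -
  have "P \<in> dyadic_cubes" "\<forall>i. dyadic_test (f i)" using cubes_imp_dyadic step_test assms(1-3) by blast+
  then show ?thesis using smooth assms(4-7) unfolding perfect_smoothness_def by blast
qed

text \<open>Exchanging \<open>u j\<close> for \<open>v j\<close> changes the form by its value on a
  mean zero function supported on \<open>\<rho> j\<close>. Some \<open>\<rho> k\<close> is a
  different cube of the same scale, hence disjoint, so the argument \<open>k\<close> vanishes on
  \<open>\<rho> j\<close> and perfect smoothness applies.\<close>

lemma off_diagonal:
  assumes M': "m \<le> M'" and u: "\<And>j. step_fun m M' (u j)" and v: "\<And>j. step_fun m M' (v j)"
    and \<rho>: "\<And>j. \<rho> j \<in> cubes r" "\<rho> j0 \<noteq> \<rho> k0"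
    and supp: "\<And>j. supported_on (u j) (\<rho> j)" "\<And>j. supported_on (v j) (\<rho> j)"
    and int: "\<And>j. (LINT x|lebesgue. u j x) = (LINT x|lebesgue. v j x)"
  shows "\<Lambda> u = \<Lambda> v"
proof (rule replace[OF M' u v])
  fix S and j :: 'n
  obtain k where k: "\<rho> k \<noteq> \<rho> j" using \<rho>(2) by metis
  then have kj: "j \<noteq> k" by auto
  have dis: "\<rho> k \<inter> \<rho> j = {}" using cubes_disjoint[OF \<rho>(1) \<rho>(1) k] .
  show "\<Lambda> ((\<lambda>i. if i \<in> S then v i else u i)(j := \<lambda>x. v j x - u j x)) = 0"
  proof (rule smoothD[OF M' _ \<rho>(1) kj])
    show "step_fun m M' (((\<lambda>i. if i \<in> S then v i else u i)(j := \<lambda>x. v j x - u j x)) i)" for i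
      using u v by (auto intro: step_diff)
    show "supported_on (((\<lambda>i. if i \<in> S then v i else u i)(j := \<lambda>x. v j x - u j x)) j) (\<rho> j)"
      using supp by (auto simp: supported_on_def)
    show "(LINT x|lebesgue. ((\<lambda>i. if i \<in> S then v i else u i)(j := \<lambda>x. v j x - u j x)) j x) = 0"
      using int step_integrable[OF M' u] step_integrable[OF M' v] by simp
    show "((\<lambda>i. if i \<in> S then v i else u i)(j := \<lambda>x. v j x - u j x)) k x = 0" if "x \<in> \<rho> j" for x
    proof -
      have "x \<notin> \<rho> k" using dis that by blast
      then show ?thesis using supp kj by (auto simp: supported_on_def)
    qed
  qed
qed

text \<open>In a slot \<open>i\<close> other than \<open>j\<close>, the difference of
  \<open>b i\<close> and its restriction to \<open>P\<close> vanishes on \<open>P\<close>, where the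
  mean zero function \<open>d\<close> lives; perfect smoothness removes it.\<close>

lemma localize:
  assumes b: "\<And>j. step_fun m M (b j)" and d: "step_fun m M d" "supported_on d P" "(LINT x|lebesgue. d x) = 0"
    and P: "P \<in> cubes r" "m \<le> r"
  shows "\<Lambda> ((\<lambda>i x. b i x * indicator P x)(j := d)) = \<Lambda> (b(j := d))"
proof (rule replace[OF mM])
  show 1: "step_fun m M (((\<lambda>i x. b i x * indicator P x)(j := d)) i)" for i
    using b d P by (auto intro: step_mult_indicator)
  show 2: "step_fun m M ((b(j := d)) i)" for i using b d by auto
  fix S and i :: 'n
  let ?u = "(\<lambda>i x. b i x * indicator P x)(j := d)" and ?v = "b(j := d)"
  let ?f = "(\<lambda>i. if i \<in> S then ?v i else ?u i)(i := \<lambda>x. ?v i x - ?u i x)"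
  show "\<Lambda> ?f = 0"
  proof (cases "i = j")
    case True
    then have "?f = (\<lambda>i. if i \<in> S then ?v i else ?u i)(j := \<lambda>x. 0)" by auto
    moreover have "\<Lambda> ((\<lambda>i. if i \<in> S then ?v i else ?u i)(j := \<lambda>x. 0)) = 0"
      using 1 2 by (intro upd_zero) (auto intro!: step_li[OF mM] simp del: fun_upd_apply)
    ultimately show ?thesis by simp
  next
    case False
    show ?thesis
    proof (rule smoothD[OF mM _ P(1), of _ j i])
      show "step_fun m M (?f i')" for i'
        using 1 2 step_diff[OF 2[of i] 1[of i]] by (cases "i' = i") (auto simp del: fun_upd_apply simp: fun_upd_apply[of _ i])
    qed (use False d in auto)
  qed
qed

end

section \<open>The form on an accretive system\<close>

lemma set_integrable_const_cube: "Q \<in> cubes r \<Longrightarrow> set_integrable lebesgue Q (\<lambda>x. k :: real)"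
  using cube_lmeasurable[of Q r]
  by (auto simp: set_integrable_def fmeasurable_def simp del: emeasure_completion intro!: integrable_real_mult_indicator integrable_mult_left integrable_real_indicator)

lemma set_integral_const_cube: "Q \<in> cubes r \<Longrightarrow> (LINT x:Q|lebesgue. (k::real)) = k * measure lebesgue Q"
  using cube_lmeasurable[of Q r] by (simp add: set_lebesgue_integral_def)

lemma set_integral_eq_mean: "Q \<in> cubes r \<Longrightarrow> (LINT x:Q|lebesgue. u x) = mean_on u Q * measure lebesgue Q"
  using measure_cube_pos[of Q r] by (simp add: mean_on_def)

lemma mean_const: "Q \<in> cubes r \<Longrightarrow> mean_on (\<lambda>x. k) Q = k"
  using measure_cube_pos[of Q r] by (simp add: mean_on_def set_integral_const_cube)

lemma mean_cmult: "mean_on (\<lambda>x. k * u x) Q = k * mean_on u Q"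
  by (simp add: mean_on_def)

lemma mean_diff: "set_integrable lebesgue Q u \<Longrightarrow> set_integrable lebesgue Q v \<Longrightarrow>
    mean_on (\<lambda>x. u x - v x) Q = mean_on u Q - mean_on v Q"
  by (simp add: mean_on_def set_integral_diff diff_divide_distrib)

lemma mean_mono: "set_integrable lebesgue Q u \<Longrightarrow> set_integrable lebesgue Q v \<Longrightarrow> (\<And>x. x \<in> Q \<Longrightarrow> u x \<le> v x) \<Longrightarrow>
    mean_on u Q \<le> mean_on v Q"
  unfolding mean_on_def by (intro divide_right_mono set_integral_mono) auto

lemma mean_cong: "Q \<in> cubes r \<Longrightarrow> (\<And>x. x \<in> Q \<Longrightarrow> u x = v x) \<Longrightarrow> mean_on u Q = mean_on v Q"
  unfolding mean_on_def by (intro arg_cong2[where f = "(/)"] set_lebesgue_integral_cong) auto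

lemma mean_abs: "set_integrable lebesgue Q u \<Longrightarrow> \<bar>mean_on u Q\<bar> \<le> mean_on (\<lambda>x. \<bar>u x\<bar>) Q"
  using set_integral_norm_bound[of lebesgue Q u] by (simp add: mean_on_def abs_divide divide_right_mono)

lemma mean_leaf: "step_fun m M f \<Longrightarrow> Q \<in> cubes m \<Longrightarrow> x \<in> Q \<Longrightarrow> mean_on f Q = f x"
  using leaf_integral[of m M f Q x] measure_cube_pos[of Q m] by (simp add: mean_on_def)

text \<open>Jensen's inequality, by integrating the tangent line of the power at the mean
  \<open>a\<close>.\<close>

lemma mean_powr_le:
  assumes "Q \<in> cubes r" "p > 1" "set_integrable lebesgue Q u" "set_integrable lebesgue Q (\<lambda>x. u x powr p)" "\<And>x. u x \<ge> 0"
  shows "mean_on u Q powr p \<le> mean_on (\<lambda>x. u x powr p) Q"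
proof -
  define a where "a = mean_on u Q"
  have "mean_on (\<lambda>x. 0) Q \<le> a"
    unfolding a_def using assms by (intro mean_mono set_integrable_const_cube) auto
  then have a: "a \<ge> 0" using mean_const[OF assms(1), of 0] by simp
  have "mean_on (\<lambda>x. p * a powr (p - 1) * u x - (p - 1) * a powr p) Q \<le> mean_on (\<lambda>x. u x powr p) Q"
    using assms a powr_ge_tangent
    by (intro mean_mono set_integral_diff set_integrable_mult_right set_integrable_const_cube[OF assms(1)]) auto
  moreover have "mean_on (\<lambda>x. p * a powr (p - 1) * u x - (p - 1) * a powr p) Q = p * a powr (p - 1) * a - (p - 1) * a powr p"
    using assms by (subst mean_diff) (auto simp: mean_cmult mean_const[OF assms(1)] a_def intro!: set_integrable_const_cube[OF assms(1)] simp del: mult.assoc)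
  moreover have "a powr (p - 1) * a = a powr p" using a by (cases "a = 0") (auto simp: powr_diff)
  ultimately show ?thesis unfolding a_def[symmetric] by (simp add: mult.assoc left_diff_distrib)
qed

lemma step_local: "step_fun m M u \<Longrightarrow> Q \<in> cubes r \<Longrightarrow> m \<le> r \<Longrightarrow> Q \<subseteq> region M \<Longrightarrow> step_fun m M (\<lambda>x. h (u x) * indicator Q x)"
proof -
  assume *: "step_fun m M u" "Q \<in> cubes r" "m \<le> r" "Q \<subseteq> region M"
  then have "indicator Q x = (0::real)" if "x \<notin> region M" for x using that by (auto simp: indicator_def)
  then show ?thesis
    using * indicator_cube_const[of Q r m] unfolding step_fun_def supported_on_def by auto
qed

lemma sum_indicator_subcubes:
  assumes "P \<in> cubes r" "k \<le> r"
  shows "(\<Sum>R\<in>subcubes k P. indicator R x) = (indicator P x :: real)"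
proof (cases "x \<in> P")
  case False
  then have "(\<Sum>R\<in>subcubes k P. indicator R x) = (0::real)" by (intro sum.neutral) (auto simp: subcubes_def indicator_def)
  then show ?thesis using False by simp
next
  case True
  then obtain R0 where R0: "R0 \<in> subcubes k P" "x \<in> R0" using Union_subcubes_cube[OF assms] by blast
  have "(\<Sum>R\<in>subcubes k P. indicator R x) = (\<Sum>R\<in>subcubes k P. if R = R0 then 1 else 0 :: real)"
    using R0 cubes_disjoint[of _ k R0] by (intro sum.cong refl) (auto simp: subcubes_def indicator_def)
  then show ?thesis using R0 True finite_subcubes_cube[OF assms(1)] by simp
qed

lemma Lp_norm_le:
  assumes "Q \<in> cubes r" "p > 0" "B \<ge> 0" "\<And>x. \<bar>g x\<bar> \<le> B * indicator Q x" "integrable lebesgue (\<lambda>x. \<bar>g x\<bar> powr p)"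
  shows "Lp_norm p g \<le> B * measure lebesgue Q powr (1 / p)"
proof -
  have "(LINT x|lebesgue. \<bar>g x\<bar> powr p) \<le> (LINT x|lebesgue. indicator Q x * B powr p)"
  proof (rule integral_mono)
    show "integrable lebesgue (\<lambda>x. indicator Q x * B powr p)"
      using set_integrable_const_cube[OF assms(1)] by (simp add: set_integrable_def)
    fix x
    show "\<bar>g x\<bar> powr p \<le> indicator Q x * B powr p"
      using assms(4)[of x] assms(2) by (cases "x \<in> Q") (auto intro!: powr_mono2)
  qed fact
  also have "\<dots> = B powr p * measure lebesgue Q"
    using set_integral_const_cube[OF assms(1), of "B powr p"] by (simp add: set_lebesgue_integral_def)
  finally have "Lp_norm p g \<le> (B powr p * measure lebesgue Q) powr (1 / p)"
    unfolding Lp_norm_def using assms by (intro powr_mono2) (auto intro: integral_nonneg_AE)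
  also have "\<dots> = B * measure lebesgue Q powr (1 / p)"
    using assms by (simp add: powr_mult powr_powr)
  finally show ?thesis .
qed

section \<open>The dyadic tree below a root cube\<close>

definition scale_of :: "'a::euclidean_space set \<Rightarrow> int" where
  "scale_of Q = (THE r. Q \<in> cubes r)"

lemma scale_of_eq: "Q \<in> cubes r \<Longrightarrow> scale_of Q = r"
  unfolding scale_of_def using cubes_scale_unique by blast

definition children :: "'a::euclidean_space set \<Rightarrow> 'a set set" where
  "children Q = subcubes (scale_of Q - 1) Q"

lemma children_eq: "Q \<in> cubes r \<Longrightarrow> children Q = subcubes (r - 1) Q"
  by (simp add: children_def scale_of_eq)

definition height :: "int \<Rightarrow> 'a::euclidean_space set \<Rightarrow> nat" where
  "height m Q = nat (scale_of Q - m)"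

definition nodes :: "int \<Rightarrow> int \<Rightarrow> 'a::euclidean_space set \<Rightarrow> 'a set set" where
  "nodes m M Q0 = {Q. \<exists>r. m \<le> r \<and> r \<le> M \<and> Q \<in> cubes r \<and> Q \<subseteq> Q0}"

lemma dyadic_tree: "weighted_tree (nodes m M Q0) (height m) children (measure lebesgue) (2 ^ DIM('a))"
  for Q0 :: "'a::euclidean_space set"
proof
  show "measure lebesgue Q > 0" if "Q \<in> nodes m M Q0" for Q
    using that measure_cube_pos by (auto simp: nodes_def)
next
  fix P R assume P: "P \<in> nodes m M Q0" "height m P > 0"
  then obtain r where r: "m < r" "r \<le> M" "P \<in> cubes r" "P \<subseteq> Q0" by (auto simp: nodes_def height_def scale_of_eq)
  show "card (children P) = 2 ^ DIM('a)" using r(3) by (simp add: children_eq card_subcubes_Suc)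
  assume "R \<in> children P"
  then have R: "R \<in> cubes (r - 1)" "R \<subseteq> P" by (auto simp: children_eq[OF r(3)] subcubes_def)
  show "R \<in> nodes m M Q0" unfolding nodes_def using r R by (auto intro!: exI[of _ "r - 1"])
  show "height m R < height m P" using r(1) by (simp add: height_def scale_of_eq[OF R(1)] scale_of_eq[OF r(3)])
  show "measure lebesgue P = real (2 ^ DIM('a)) * measure lebesgue R" using measure_child[OF r(3) R(1)] by simp
qed simp

lemma mart_mean:
  assumes "\<And>Q r. Q \<in> cubes r \<Longrightarrow> m \<le> r \<Longrightarrow> set_integrable lebesgue Q u"
  shows "weighted_tree.mart (nodes m M Q0) (height m) children (measure lebesgue) (mean_on u)"
  unfolding weighted_tree.mart_def[OF dyadic_tree]
proof (intro ballI impI)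
  fix P assume P: "P \<in> nodes m M Q0" "height m P > 0"
  then obtain r where r: "m < r" "r \<le> M" "P \<in> cubes r" "P \<subseteq> Q0" by (auto simp: nodes_def height_def scale_of_eq)
  have "measure lebesgue P * mean_on u P = (LINT x:P|lebesgue. u x)" by (simp add: set_integral_eq_mean[OF r(3)])
  also have "\<dots> = (\<Sum>R\<in>children P. LINT x:R|lebesgue. u x)"
    unfolding children_eq[OF r(3)] using r assms by (intro set_integral_subcubes) auto
  also have "\<dots> = (\<Sum>R\<in>children P. measure lebesgue R * mean_on u R)"
    unfolding children_eq[OF r(3)] by (intro sum.cong refl) (simp add: subcubes_def set_integral_eq_mean[of _ "r - 1"])
  finally show "measure lebesgue P * mean_on u P = (\<Sum>R\<in>children P. measure lebesgue R * mean_on u R)" .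
qed

text \<open>The \<open>b j\<close> are here already averaged to step functions: their bound is
  pointwise, and accretivity and weak boundedness are required only for cubes of scale at least
  \<open>m\<close> inside the region. In \<open>atom_test\<close> the BMO condition is reduced to
  atoms that are step functions.\<close>

locale tb_form = perfect_form \<Lambda> m M I c T s
  for \<Lambda> :: "('n::finite \<Rightarrow> 'a::euclidean_space \<Rightarrow> real) \<Rightarrow> real" and m M :: int
    and I :: "'i set" and c :: "'i \<Rightarrow> real" and T :: "'i \<Rightarrow> 'n \<Rightarrow> 'a set" and s :: "'i \<Rightarrow> int" +
  fixes b :: "'n \<Rightarrow> 'a \<Rightarrow> real" and B :: real
  assumes B: "B \<ge> 1" and b_step: "step_fun m M (b j)" and b_bound: "\<bar>b j x\<bar> \<le> B"
    and accretive: "Q \<in> cubes r \<Longrightarrow> m \<le> r \<Longrightarrow> Q \<subseteq> region M \<Longrightarrow> 1 \<le> \<bar>mean_on (b j) Q\<bar>"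
    and wbp: "Q \<in> cubes r \<Longrightarrow> m \<le> r \<Longrightarrow> Q \<subseteq> region M \<Longrightarrow> \<bar>\<Lambda> (\<lambda>j x. b j x * indicator Q x)\<bar> \<le> B * measure lebesgue Q"
    and atom_test: "step_fun m M g \<Longrightarrow> Q \<in> cubes r \<Longrightarrow> supported_on g Q \<Longrightarrow> (LINT x|lebesgue. g x) = 0 \<Longrightarrow>
      (\<And>x. \<bar>g x\<bar> \<le> 1 / measure lebesgue Q) \<Longrightarrow> \<bar>\<Lambda> (b(j := g))\<bar> \<le> B"
begin

lemma integrable_on_cube: "step_fun m M f \<Longrightarrow> Q \<in> cubes r \<Longrightarrow> set_integrable lebesgue Q f"
  by (rule step_set_integrable[OF mM]) auto

lemma step_locally_integrable: "step_fun m M f \<Longrightarrow> locally_integrable f"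
  by (rule step_li[OF mM])

section \<open>The function representing the form in one argument\<close>

text \<open>Freezing all arguments but the \<open>j\<close>-th at \<open>b\<close> in the kernel sum
  leaves this density.\<close>

definition \<beta> :: "'n \<Rightarrow> 'a \<Rightarrow> real" where
  "\<beta> j = (\<lambda>x. \<Sum>k\<in>I. (c k * (\<Prod>i\<in>UNIV - {j}. (LINT x:T k i|lebesgue. b i x))) * indicator (T k j) x)"

lemma \<beta>_step: "step_fun m M (\<beta> j)"
  unfolding \<beta>_def by (intro step_sum step_cmult step_indicator[OF T])

lemma \<beta>_repr:
  assumes "step_fun m M g"
  shows "\<Lambda> (b(j := g)) = (LINT x|lebesgue. \<beta> j x * g x)"
proof -
  have "\<Lambda> (b(j := g)) = (\<Sum>k\<in>I. c k * (\<Prod>i\<in>UNIV - {j}. (LINT x:T k i|lebesgue. b i x)) * (LINT x:T k j|lebesgue. g x))"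
    by (rule upd_eq) (auto intro: step_locally_integrable b_step assms)
  also have "\<dots> = (\<Sum>k\<in>I. LINT x|lebesgue. c k * (\<Prod>i\<in>UNIV - {j}. (LINT x:T k i|lebesgue. b i x)) * (indicator (T k j) x * g x))"
    by (simp add: set_lebesgue_integral_def)
  also have "\<dots> = (LINT x|lebesgue. (\<Sum>k\<in>I. c k * (\<Prod>i\<in>UNIV - {j}. (LINT x:T k i|lebesgue. b i x)) * (indicator (T k j) x * g x)))"
    using integrable_on_cube[OF assms T(1)] by (intro Bochner_Integration.integral_sum[symmetric] integrable_mult_right) (simp add: set_integrable_def)
  also have "\<dots> = (LINT x|lebesgue. \<beta> j x * g x)"
    by (simp add: \<beta>_def sum_distrib_right mult.assoc)
  finally show ?thesis .
qed

text \<open>Duality of BMO with atoms. The sign \<open>\<sigma>\<close> of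
  \<open>\<beta> j - c0\<close> minus its mean \<open>a\<close> has mean zero and is at most 2 in
  size, so division by \<open>2 * V\<close> gives an admissible atom \<open>g\<close>. Testing on
  \<open>g\<close> yields half the mean oscillation, hence the factor 2.\<close>

lemma \<beta>_oscillation:
  assumes Q: "Q \<in> cubes r" "m \<le> r" "Q \<subseteq> region M"
  shows "mean_on (\<lambda>x. \<bar>\<beta> j x - mean_on (\<beta> j) Q\<bar>) Q \<le> 2 * B"
proof -
  define c0 where "c0 = mean_on (\<beta> j) Q"
  define \<sigma> where "\<sigma> x = sgn (\<beta> j x - c0) * indicator Q x" for x
  define a where "a = mean_on \<sigma> Q"
  define V where "V = measure lebesgue Q"
  define g where "g x = 1 / (2 * V) * (\<sigma> x - a * indicator Q x)" for x
  have V: "V > 0" using measure_cube_pos[OF Q(1)] by (simp add: V_def)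
  have \<sigma>: "step_fun m M \<sigma>" unfolding \<sigma>_def by (rule step_local[OF \<beta>_step Q])
  have \<sigma>1: "\<bar>\<sigma> x\<bar> \<le> 1" for x by (auto simp: \<sigma>_def indicator_def abs_sgn_eq)
  have a: "\<bar>a\<bar> \<le> 1" unfolding a_def by (rule mean_on_bound[OF _ integrable_on_cube[OF \<sigma> Q(1)] Q(1)]) (simp add: \<sigma>1)
  have g: "step_fun m M g" unfolding g_def by (intro step_cmult step_diff \<sigma> step_indicator[OF Q])
  have gs: "supported_on g Q" by (auto simp: supported_on_def g_def \<sigma>_def)
  have mg: "mean_on g Q = 0"
  proof -
    have "mean_on g Q = mean_on (\<lambda>x. 1 / (2 * V) * (\<sigma> x - a)) Q"
      by (rule mean_cong[OF Q(1)]) (simp add: g_def)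
    also have "\<dots> = 1 / (2 * V) * (mean_on \<sigma> Q - a)"
      unfolding mean_cmult by (subst mean_diff[OF integrable_on_cube[OF \<sigma> Q(1)] set_integrable_const_cube[OF Q(1)]]) (simp add: mean_const[OF Q(1)])
    finally show ?thesis by (simp add: a_def)
  qed
  have "\<bar>\<Lambda> (b(j := g))\<bar> \<le> B"
  proof (rule atom_test[OF g Q(1) gs])
    show "(LINT x|lebesgue. g x) = 0"
      using mg supported_integral[OF gs] set_integral_eq_mean[OF Q(1), of g] by simp
    fix x
    have "\<bar>\<sigma> x - a * indicator Q x\<bar> \<le> 2" using \<sigma>1[of x] a by (cases "x \<in> Q") auto
    then show "\<bar>g x\<bar> \<le> 1 / measure lebesgue Q"
      using V by (simp add: g_def V_def[symmetric] abs_mult field_simps)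
  qed
  moreover have "\<Lambda> (b(j := g)) = mean_on (\<lambda>x. \<bar>\<beta> j x - c0\<bar>) Q / 2"
  proof -
    have i: "set_integrable lebesgue Q (\<lambda>x. \<beta> j x - c0)"
      by (intro set_integral_diff integrable_on_cube[OF \<beta>_step Q(1)] set_integrable_const_cube[OF Q(1)])
    have "\<Lambda> (b(j := g)) = (LINT x:Q|lebesgue. \<beta> j x * g x)"
      unfolding \<beta>_repr[OF g] using gs by (intro supported_integral[symmetric]) (auto simp: supported_on_def)
    also have "\<dots> = mean_on (\<lambda>x. \<beta> j x * g x) Q * V" by (simp add: set_integral_eq_mean[OF Q(1)] V_def)
    \<comment> \<open>Splitting off \<open>c0\<close> isolates the absolute oscillation; the other
      two terms have mean zero over \<open>Q\<close>.\<close>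
    also have "mean_on (\<lambda>x. \<beta> j x * g x) Q = mean_on (\<lambda>x. (1 / (2 * V) * \<bar>\<beta> j x - c0\<bar> - a / (2 * V) * (\<beta> j x - c0)) - (- c0) * g x) Q"
    proof (rule mean_cong[OF Q(1)])
      fix x assume "x \<in> Q"
      then have gx: "g x = 1 / (2 * V) * (sgn (\<beta> j x - c0) - a)" by (simp add: g_def \<sigma>_def)
      have ab: "\<bar>\<beta> j x - c0\<bar> = sgn (\<beta> j x - c0) * (\<beta> j x - c0)" by (simp add: abs_sgn mult.commute)
      then show "\<beta> j x * g x = (1 / (2 * V) * \<bar>\<beta> j x - c0\<bar> - a / (2 * V) * (\<beta> j x - c0)) - (- c0) * g x"
        unfolding gx ab using V by (simp add: field_simps)
    qed
    also have "\<dots> = 1 / (2 * V) * mean_on (\<lambda>x. \<bar>\<beta> j x - c0\<bar>) Q - a / (2 * V) * mean_on (\<lambda>x. \<beta> j x - c0) Q - (- c0) * mean_on g Q"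
    proof -
      have i1: "set_integrable lebesgue Q (\<lambda>x. 1 / (2 * V) * \<bar>\<beta> j x - c0\<bar>)"
        by (intro set_integrable_mult_right set_integrable_abs i)
      have i2: "set_integrable lebesgue Q (\<lambda>x. a / (2 * V) * (\<beta> j x - c0))" by (intro set_integrable_mult_right i)
      have i3: "set_integrable lebesgue Q (\<lambda>x. (- c0) * g x)" by (intro set_integrable_mult_right integrable_on_cube[OF g Q(1)])
      show ?thesis unfolding mean_diff[OF set_integral_diff(1)[OF i1 i2] i3] mean_diff[OF i1 i2] mean_cmult ..
    qed
    also have "mean_on (\<lambda>x. \<beta> j x - c0) Q = 0"
      by (subst mean_diff[OF integrable_on_cube[OF \<beta>_step Q(1)] set_integrable_const_cube[OF Q(1)]]) (simp add: mean_const[OF Q(1)] c0_def)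
    also have "(1 / (2 * V) * mean_on (\<lambda>x. \<bar>\<beta> j x - c0\<bar>) Q - a / (2 * V) * 0 - (- c0) * mean_on g Q) * V
        = mean_on (\<lambda>x. \<bar>\<beta> j x - c0\<bar>) Q / 2"
      using V by (simp add: mg field_simps)
    finally show ?thesis .
  qed
  ultimately show ?thesis by (simp add: c0_def)
qed

section \<open>Defects and their change from a cube to its children\<close>

text \<open>The factor for which the multiple of \<open>b j\<close> has the same mean over
  \<open>Q\<close> as \<open>f j\<close>.\<close>

definition \<phi> :: "('n \<Rightarrow> 'a \<Rightarrow> real) \<Rightarrow> 'n \<Rightarrow> 'a set \<Rightarrow> real" where
  "\<phi> f j Q = mean_on (f j) Q / mean_on (b j) Q"

definition lam :: "('n \<Rightarrow> 'a set) \<Rightarrow> real" where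
  "lam \<rho> = \<Lambda> (\<lambda>j x. b j x * indicator (\<rho> j) x)"

text \<open>The function \<open>G\<close> of the stopping time argument: the error made on
  \<open>Q\<close> by replacing each \<open>f j\<close> with its multiple of
  \<open>b j\<close>.\<close>

definition defect :: "('n \<Rightarrow> 'a \<Rightarrow> real) \<Rightarrow> 'a set \<Rightarrow> real" where
  "defect f Q = \<Lambda> (\<lambda>j x. f j x * indicator Q x) - (\<Prod>j\<in>UNIV. \<phi> f j Q) * lam (\<lambda>j. Q)"

lemma scaled_b:
  assumes "\<And>j. \<rho> j \<in> cubes r" "m \<le> r"
  shows "\<Lambda> (\<lambda>j x. v j * (b j x * indicator (\<rho> j) x)) = (\<Prod>j\<in>UNIV. v j) * lam \<rho>"
  unfolding lam_def by (rule scale[OF _ mM]) (rule step_mult_indicator[OF b_step assms])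

text \<open>At the finest scale \<open>f j\<close> and \<open>b j\<close> are constant on
  \<open>Q\<close>, and accretivity makes \<open>b j\<close> nonzero there, so \<open>f j\<close> is
  exactly its multiple of \<open>b j\<close>.\<close>

lemma defect_leaf:
  assumes f: "\<And>j. step_fun m M (f j)" and Q: "Q \<in> cubes m" "Q \<subseteq> region M"
  shows "defect f Q = 0"
proof -
  have "f j x * indicator Q x = \<phi> f j Q * (b j x * indicator Q x)" for j x
  proof (cases "x \<in> Q")
    case True
    have "b j x \<noteq> 0" using accretive[OF Q(1) order_refl Q(2), of j] mean_leaf[OF b_step Q(1) True, of j] by auto
    then show ?thesis by (simp add: \<phi>_def mean_leaf[OF b_step Q(1) True] mean_leaf[OF f Q(1) True])
  qed simp
  then have "\<Lambda> (\<lambda>j x. f j x * indicator Q x) = \<Lambda> (\<lambda>j x. \<phi> f j Q * (b j x * indicator Q x))"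
    by (intro arg_cong[where f = \<Lambda>] ext)
  also have "\<dots> = (\<Prod>j\<in>UNIV. \<phi> f j Q) * lam (\<lambda>j. Q)" by (rule scaled_b[OF Q(1) order_refl])
  finally show ?thesis by (simp add: defect_def)
qed

lemma integral_mult_indicator: "(LINT x|lebesgue. u x * indicator Q x) = (LINT x:Q|lebesgue. u x)" for u :: "'a \<Rightarrow> real"
  by (simp add: set_lebesgue_integral_def mult.commute)

text \<open>On \<open>\<rho> j\<close> the function \<open>f j\<close> and its multiple of
  \<open>b j\<close> have equal integrals, and off the diagonal only these integrals matter.\<close>

lemma off_diagonal_form:
  assumes f: "\<And>j. step_fun m M (f j)" and \<rho>: "\<And>j. \<rho> j \<in> cubes r" "\<And>j. \<rho> j \<subseteq> region M" "\<rho> j0 \<noteq> \<rho> k0" and r: "m \<le> r"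
  shows "\<Lambda> (\<lambda>j x. f j x * indicator (\<rho> j) x) = (\<Prod>j\<in>UNIV. \<phi> f j (\<rho> j)) * lam \<rho>"
proof -
  have "\<Lambda> (\<lambda>j x. f j x * indicator (\<rho> j) x) = \<Lambda> (\<lambda>j x. \<phi> f j (\<rho> j) * (b j x * indicator (\<rho> j) x))"
  proof (rule off_diagonal[OF mM _ _ \<rho>(1,3)])
    fix j
    show "step_fun m M (\<lambda>x. f j x * indicator (\<rho> j) x)" by (rule step_mult_indicator[OF f \<rho>(1) r])
    show "step_fun m M (\<lambda>x. \<phi> f j (\<rho> j) * (b j x * indicator (\<rho> j) x))" by (intro step_cmult step_mult_indicator[OF b_step \<rho>(1) r])
    have "mean_on (b j) (\<rho> j) \<noteq> 0" using accretive[OF \<rho>(1) r \<rho>(2), of j j] by auto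
    then show "(LINT x|lebesgue. f j x * indicator (\<rho> j) x) = (LINT x|lebesgue. \<phi> f j (\<rho> j) * (b j x * indicator (\<rho> j) x))"
      by (simp add: integral_mult_indicator set_integral_eq_mean[OF \<rho>(1)] \<phi>_def)
  qed (auto simp: supported_on_def)
  also have "\<dots> = (\<Prod>j\<in>UNIV. \<phi> f j (\<rho> j)) * lam \<rho>" by (rule scaled_b[OF \<rho>(1) r])
  finally show ?thesis .
qed

context
  fixes P :: "'a set" and r :: int
  assumes P: "P \<in> cubes r" "m < r" "P \<subseteq> region M"
begin

lemma child:
  assumes "R \<in> children P"
  shows "R \<in> cubes (r - 1)" "R \<subseteq> P" "R \<subseteq> region M" "m \<le> r - 1" "R \<in> dyadic_cubes" "dyadic_child R P"
proof -
  show 1: "R \<in> cubes (r - 1)" "R \<subseteq> P" "R \<subseteq> region M" "m \<le> r - 1"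
    using assms P by (auto simp: children_eq[OF P(1)] subcubes_def)
  show "R \<in> dyadic_cubes" using 1 cubes_imp_dyadic by blast
  show "dyadic_child R P" unfolding dyadic_child_def using 1 P(1) by (auto simp: cubes_def)
qed

lemma finite_children: "finite (children P)"
  unfolding children_eq[OF P(1)] by (rule finite_subcubes_cube[OF P(1)])

lemma split_children: "u x * indicator P x = (\<Sum>R\<in>children P. u x * indicator R x)" for u :: "'a \<Rightarrow> real"
  unfolding children_eq[OF P(1)] sum_distrib_left[symmetric] by (simp add: sum_indicator_subcubes[OF P(1)])

lemma expand_children:
  assumes f: "\<And>j. step_fun m M (f j)"
  shows "\<Lambda> (\<lambda>j x. \<Sum>R\<in>children P. v j R * (f j x * indicator R x))
    = (\<Sum>\<rho>\<in>PiE UNIV (\<lambda>_. children P). (\<Prod>j\<in>UNIV. v j (\<rho> j)) * \<Lambda> (\<lambda>j x. f j x * indicator (\<rho> j) x))"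
  using f child by (intro expand finite_children step_locally_integrable step_sum step_cmult step_mult_indicator) auto

text \<open>Both \<open>f\<close> and \<open>b\<close> are expanded over tuples of children. A tuple
  with two different cubes has error \<open>a \<rho> = 0\<close>, so the sum of all errors reduces
  to the diagonal, where it is the sum of the defects of the children.\<close>

lemma defect_step:
  assumes f: "\<And>j. step_fun m M (f j)"
  shows "defect f P - (\<Sum>R\<in>children P. defect f R)
    = (\<Sum>\<rho>\<in>PiE UNIV (\<lambda>_. children P). lam \<rho> * ((\<Prod>j\<in>UNIV. \<phi> f j (\<rho> j)) - (\<Prod>j\<in>UNIV. \<phi> f j P)))"
proof -
  let ?P = "PiE (UNIV :: 'n set) (\<lambda>_. children P)"
  have finP: "finite ?P" by (intro finite_PiE) (auto simp: finite_children)
  define a where "a \<rho> = \<Lambda> (\<lambda>j x. f j x * indicator (\<rho> j) x) - (\<Prod>j\<in>UNIV. \<phi> f j (\<rho> j)) * lam \<rho>" for \<rho>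
  have "(\<Sum>\<rho>\<in>?P. a \<rho>) = (\<Sum>\<rho>\<in>(\<lambda>R _. R) ` children P. a \<rho>)"
  proof (rule sum.mono_neutral_right[OF finP])
    show "\<forall>\<rho>\<in>?P - (\<lambda>R _. R) ` children P. a \<rho> = 0"
    proof
      fix \<rho> assume \<rho>: "\<rho> \<in> ?P - (\<lambda>R _. R) ` children P"
      then have \<rho>': "\<rho> j \<in> children P" for j by auto
      have "\<exists>j k. \<rho> j \<noteq> \<rho> k"
      proof (rule ccontr)
        assume "\<not> ?thesis"
        then have "\<rho> i = \<rho> undefined" for i by metis
        then have "\<rho> = (\<lambda>_. \<rho> undefined)" by (intro ext)
        then show False using \<rho> \<rho>' by blast
      qed
      then obtain j k where jk: "\<rho> j \<noteq> \<rho> k" by blast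
      have "\<Lambda> (\<lambda>j x. f j x * indicator (\<rho> j) x) = (\<Prod>j\<in>UNIV. \<phi> f j (\<rho> j)) * lam \<rho>"
        by (rule off_diagonal_form[OF f child(1)[OF \<rho>'] child(3)[OF \<rho>'] jk child(4)[OF \<rho>'[of j]]])
      then show "a \<rho> = 0" by (simp add: a_def)
    qed
  qed auto
  also have "\<dots> = (\<Sum>R\<in>children P. a (\<lambda>_. R))" by (subst sum.reindex) (auto simp: inj_on_def fun_eq_iff)
  also have "\<dots> = (\<Sum>R\<in>children P. defect f R)" by (simp add: a_def defect_def)
  finally have 1: "(\<Sum>R\<in>children P. defect f R) = (\<Sum>\<rho>\<in>?P. a \<rho>)" by simp
  have ex: "\<Lambda> (\<lambda>j x. g j x * indicator P x) = (\<Sum>\<rho>\<in>?P. \<Lambda> (\<lambda>j x. g j x * indicator (\<rho> j) x))"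
    if "\<And>j. step_fun m M (g j)" for g
    using expand_children[OF that, of "\<lambda>_ _. 1"] by (simp add: split_children)
  have "defect f P = (\<Sum>\<rho>\<in>?P. \<Lambda> (\<lambda>j x. f j x * indicator (\<rho> j) x)) - (\<Prod>j\<in>UNIV. \<phi> f j P) * (\<Sum>\<rho>\<in>?P. lam \<rho>)"
    unfolding defect_def lam_def ex[OF f] ex[OF b_step] ..
  then show ?thesis
    unfolding 1 by (simp add: a_def sum_distrib_left sum_subtractf[symmetric] algebra_simps)
qed

text \<open>On the diagonal this is weak boundedness. Otherwise two arguments sit in different
  children, and dyadic decay gives a product of norms in which the powers of the measure multiply to
  \<open>measure lebesgue P\<close>, because the \<open>1 / p j\<close> sum to 1.\<close>

lemma lam_bound:
  assumes p: "hoelder_tuple (p :: 'n \<Rightarrow> real)" and \<rho>: "\<rho> \<in> PiE UNIV (\<lambda>_. children P)"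
  shows "\<bar>lam \<rho>\<bar> \<le> (B ^ CARD('n) + B) * measure lebesgue P"
proof -
  have \<rho>': "\<rho> j \<in> children P" for j using \<rho> by auto
  have wR: "measure lebesgue R \<le> measure lebesgue P" if "R \<in> children P" for R
    using child[OF that] measure_mono_fmeasurable[of R P lebesgue] cube_lmeasurable[OF P(1)] by auto
  have w0: "measure lebesgue P > 0" by (rule measure_cube_pos[OF P(1)])
  show ?thesis
  proof (cases "\<exists>j k. \<rho> j \<noteq> \<rho> k")
    case False
    define R where "R = \<rho> undefined"
    have "\<rho> j = R" for j using False unfolding R_def by metis
    then have R: "R \<in> children P" "\<rho> = (\<lambda>_. R)" using \<rho>' by (auto simp: R_def)
    have "\<bar>lam \<rho>\<bar> \<le> B * measure lebesgue R"
      unfolding lam_def R(2) by (rule wbp[OF child(1,4,3)[OF R(1)]])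
    also have "\<dots> \<le> B * measure lebesgue P" using wR[OF R(1)] B by (intro mult_left_mono) auto
    also have "\<dots> \<le> (B ^ CARD('n) + B) * measure lebesgue P" using B w0 by (intro mult_right_mono) auto
    finally show ?thesis .
  next
    case True
    then obtain j k where jk: "\<rho> j \<noteq> \<rho> k" by blast
    let ?g = "\<lambda>j x. b j x * indicator (\<rho> j) x"
    have st: "step_fun m M (?g j)" for j by (rule step_mult_indicator[OF b_step child(1,4)[OF \<rho>']])
    have Pd: "P \<in> dyadic_cubes" by (rule cubes_imp_dyadic[OF P(1)])
    have "\<bar>\<Lambda> ?g\<bar> \<le> (\<Prod>j\<in>UNIV. Lp_norm (p j) (?g j))"
    proof -
      have "\<forall>j. dyadic_test (?g j) \<and> supported_on (?g j) P"
        using step_test[OF mM st] child(2)[OF \<rho>'] by (auto simp: supported_on_def indicator_def)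
      moreover have "j \<noteq> k \<and> dyadic_child (\<rho> j) P \<and> dyadic_child (\<rho> k) P \<and> \<rho> j \<noteq> \<rho> k \<and> supported_on (?g j) (\<rho> j) \<and> supported_on (?g k) (\<rho> k)"
        using jk child(6)[OF \<rho>'] by (auto simp: supported_on_def)
      ultimately have "(\<forall>j. dyadic_test (?g j) \<and> supported_on (?g j) P) \<and>
          (\<exists>j k R S. j \<noteq> k \<and> dyadic_child R P \<and> dyadic_child S P \<and> R \<noteq> S \<and> supported_on (?g j) R \<and> supported_on (?g k) S)"
        by blast
      from mp[OF bspec[OF spec[OF decay[unfolded dyadic_decay_def]] Pd] this] p show ?thesis by simp
    qed
    also have "\<dots> \<le> (\<Prod>j\<in>UNIV. B * measure lebesgue P powr (1 / p j))"
    proof (rule prod_mono)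
      fix j
      have pj: "p j > 1" using p by (simp add: hoelder_tuple_def)
      have "Lp_norm (p j) (?g j) \<le> B * measure lebesgue (\<rho> j) powr (1 / p j)"
      proof (rule Lp_norm_le[OF child(1)[OF \<rho>']])
        show "\<bar>?g j x\<bar> \<le> B * indicator (\<rho> j) x" for x using b_bound[of j x] by (auto simp: indicator_def)
        show "integrable lebesgue (\<lambda>x. \<bar>?g j x\<bar> powr p j)"
          using step_integrable[OF mM step_comp[OF _ st[of j], of "\<lambda>t. \<bar>t\<bar> powr p j"]] by simp
      qed (use pj B in auto)
      also have "\<dots> \<le> B * measure lebesgue P powr (1 / p j)"
        using B pj wR[OF \<rho>'] by (intro mult_left_mono powr_mono2) auto
      finally show "0 \<le> Lp_norm (p j) (?g j) \<and> Lp_norm (p j) (?g j) \<le> B * measure lebesgue P powr (1 / p j)"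
        by (simp add: Lp_norm_def)
    qed
    also have "\<dots> = B ^ CARD('n) * measure lebesgue P"
      using p w0 by (simp add: prod.distrib powr_sum[symmetric] hoelder_tuple_def)
    also have "\<dots> \<le> (B ^ CARD('n) + B) * measure lebesgue P" using B w0 by (intro mult_right_mono) auto
    finally show ?thesis by (simp add: lam_def)
  qed
qed

text \<open>The sum is the form with \<open>d\<close> in slot \<open>j\<close> and the restricted
  \<open>b i\<close> elsewhere. The function \<open>d\<close> has mean zero because
  \<open>\<phi> f j P\<close> reproduces the mean of \<open>f j\<close> over \<open>P\<close>; so
  \<open>localize\<close> removes the restriction and \<open>\<beta>_repr\<close> gives an integral
  against \<open>\<beta> j\<close>. The cancellation \<open>zero\<close> then produces increments of
  \<open>\<psi>\<close>, for every \<open>k\<close>.\<close>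

lemma linear_part:
  assumes f: "\<And>j. step_fun m M (f j)"
  shows "\<bar>\<Sum>\<rho>\<in>PiE UNIV (\<lambda>_. children P). lam \<rho> * (\<phi> f j (\<rho> j) - \<phi> f j P)\<bar>
    \<le> B * (\<Sum>R\<in>children P. measure lebesgue R * (\<bar>\<phi> f j R - \<phi> f j P\<bar> *
        \<bar>(mean_on (\<lambda>x. \<beta> j x * b j x) R - k * mean_on (b j) R) / mean_on (b j) R
        - (mean_on (\<lambda>x. \<beta> j x * b j x) P - k * mean_on (b j) P) / mean_on (b j) P\<bar>))"
proof -
  let ?w = "measure lebesgue" and ?y = "mean_on (b j)" and ?z = "mean_on (\<lambda>x. \<beta> j x * b j x)" and ?\<Delta> = "\<lambda>R. \<phi> f j R - \<phi> f j P"
  define \<psi> where "\<psi> R = (?z R - k * ?y R) / ?y R" for R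
  define d where "d x = (\<Sum>R\<in>children P. ?\<Delta> R * (b j x * indicator R x))" for x
  have d: "step_fun m M d" unfolding d_def using child by (intro step_sum step_cmult step_mult_indicator b_step) auto
  have y0: "?y R \<noteq> 0" if "R \<in> children P \<or> R = P" for R
    using that accretive[of R r j] accretive[of R "r - 1" j] child[of R] P by auto
  have sum_mean: "?w P * mean_on u P = (\<Sum>R\<in>children P. ?w R * mean_on u R)" if "step_fun m M u" for u
  proof -
    have "?w P * mean_on u P = (LINT x:P|lebesgue. u x)" by (simp add: set_integral_eq_mean[OF P(1)])
    also have "\<dots> = (\<Sum>R\<in>children P. LINT x:R|lebesgue. u x)"
      unfolding children_eq[OF P(1)] by (intro set_integral_subcubes[OF P(1) _ integrable_on_cube[OF that P(1)]]) auto
    also have "\<dots> = (\<Sum>R\<in>children P. ?w R * mean_on u R)"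
      by (intro sum.cong refl) (simp add: set_integral_eq_mean[OF child(1)])
    finally show ?thesis .
  qed
  have zero: "(\<Sum>R\<in>children P. ?\<Delta> R * (?w R * ?y R)) = 0"
  proof -
    have "(\<Sum>R\<in>children P. ?\<Delta> R * (?w R * ?y R)) = (\<Sum>R\<in>children P. ?w R * mean_on (f j) R - \<phi> f j P * (?w R * ?y R))"
      using y0 by (intro sum.cong refl) (auto simp: \<phi>_def left_diff_distrib)
    also have "\<dots> = ?w P * mean_on (f j) P - \<phi> f j P * (?w P * ?y P)"
      unfolding sum_subtractf sum_distrib_left[symmetric] sum_mean[OF f] sum_mean[OF b_step] ..
    also have "\<dots> = 0" using y0[of P] by (simp add: \<phi>_def)
    finally show ?thesis .
  qed
  have int_R: "(LINT x|lebesgue. v x * d x) = (\<Sum>R\<in>children P. ?\<Delta> R * (?w R * mean_on (\<lambda>x. v x * b j x) R))"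
    if v: "\<And>R. R \<in> children P \<Longrightarrow> set_integrable lebesgue R (\<lambda>x. v x * b j x)" for v
  proof -
    have "(LINT x|lebesgue. v x * d x) = (LINT x|lebesgue. (\<Sum>R\<in>children P. ?\<Delta> R * (indicator R x * (v x * b j x))))"
      by (simp add: d_def sum_distrib_left algebra_simps)
    also have "\<dots> = (\<Sum>R\<in>children P. LINT x|lebesgue. ?\<Delta> R * (indicator R x * (v x * b j x)))"
      using v by (intro Bochner_Integration.integral_sum integrable_mult_right) (simp add: set_integrable_def)
    also have "\<dots> = (\<Sum>R\<in>children P. ?\<Delta> R * (?w R * mean_on (\<lambda>x. v x * b j x) R))"
    proof (rule sum.cong[OF refl])
      fix R assume "R \<in> children P"
      then show "(LINT x|lebesgue. ?\<Delta> R * (indicator R x * (v x * b j x))) = ?\<Delta> R * (?w R * mean_on (\<lambda>x. v x * b j x) R)"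
        using set_integral_eq_mean[OF child(1), of R "\<lambda>x. v x * b j x"] by (simp add: set_lebesgue_integral_def)
    qed
    finally show ?thesis .
  qed
  have d0: "(LINT x|lebesgue. d x) = 0"
    using int_R[of "\<lambda>_. 1"] integrable_on_cube[OF b_step child(1)] zero by simp
  have ds: "supported_on d P"
    using child(2) by (auto simp: supported_on_def d_def indicator_def subset_iff intro!: sum.neutral)
  have "(\<Sum>\<rho>\<in>PiE UNIV (\<lambda>_. children P). lam \<rho> * ?\<Delta> (\<rho> j)) = \<Lambda> ((\<lambda>i x. b i x * indicator P x)(j := d))"
  proof -
    have "(\<lambda>i x. b i x * indicator P x)(j := d) = (\<lambda>i x. \<Sum>R\<in>children P. (if i = j then ?\<Delta> R else 1) * (b i x * indicator R x))"
      by (auto simp: fun_eq_iff d_def split_children)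
    then have "\<Lambda> ((\<lambda>i x. b i x * indicator P x)(j := d))
      = (\<Sum>\<rho>\<in>PiE UNIV (\<lambda>_. children P). (\<Prod>i\<in>UNIV. if i = j then ?\<Delta> (\<rho> i) else 1) * lam \<rho>)"
      using expand_children[OF b_step, of "\<lambda>i R. if i = j then ?\<Delta> R else 1"] by (simp add: lam_def)
    then show ?thesis by (simp add: mult.commute)
  qed
  also have "\<dots> = \<Lambda> (b(j := d))"
    using P(2) by (intro localize[OF b_step d ds d0 P(1)]) simp
  also have "\<dots> = (\<Sum>R\<in>children P. ?\<Delta> R * (?w R * ?z R))"
    unfolding \<beta>_repr[OF d] by (intro int_R integrable_on_cube[OF step_mult[OF \<beta>_step b_step] child(1)])
  also have "\<dots> = (\<Sum>R\<in>children P. ?w R * (?\<Delta> R * (?y R * (\<psi> R - \<psi> P))))"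
  proof -
    \<comment> \<open>By \<open>zero\<close>, subtracting the multiple \<open>k + \<psi> P\<close>
      of \<open>?y R\<close> from \<open>?z R\<close> changes nothing in the sum.\<close>
    have "(\<Sum>R\<in>children P. ?w R * (?\<Delta> R * (?y R * (\<psi> R - \<psi> P))))
      = (\<Sum>R\<in>children P. ?\<Delta> R * (?w R * ?z R) - (k + \<psi> P) * (?\<Delta> R * (?w R * ?y R)))"
    proof (rule sum.cong[OF refl])
      fix R assume "R \<in> children P"
      then have "?y R * \<psi> R = ?z R - k * ?y R" using y0[of R] by (simp add: \<psi>_def)
      then have e: "?y R * (\<psi> R - \<psi> P) = ?z R - k * ?y R - ?y R * \<psi> P" by (simp add: right_diff_distrib)
      show "?w R * (?\<Delta> R * (?y R * (\<psi> R - \<psi> P))) = ?\<Delta> R * (?w R * ?z R) - (k + \<psi> P) * (?\<Delta> R * (?w R * ?y R))"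
        unfolding e by (simp add: algebra_simps)
    qed
    also have "\<dots> = (\<Sum>R\<in>children P. ?\<Delta> R * (?w R * ?z R)) - (k + \<psi> P) * 0"
      unfolding sum_subtractf sum_distrib_left[symmetric] zero ..
    finally show ?thesis by simp
  qed
  finally have "\<bar>\<Sum>\<rho>\<in>PiE UNIV (\<lambda>_. children P). lam \<rho> * ?\<Delta> (\<rho> j)\<bar> \<le> (\<Sum>R\<in>children P. \<bar>?w R * (?\<Delta> R * (?y R * (\<psi> R - \<psi> P)))\<bar>)"
    by (simp add: sum_abs)
  also have "\<dots> \<le> (\<Sum>R\<in>children P. B * (?w R * (\<bar>?\<Delta> R\<bar> * \<bar>\<psi> R - \<psi> P\<bar>)))"
  proof (rule sum_mono)
    fix R assume R: "R \<in> children P"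
    have "\<bar>?y R\<bar> \<le> B" using b_bound by (intro mean_on_bound[OF _ integrable_on_cube[OF b_step child(1)[OF R]] child(1)[OF R]]) simp
    then have "\<bar>?y R\<bar> * (?w R * (\<bar>?\<Delta> R\<bar> * \<bar>\<psi> R - \<psi> P\<bar>)) \<le> B * (?w R * (\<bar>?\<Delta> R\<bar> * \<bar>\<psi> R - \<psi> P\<bar>))"
      by (intro mult_right_mono) auto
    then show "\<bar>?w R * (?\<Delta> R * (?y R * (\<psi> R - \<psi> P)))\<bar> \<le> B * (?w R * (\<bar>?\<Delta> R\<bar> * \<bar>\<psi> R - \<psi> P\<bar>))"
      by (simp add: abs_mult mult.assoc mult.left_commute)
  qed
  finally show ?thesis by (simp add: sum_distrib_left \<psi>_def)
qed

end

end

section \<open>Root cubes and the global estimate\<close>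

context perfect_form
begin

text \<open>Passing to the parents of the root cubes multiplies the form by \<open>2\<^bsup>-dn\<^esup>\<close>, by perfect smoothness, but
  also leaves it unchanged, since the kernel is supported in the region.\<close>

lemma indicator_roots_zero:
  assumes \<rho>: "\<And>j. \<rho> j \<in> subcubes M (region M)" "\<rho> j0 \<noteq> \<rho> k0"
  shows "\<Lambda> (\<lambda>j. indicator (\<rho> j)) = 0"
proof -
  define d where "d = DIM('a)"
  have \<rho>c: "\<rho> j \<in> cubes M" "\<rho> j \<subseteq> region M" for j using \<rho>(1) by (auto simp: subcubes_def)
  have "\<exists>x. x \<in> \<rho> j" for j using cubes_nonempty[OF \<rho>c(1)] by blast
  then obtain a where a: "\<And>j. a j \<in> \<rho> j" by metis
  define P where "P j = cube_at (M + 1) (a j)" for j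
  have \<rho>_eq: "\<rho> j = cube_at M (a j)" for j by (rule cubes_eq_cube_at[OF \<rho>c(1) a])
  have ar: "a j \<in> region M" for j using a \<rho>c by blast
  have P: "P j \<in> cubes (M + 1)" "\<rho> j \<subseteq> P j" for j
    using cube_at_mono[of M "M + 1" "a j"] by (auto simp: P_def \<rho>_eq)
  \<comment> \<open>The indices -1 and 0 are fixed under integer division by 2, so a root cube and
    its parent have the same index.\<close>
  have fl: "\<lfloor>x \<bullet> e / 2 powi (M + 1)\<rfloor> = \<lfloor>x \<bullet> e / 2 powi M\<rfloor>" if "x \<in> region M" "e \<in> Basis" for x :: 'a and e
    using that floor_div_powi[of M "M + 1" "x \<bullet> e"] by (auto simp: region_def)
  have PR: "P j \<inter> region M = \<rho> j" for j
    using fl ar \<rho>c(2)[of j] P(2)[of j] by (auto simp: P_def \<rho>_eq mem_cube_at)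
  have P_reg: "P j \<subseteq> region (M + 1)" for j
  proof -
    have "a j \<in> region (M + 1)" using ar region_mono[of M "M + 1"] by auto
    then show ?thesis using region_cube[OF P(1)[of j] order_refl] P(2) a by blast
  qed
  have dis: "P j0 \<noteq> P k0" using PR[of j0] PR[of k0] \<rho>(2) by metis
  have m1: "m \<le> M + 1" using mM by simp
  have st\<rho>: "step_fun m M (indicator (\<rho> j))" for j by (rule step_indicator[OF \<rho>c(1) mM \<rho>c(2)])
  have stP: "step_fun m (M + 1) (indicator (P j))" for j by (rule step_indicator[OF P(1) m1 P_reg])
  have "\<Lambda> (\<lambda>j. indicator (\<rho> j)) = \<Lambda> (\<lambda>j x. 1 / 2 ^ d * indicator (P j) x)"
  proof (rule off_diagonal[OF m1 _ _ P(1) dis])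
    show "step_fun m (M + 1) (indicator (\<rho> j))" for j using step_mono[OF st\<rho>, of "M + 1"] by simp
    show "step_fun m (M + 1) (\<lambda>x. 1 / 2 ^ d * indicator (P j) x)" for j by (rule step_cmult[OF stP])
    show "supported_on (indicator (\<rho> j)) (P j)" for j using P(2)[of j] by (auto simp: supported_on_def indicator_def)
    show "supported_on (\<lambda>x. 1 / 2 ^ d * indicator (P j) x) (P j)" for j by (auto simp: supported_on_def)
    show "(LINT x|lebesgue. indicator (\<rho> j) x) = (LINT x|lebesgue. 1 / 2 ^ d * indicator (P j) x :: real)" for j
      using measure_child[of "P j" "M + 1" "\<rho> j"] P(1)[of j] \<rho>c(1)[of j] by (simp add: d_def)
  qed
  also have "\<dots> = (1 / 2 ^ d) ^ CARD('n) * \<Lambda> (\<lambda>j. indicator (P j))"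
    using scale[OF stP m1, of "\<lambda>_. 1 / 2 ^ d"] by simp
  also have "\<Lambda> (\<lambda>j. indicator (P j)) = \<Lambda> (\<lambda>j. indicator (\<rho> j))"
  proof (rule cong_integrals)
    show "locally_integrable (indicator (P j) :: 'a \<Rightarrow> real)" for j by (rule step_li[OF m1 stP])
    show "locally_integrable (indicator (\<rho> j) :: 'a \<Rightarrow> real)" for j by (rule step_li[OF mM st\<rho>])
    fix j r and Q :: "'a set" assume Q: "Q \<in> cubes r" "m \<le> r" "Q \<subseteq> region M"
    show "(LINT x:Q|lebesgue. indicator (P j) x) = (LINT x:Q|lebesgue. indicator (\<rho> j) x :: real)"
      using Q(1,3) PR[of j] by (intro set_lebesgue_integral_cong) (auto simp: indicator_def)
  qed
  finally have e: "\<Lambda> (\<lambda>j. indicator (\<rho> j)) = (1 / 2 ^ d) ^ CARD('n) * \<Lambda> (\<lambda>j. indicator (\<rho> j))" .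
  have "(1 / 2 ^ d :: real) < 1" by (simp add: d_def)
  then have "(1 / 2 ^ d :: real) ^ CARD('n) < 1 ^ CARD('n)" by (intro power_strict_mono) auto
  then show ?thesis using e by (metis mult_cancel_right1 order_less_irrefl power_one)
qed

text \<open>Off the diagonal each piece may be averaged over its root cube, which leaves a multiple
  of the form on indicators; this is zero by \<open>indicator_roots_zero\<close>.\<close>

lemma sum_roots:
  assumes f: "\<And>j. step_fun m M (f j)"
  shows "\<Lambda> f = (\<Sum>R\<in>subcubes M (region M). \<Lambda> (\<lambda>j x. f j x * indicator R x))"
proof -
  let ?S = "subcubes M (region M) :: 'a set set"
  let ?P = "PiE (UNIV :: 'n set) (\<lambda>_. ?S)"
  define F where "F \<rho> = \<Lambda> (\<lambda>j x. f j x * indicator (\<rho> j) x)" for \<rho>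
  have S: "R \<in> cubes M" "R \<subseteq> region M" if "R \<in> ?S" for R using that by (auto simp: subcubes_def)
  have ind: "f j x = (\<Sum>R\<in>?S. 1 * (f j x * indicator R x))" for j x
  proof (cases "x \<in> region M")
    case False
    then show ?thesis using step_supp[OF f] by simp
  next
    case True
    then obtain R0 where R0: "R0 \<in> ?S" "x \<in> R0" using Union_subcubes_region[of M M] by blast
    have "(\<Sum>R\<in>?S. 1 * (f j x * indicator R x)) = (\<Sum>R\<in>?S. if R = R0 then f j x else 0)"
      using R0 cubes_disjoint[of _ M R0] by (intro sum.cong refl) (auto simp: subcubes_def indicator_def)
    then show ?thesis using R0(1) by simp
  qed
  have "\<Lambda> f = \<Lambda> (\<lambda>j x. \<Sum>R\<in>?S. 1 * (f j x * indicator R x))"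
    by (intro arg_cong[where f = \<Lambda>] ext) (rule ind)
  also have "\<dots> = (\<Sum>\<rho>\<in>?P. (\<Prod>j\<in>(UNIV :: 'n set). 1) * F \<rho>)"
    unfolding F_def
  proof (rule expand[of "\<lambda>_. ?S" "\<lambda>j R x. f j x * indicator R x" "\<lambda>_ _. 1"])
    show "locally_integrable (\<lambda>x. f j x * indicator R x)" if "R \<in> ?S" for j R
      by (rule step_li[OF mM step_mult_indicator[OF f S(1)[OF that] mM]])
    show "locally_integrable (\<lambda>x. \<Sum>R\<in>?S. 1 * (f j x * indicator R x))" for j
      using step_li[OF mM f[of j]] unfolding ind[symmetric] .
  qed simp
  also have "\<dots> = (\<Sum>\<rho>\<in>?P. F \<rho>)" by simp
  also have "\<dots> = (\<Sum>\<rho>\<in>(\<lambda>R _. R) ` ?S. F \<rho>)"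
  proof (rule sum.mono_neutral_right)
    show "finite ?P" by (intro finite_PiE) auto
    show "\<forall>\<rho>\<in>?P - (\<lambda>R _. R) ` ?S. F \<rho> = 0"
    proof
      fix \<rho> assume \<rho>: "\<rho> \<in> ?P - (\<lambda>R _. R) ` ?S"
      then have \<rho>': "\<rho> j \<in> ?S" for j by auto
      have "\<exists>j k. \<rho> j \<noteq> \<rho> k"
      proof (rule ccontr)
        assume "\<not> ?thesis"
        then have "\<rho> i = \<rho> undefined" for i by metis
        then have "\<rho> = (\<lambda>_. \<rho> undefined)" by (intro ext)
        then show False using \<rho> \<rho>' by blast
      qed
      then obtain j0 k0 where jk: "\<rho> j0 \<noteq> \<rho> k0" by blast
      have \<rho>c: "\<rho> j \<in> cubes M" "\<rho> j \<subseteq> region M" for j using S[OF \<rho>'] by auto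
      have st: "step_fun m M (indicator (\<rho> j))" for j by (rule step_indicator[OF \<rho>c(1) mM \<rho>c(2)])
      define v where "v j = mean_on (f j) (\<rho> j)" for j
      have "F \<rho> = \<Lambda> (\<lambda>j x. v j * indicator (\<rho> j) x)"
        unfolding F_def
      proof (rule off_diagonal[OF mM _ _ \<rho>c(1) jk])
        show "step_fun m M (\<lambda>x. f j x * indicator (\<rho> j) x)" for j by (rule step_mult_indicator[OF f \<rho>c(1) mM])
        show "step_fun m M (\<lambda>x. v j * indicator (\<rho> j) x)" for j by (rule step_cmult[OF st])
        fix j
        have "(LINT x|lebesgue. f j x * indicator (\<rho> j) x) = (LINT x:\<rho> j|lebesgue. f j x)"
          by (simp add: set_lebesgue_integral_def mult.commute)
        also have "\<dots> = v j * measure lebesgue (\<rho> j)" unfolding v_def by (rule set_integral_eq_mean[OF \<rho>c(1)])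
        also have "\<dots> = (LINT x|lebesgue. v j * indicator (\<rho> j) x)" by simp
        finally show "(LINT x|lebesgue. f j x * indicator (\<rho> j) x) = (LINT x|lebesgue. v j * indicator (\<rho> j) x)" .
      qed (auto simp: supported_on_def)
      also have "\<dots> = (\<Prod>j\<in>UNIV. v j) * \<Lambda> (\<lambda>j. indicator (\<rho> j))" by (rule scale[OF st mM])
      finally show "F \<rho> = 0" using indicator_roots_zero[OF \<rho>' jk] by simp
    qed
  qed auto
  also have "\<dots> = (\<Sum>R\<in>?S. F (\<lambda>_. R))" by (subst sum.reindex) (auto simp: inj_on_def fun_eq_iff)
  finally show ?thesis by (simp add: F_def)
qed

end

section \<open>Bounds on one root cube and for the whole form\<close>

context tb_form
begin

text \<open>The cubes inside \<open>Q0\<close> form a weighted tree with \<open>defect f\<close> as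
  \<open>G\<close>, which bounds the defect. The subtracted product is bounded by weak boundedness,
  the inequality between products and sums of powers, and Jensen.\<close>

lemma root_bound:
  assumes p: "hoelder_tuple p" and Cs: "Cs \<ge> 0"
      "step_constant TYPE('a set) TYPE('n) (4 * CARD('n)) B (B ^ CARD('n) + B) (2 ^ DIM('a)) Cs"
    and f: "\<And>j. step_fun m M (f j)" and Q0: "Q0 \<in> subcubes M (region M)"
  shows "\<bar>\<Lambda> (\<lambda>j x. f j x * indicator Q0 x)\<bar>
    \<le> (tb_tree.C' (2 ^ DIM('a)) p (4 * CARD('n)) B Cs + B) * (\<Sum>j\<in>UNIV. (LINT x:Q0|lebesgue. \<bar>f j x\<bar> powr p j))"
proof -
  let ?K = "real (4 * CARD('n))"
  let ?x = "\<lambda>j. mean_on (f j)" and ?X = "\<lambda>j. mean_on (\<lambda>x. \<bar>f j x\<bar>)" and ?F = "\<lambda>j. mean_on (\<lambda>x. \<bar>f j x\<bar> powr p j)"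
  let ?y = "\<lambda>j. mean_on (b j)" and ?z = "\<lambda>j. mean_on (\<lambda>x. \<beta> j x * b j x)"
  have Q0': "Q0 \<in> cubes M" "Q0 \<subseteq> region M" using Q0 by (auto simp: subcubes_def)
  have sX: "step_fun m M (\<lambda>x. \<bar>f j x\<bar>)" for j by (rule step_comp[OF _ f]) simp
  have sF: "step_fun m M (\<lambda>x. \<bar>f j x\<bar> powr p j)" for j by (rule step_comp[OF _ f, of "\<lambda>t. \<bar>t\<bar> powr p j"]) simp
  have sz: "step_fun m M (\<lambda>x. \<beta> j x * b j x)" for j by (rule step_mult[OF \<beta>_step b_step])
  have nodeE: "\<exists>r. m \<le> r \<and> Q \<in> cubes r \<and> Q \<subseteq> region M" if "Q \<in> nodes m M Q0" for Q
    using that Q0' by (auto simp: nodes_def)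
  have marts: "weighted_tree.mart (nodes m M Q0) (height m) children (measure lebesgue) (mean_on u)" if "step_fun m M u" for u
    by (rule mart_mean) (rule integrable_on_cube[OF that])
  have K1: "?K > 0" by simp
  interpret tb_tree "nodes m M Q0" "height m" children "measure lebesgue" "2 ^ DIM('a)" p ?x ?X ?F ?y ?z "defect f" ?K B Cs
  proof (intro tb_tree.intro dyadic_tree tb_tree_axioms.intro)
    show "hoelder_tuple p" "?K = real (4 * CARD('n))" "1 \<le> B" "0 \<le> Cs" using p B Cs by simp_all
    fix j
    show "weighted_tree.mart (nodes m M Q0) (height m) children (measure lebesgue) (?x j)" by (rule marts[OF f])
    show "weighted_tree.mart (nodes m M Q0) (height m) children (measure lebesgue) (?X j)" by (rule marts[OF sX])
    show "weighted_tree.mart (nodes m M Q0) (height m) children (measure lebesgue) (?F j)" by (rule marts[OF sF])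
    show "weighted_tree.mart (nodes m M Q0) (height m) children (measure lebesgue) (?y j)" by (rule marts[OF b_step])
    show "weighted_tree.mart (nodes m M Q0) (height m) children (measure lebesgue) (?z j)" by (rule marts[OF sz])
    fix Q assume "Q \<in> nodes m M Q0"
    then obtain r where Q: "m \<le> r" "Q \<in> cubes r" "Q \<subseteq> region M" using nodeE by blast
    show "\<bar>?x j Q\<bar> \<le> ?X j Q" by (rule mean_abs[OF integrable_on_cube[OF f Q(2)]])
    show "1 \<le> \<bar>?y j Q\<bar>" by (rule accretive[OF Q(2,1,3)])
    show "\<bar>?y j Q\<bar> \<le> B" using b_bound by (intro mean_on_bound[OF _ integrable_on_cube[OF b_step Q(2)] Q(2)]) simp
    \<comment> \<open>The mean \<open>k\<close> and the averaged distance \<open>t\<close> are the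
      witnesses for \<open>bmo\<close>: \<open>\<beta>_oscillation\<close> bounds
      \<open>t Q\<close>, and the bound on \<open>b j\<close> passes from
      \<open>\<beta> j - k\<close> to its product with \<open>b j\<close>.\<close>
    define k where "k = mean_on (\<beta> j) Q"
    define t where "t = mean_on (\<lambda>x. \<bar>\<beta> j x - k\<bar>)"
    have ti: "set_integrable lebesgue R (\<lambda>x. \<bar>\<beta> j x - k\<bar>)" if "R \<in> cubes r" for R r
      by (intro set_integrable_abs set_integral_diff integrable_on_cube[OF \<beta>_step that] set_integrable_const_cube[OF that])
    have "weighted_tree.mart (nodes m M Q0) (height m) children (measure lebesgue) t"
      unfolding t_def by (rule mart_mean) (rule ti)
    moreover have "t Q \<le> 2 * B" unfolding t_def k_def by (rule \<beta>_oscillation[OF Q(2,1,3)])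
    moreover have "t R \<ge> 0 \<and> \<bar>?z j R - k * ?y j R\<bar> \<le> B * t R" if "R \<in> nodes m M Q0" for R
    proof
      obtain r where R: "m \<le> r" "R \<in> cubes r" "R \<subseteq> region M" using nodeE[OF \<open>R \<in> nodes m M Q0\<close>] by blast
      have "mean_on (\<lambda>x. 0) R \<le> t R"
        unfolding t_def by (intro mean_mono set_integrable_const_cube[OF R(2)] ti[OF R(2)]) simp
      then show "t R \<ge> 0" by (simp add: mean_const[OF R(2)])
      have i: "set_integrable lebesgue R (\<lambda>x. k * b j x)" "set_integrable lebesgue R (\<lambda>x. \<beta> j x * b j x - k * b j x)"
        by (intro integrable_on_cube[OF step_cmult[OF b_step] R(2)] integrable_on_cube[OF step_diff[OF sz step_cmult[OF b_step]] R(2)])+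
      have "?z j R - k * ?y j R = mean_on (\<lambda>x. \<beta> j x * b j x - k * b j x) R"
        by (simp add: mean_diff[OF integrable_on_cube[OF sz R(2)] i(1)] mean_cmult)
      then have "\<bar>?z j R - k * ?y j R\<bar> \<le> mean_on (\<lambda>x. \<bar>\<beta> j x * b j x - k * b j x\<bar>) R"
        using mean_abs[OF i(2)] by simp
      also have "\<dots> \<le> mean_on (\<lambda>x. B * \<bar>\<beta> j x - k\<bar>) R"
      proof (rule mean_mono)
        show "set_integrable lebesgue R (\<lambda>x. \<bar>\<beta> j x * b j x - k * b j x\<bar>)" by (rule set_integrable_abs[OF i(2)])
        show "set_integrable lebesgue R (\<lambda>x. B * \<bar>\<beta> j x - k\<bar>)" by (intro set_integrable_mult_right ti[OF R(2)])
        show "\<bar>\<beta> j x * b j x - k * b j x\<bar> \<le> B * \<bar>\<beta> j x - k\<bar>" for x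
        proof -
          have "\<bar>\<beta> j x * b j x - k * b j x\<bar> = \<bar>b j x\<bar> * \<bar>\<beta> j x - k\<bar>"
            unfolding abs_mult[symmetric] by (simp add: algebra_simps)
          then show ?thesis using mult_right_mono[OF b_bound[of j x], of "\<bar>\<beta> j x - k\<bar>"] by simp
        qed
      qed
      finally show "\<bar>?z j R - k * ?y j R\<bar> \<le> B * t R" by (simp add: mean_cmult t_def)
    qed
    ultimately show "\<exists>c t. weighted_tree.mart (nodes m M Q0) (height m) children (measure lebesgue) t \<and> t Q \<le> 2 * B
        \<and> (\<forall>R\<in>nodes m M Q0. 0 \<le> t R \<and> \<bar>?z j R - c * ?y j R\<bar> \<le> B * t R)" by blast
    assume "height m Q = 0"
    then have Qm: "Q \<in> cubes m" using Q by (simp add: height_def scale_of_eq)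
    show "defect f Q = 0" by (rule defect_leaf[OF f Qm Q(3)])
    obtain x where x: "x \<in> Q" using cubes_nonempty[OF Qm] by blast
    show "?F j Q = ?X j Q powr p j" by (simp add: mean_leaf[OF sF Qm x] mean_leaf[OF sX Qm x])
  next
    fix P A and k :: "'n \<Rightarrow> real"
    assume P': "P \<in> nodes m M Q0" "height m P > 0" and A: "\<And>j. \<bar>?x j P\<bar> \<le> ?K * A j"
      "\<And>j R. R \<in> children P \<Longrightarrow> \<bar>?x j R\<bar> \<le> real (2 ^ DIM('a)) * ?K * A j"
    then obtain r where P: "P \<in> cubes r" "m < r" "P \<subseteq> region M"
      using Q0' by (auto simp: nodes_def height_def scale_of_eq)
    note child = child[OF P]
    have \<phi>_le: "\<bar>\<phi> f j R\<bar> \<le> \<bar>?x j R\<bar>" if "R \<in> cubes r'" "m \<le> r'" "R \<subseteq> region M" for j R r'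
    proof -
      have "\<bar>?x j R\<bar> / \<bar>?y j R\<bar> \<le> \<bar>?x j R\<bar> / 1" by (rule divide_left_mono) (use accretive[OF that, of j] in auto)
      then show ?thesis by (simp add: \<phi>_def abs_divide)
    qed
    have A0: "A j \<ge> 0" for j
    proof -
      have "0 \<le> ?K * A j" using A(1)[of j] by linarith
      then show ?thesis using K1 by (simp add: zero_le_mult_iff)
    qed
    have h1: "card (children P) = 2 ^ DIM('a)" by (simp add: children_eq[OF P(1)] card_subcubes_Suc[OF P(1)])
    have h2: "\<forall>R\<in>children P. measure lebesgue R > 0 \<and> measure lebesgue P = real (2 ^ DIM('a)) * measure lebesgue R"
      using measure_cube_pos[OF child(1)] measure_child[OF P(1) child(1)] by simp
    have h3: "\<forall>j. A j \<ge> 0 \<and> \<bar>\<phi> f j P\<bar> \<le> ?K * A j \<and> (\<forall>R\<in>children P. \<bar>\<phi> f j R\<bar> \<le> real (2 ^ DIM('a)) * ?K * A j)"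
      using A0 A order_trans[OF \<phi>_le[OF P(1) less_imp_le[OF P(2)] P(3)]] order_trans[OF \<phi>_le[OF child(1,4,3)]] by blast
    have h4: "\<forall>\<rho>\<in>PiE UNIV (\<lambda>_. children P). \<bar>lam \<rho>\<bar> \<le> (B ^ CARD('n) + B) * measure lebesgue P"
      using lam_bound[OF P p] by blast
    have "\<bar>defect f P - (\<Sum>R\<in>children P. defect f R)\<bar> \<le> Cs * (\<Prod>j\<in>UNIV. A j) *
        (\<Sum>j\<in>UNIV. \<Sum>R\<in>children P. measure lebesgue R * (((\<phi> f j R - \<phi> f j P) / A j)\<^sup>2
          + ((?z j R - k j * ?y j R) / ?y j R - (?z j P - k j * ?y j P) / ?y j P)\<^sup>2))"
      unfolding defect_step[OF P f]
      by (rule Cs(2)[unfolded step_constant_def, rule_format (no_asm), OF h1 h2 h3 h4]) (intro allI linear_part[OF P f])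
    then show "\<bar>defect f P - (\<Sum>R\<in>children P. defect f R)\<bar> \<le> Cs * (\<Prod>j\<in>UNIV. A j) *
        (\<Sum>j\<in>UNIV. \<Sum>R\<in>children P. measure lebesgue R * (((?x j R / ?y j R - ?x j P / ?y j P) / A j)\<^sup>2
          + ((?z j R - k j * ?y j R) / ?y j R - (?z j P - k j * ?y j P) / ?y j P)\<^sup>2))"
      by (simp add: \<phi>_def)
  qed
  have Q0n: "Q0 \<in> nodes m M Q0" using Q0' mM by (auto simp: nodes_def)
  have w: "measure lebesgue Q0 > 0" by (rule measure_cube_pos[OF Q0'(1)])
  have "\<bar>(\<Prod>j\<in>UNIV. \<phi> f j Q0) * lam (\<lambda>_. Q0)\<bar> \<le> (\<Sum>j\<in>UNIV. ?F j Q0) * (B * measure lebesgue Q0)"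
    unfolding abs_mult
  proof (rule mult_mono)
    have "\<bar>\<Prod>j\<in>UNIV. \<phi> f j Q0\<bar> \<le> (\<Prod>j\<in>UNIV. ?X j Q0)"
      unfolding abs_prod
    proof (rule prod_mono)
      fix j
      have "\<bar>?x j Q0\<bar> / \<bar>?y j Q0\<bar> \<le> \<bar>?x j Q0\<bar> / 1"
        by (rule divide_left_mono) (use accretive[OF Q0'(1) mM Q0'(2), of j] in auto)
      then show "0 \<le> \<bar>\<phi> f j Q0\<bar> \<and> \<bar>\<phi> f j Q0\<bar> \<le> ?X j Q0"
        using mean_abs[OF integrable_on_cube[OF f Q0'(1)], of j] by (simp add: \<phi>_def abs_divide)
    qed
    also have "\<dots> \<le> (\<Sum>j\<in>UNIV. ?X j Q0 powr p j)"
      by (rule prod_le_sum_powr[OF p X_nonneg[OF Q0n]])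
    also have "\<dots> \<le> (\<Sum>j\<in>UNIV. ?F j Q0)"
      by (intro sum_mono mean_powr_le[OF Q0'(1) p1] integrable_on_cube[OF sX Q0'(1)] integrable_on_cube[OF sF Q0'(1)]) simp
    finally show "\<bar>\<Prod>j\<in>UNIV. \<phi> f j Q0\<bar> \<le> (\<Sum>j\<in>UNIV. ?F j Q0)" .
    then show "0 \<le> (\<Sum>j\<in>UNIV. ?F j Q0)" by linarith
    show "\<bar>lam (\<lambda>_. Q0)\<bar> \<le> B * measure lebesgue Q0"
      unfolding lam_def by (rule wbp[OF Q0'(1) mM Q0'(2)])
  qed simp
  moreover have "\<bar>defect f Q0\<bar> \<le> C' * measure lebesgue Q0 * (\<Sum>j\<in>UNIV. ?F j Q0)" by (rule G_bound[OF Q0n])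
  ultimately have "\<bar>\<Lambda> (\<lambda>j x. f j x * indicator Q0 x)\<bar> \<le> (C' + B) * (measure lebesgue Q0 * (\<Sum>j\<in>UNIV. ?F j Q0))"
    unfolding defect_def by (simp add: algebra_simps)
  also have "measure lebesgue Q0 * (\<Sum>j\<in>UNIV. ?F j Q0) = (\<Sum>j\<in>UNIV. (LINT x:Q0|lebesgue. \<bar>f j x\<bar> powr p j))"
    by (simp add: sum_distrib_left set_integral_eq_mean[OF Q0'(1)] mult.commute)
  finally show ?thesis by simp
qed

lemma form_bound:
  assumes p: "hoelder_tuple p" and Cs: "Cs \<ge> 0"
      "step_constant TYPE('a set) TYPE('n) (4 * CARD('n)) B (B ^ CARD('n) + B) (2 ^ DIM('a)) Cs"
    and f: "\<And>j. step_fun m M (f j)"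
  shows "\<bar>\<Lambda> f\<bar> \<le> (tb_tree.C' (2 ^ DIM('a)) p (4 * CARD('n)) B Cs + B) * (\<Sum>j\<in>UNIV. (LINT x|lebesgue. \<bar>f j x\<bar> powr p j))"
proof -
  let ?C = "tb_tree.C' (2 ^ DIM('a)) p (4 * CARD('n)) B Cs + B"
  let ?S = "subcubes M (region M) :: 'a set set"
  have sF: "step_fun m M (\<lambda>x. \<bar>f j x\<bar> powr p j)" for j by (rule step_comp[OF _ f, of "\<lambda>t. \<bar>t\<bar> powr p j"]) simp
  have "\<bar>\<Lambda> f\<bar> \<le> (\<Sum>R\<in>?S. \<bar>\<Lambda> (\<lambda>j x. f j x * indicator R x)\<bar>)"
    unfolding sum_roots[OF f] by (rule sum_abs)
  also have "\<dots> \<le> (\<Sum>R\<in>?S. ?C * (\<Sum>j\<in>UNIV. (LINT x:R|lebesgue. \<bar>f j x\<bar> powr p j)))"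
    by (intro sum_mono root_bound p Cs f)
  also have "\<dots> = ?C * (\<Sum>j\<in>UNIV. \<Sum>R\<in>?S. (LINT x:R|lebesgue. \<bar>f j x\<bar> powr p j))"
    unfolding sum_distrib_left[symmetric] by (subst sum.swap) simp
  also have "(\<Sum>j\<in>UNIV. \<Sum>R\<in>?S. (LINT x:R|lebesgue. \<bar>f j x\<bar> powr p j)) = (\<Sum>j\<in>UNIV. (LINT x|lebesgue. \<bar>f j x\<bar> powr p j))"
    by (simp add: integral_roots[OF mM sF])
  finally show ?thesis .
qed

text \<open>Homogeneity: scaling every \<open>f j\<close> to norm at most 1 bounds the sum of powers
  by \<open>CARD('n)\<close>. Adding \<open>e > 0\<close> to the norms avoids division by a
  vanishing norm; then \<open>e\<close> tends to 0.\<close>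

lemma form_bound_Lp:
  assumes p: "hoelder_tuple p" and Cs: "Cs \<ge> 0"
      "step_constant TYPE('a set) TYPE('n) (4 * CARD('n)) B (B ^ CARD('n) + B) (2 ^ DIM('a)) Cs"
    and f: "\<And>j. step_fun m M (f j)"
  shows "\<bar>\<Lambda> f\<bar> \<le> \<bar>tb_tree.C' (2 ^ DIM('a)) p (4 * CARD('n)) B Cs + B\<bar> * CARD('n) * (\<Prod>j\<in>UNIV. Lp_norm (p j) (f j))"
proof -
  let ?C = "tb_tree.C' (2 ^ DIM('a)) p (4 * CARD('n)) B Cs + B"
  define N where "N j = Lp_norm (p j) (f j)" for j
  have N0: "N j \<ge> 0" for j by (simp add: N_def Lp_norm_def)
  have pj: "p j > 1" for j using p by (simp add: hoelder_tuple_def)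
  have I: "(LINT x|lebesgue. \<bar>f j x\<bar> powr p j) = N j powr p j" for j
  proof -
    have "(LINT x|lebesgue. \<bar>f j x\<bar> powr p j) \<ge> 0" by (intro integral_nonneg_AE) simp
    then show ?thesis using pj[of j] by (simp add: N_def Lp_norm_def powr_powr)
  qed
  have bd: "\<bar>\<Lambda> f\<bar> \<le> \<bar>?C\<bar> * CARD('n) * (\<Prod>j\<in>UNIV. N j + e)" if e: "e > 0" for e
  proof -
    define v where "v j = 1 / (N j + e)" for j
    have v: "v j > 0" for j using N0[of j] e by (simp add: v_def)
    have "\<bar>\<Lambda> (\<lambda>j x. v j * f j x)\<bar> \<le> ?C * (\<Sum>j\<in>UNIV. (LINT x|lebesgue. \<bar>v j * f j x\<bar> powr p j))"
      by (rule form_bound[OF p Cs step_cmult[OF f]])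
    also have "\<dots> \<le> \<bar>?C\<bar> * (\<Sum>j\<in>(UNIV::'n set). 1)"
    proof (rule order_trans[OF mult_right_mono[OF abs_ge_self] mult_left_mono])
      show "0 \<le> (\<Sum>j\<in>UNIV. (LINT x|lebesgue. \<bar>v j * f j x\<bar> powr p j))"
        by (intro sum_nonneg integral_nonneg_AE) simp
      show "(\<Sum>j\<in>UNIV. (LINT x|lebesgue. \<bar>v j * f j x\<bar> powr p j)) \<le> (\<Sum>j\<in>(UNIV::'n set). 1)"
      proof (rule sum_mono)
        fix j
        have "(LINT x|lebesgue. \<bar>v j * f j x\<bar> powr p j) = v j powr p j * N j powr p j"
          using v[of j] by (simp add: abs_mult powr_mult I)
        also have "\<dots> = (v j * N j) powr p j" using v[of j] N0[of j] by (simp add: powr_mult)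
        also have "\<dots> \<le> 1 powr p j"
          using N0[of j] e pj[of j] by (intro powr_mono2) (auto simp: v_def)
        finally show "(LINT x|lebesgue. \<bar>v j * f j x\<bar> powr p j) \<le> 1" by simp
      qed
    qed simp
    finally have "\<bar>\<Lambda> (\<lambda>j x. v j * f j x)\<bar> \<le> \<bar>?C\<bar> * CARD('n)" by simp
    moreover have "\<Lambda> (\<lambda>j x. v j * f j x) = (\<Prod>j\<in>UNIV. v j) * \<Lambda> f" by (rule scale[OF f mM])
    moreover have "(\<Prod>j\<in>UNIV. v j) = 1 / (\<Prod>j\<in>UNIV. N j + e)" by (simp add: v_def prod_dividef)
    moreover have "(\<Prod>j\<in>UNIV. N j + e) > 0" using N0 e by (intro prod_pos) (auto intro: add_nonneg_pos)
    ultimately show ?thesis by (simp add: abs_mult divide_le_eq mult.commute)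
  qed
  have "((\<lambda>e. \<bar>?C\<bar> * CARD('n) * (\<Prod>j\<in>UNIV. N j + e)) \<longlongrightarrow> \<bar>?C\<bar> * CARD('n) * (\<Prod>j\<in>UNIV. N j + 0)) (at_right 0)"
    by (intro tendsto_intros)
  then have "\<bar>\<Lambda> f\<bar> \<le> \<bar>?C\<bar> * CARD('n) * (\<Prod>j\<in>UNIV. N j + 0)"
  proof (rule tendsto_lowerbound)
    show "\<forall>\<^sub>F e in at_right 0. \<bar>\<Lambda> f\<bar> \<le> \<bar>?C\<bar> * CARD('n) * (\<Prod>j\<in>UNIV. N j + e)"
      by (rule eventually_mono[OF eventually_at_right_less bd])
  qed simp
  then show ?thesis by (simp add: N_def)
qed

end

section \<open>Reduction to step functions and conclusion\<close>

text \<open>Such a \<open>g\<close> is an atom and hence its own one-term representation, padded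
  with zero coefficients.\<close>

lemma H1_norm_step_atom:
  assumes "m \<le> M" "step_fun m M g" "Q \<in> cubes r" "supported_on g Q" "(LINT x|lebesgue. g x) = 0"
    "\<And>x. \<bar>g x\<bar> \<le> 1 / measure lebesgue Q"
  shows "H1_norm g \<le> 1"
proof -
  have gm: "g \<in> borel_measurable lebesgue" using step_integrable[OF assms(1,2)] by (rule borel_measurable_integrable)
  have "Linf_norm g \<le> ereal (1 / measure lebesgue Q)"
    unfolding Linf_norm_def using gm assms(6) by (intro esssup_I) auto
  then have at: "H1_atom g"
    unfolding H1_atom_def using gm assms(3-5) cubes_imp_dyadic by blast
  define c where "c i = (if i = 0 then 1 else 0 :: real)" for i :: nat
  have c: "(\<lambda>i. \<bar>c i\<bar>) sums 1"
    using sums_finite[of "{0}" "\<lambda>i. \<bar>c i\<bar>"] by (simp add: c_def)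
  have "H1_representation g c (\<lambda>_. g)"
    unfolding H1_representation_def
  proof (intro conjI allI at)
    show "summable (\<lambda>i. \<bar>c i\<bar>)" using c by (rule sums_summable)
    have "(\<integral>\<^sup>+ x. ennreal \<bar>g x - (\<Sum>i<N. c i * g x)\<bar> \<partial>lebesgue) = 0" if "N \<ge> 1" for N
    proof -
      have "(\<Sum>i<N. c i * g x) = (\<Sum>i\<in>{0}. c i * g x)" for x
        using that by (intro sum.mono_neutral_right) (auto simp: c_def)
      then show ?thesis by (simp add: c_def)
    qed
    then show "(\<lambda>N. \<integral>\<^sup>+ x. ennreal \<bar>g x - (\<Sum>i<N. c i * g x)\<bar> \<partial>lebesgue) \<longlonglongrightarrow> 0"
      by (intro tendsto_eventually eventually_sequentiallyI[of 1])
  qed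
  then have "ereal (\<Sum>i. \<bar>c i\<bar>) \<in> {ereal (\<Sum>i. \<bar>c i\<bar>) | c a. H1_representation g c a}" by blast
  then have "H1_norm g \<le> ereal (\<Sum>i. \<bar>c i\<bar>)" unfolding H1_norm_def by (rule Inf_lower)
  then show ?thesis using sums_unique[OF c] by (simp add: one_ereal_def)
qed

lemma bounded_li:
  fixes b :: "'a::euclidean_space \<Rightarrow> real"
  assumes "b \<in> borel_measurable lebesgue" "AE x in lebesgue. \<bar>b x\<bar> \<le> B"
  shows "locally_integrable b"
  unfolding locally_integrable_def
proof (intro allI impI)
  fix S :: "'a set" assume "compact S"
  then have S: "S \<in> lmeasurable" by (rule lmeasurable_compact)
  have "set_integrable lebesgue S (\<lambda>x. B)"
    using S by (auto simp: set_integrable_def fmeasurable_def simp del: emeasure_completion intro!: integrable_real_mult_indicator integrable_mult_left integrable_real_indicator)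
  then show "set_integrable lebesgue S b"
    by (rule set_integrable_bound) (use assms S in \<open>auto simp: set_borel_measurable_def elim: eventually_mono\<close>)
qed

lemma li_mult_indicator:
  fixes b :: "'a::euclidean_space \<Rightarrow> real"
  assumes "locally_integrable b" "Q \<in> cubes r"
  shows "locally_integrable (\<lambda>x. b x * indicator Q x)"
  unfolding locally_integrable_def
proof (intro allI impI)
  fix S :: "'a set" assume "compact S"
  then have "set_integrable lebesgue S b" using assms(1) by (simp add: locally_integrable_def)
  then have "integrable lebesgue (\<lambda>x. indicator Q x *\<^sub>R (indicator S x *\<^sub>R b x))"
    unfolding set_integrable_def by (rule integrable_mult_indicator[OF cubes_sets[OF assms(2)]])
  then show "set_integrable lebesgue S (\<lambda>x. b x * indicator Q x)" by (simp add: set_integrable_def algebra_simps)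
qed

text \<open>Dyadic cubes are nested or disjoint, so both integrals are over \<open>P\<close>, over
  \<open>Q\<close> or over the empty set, and averaging preserves each.\<close>

lemma proj_indicator_integral:
  assumes "m \<le> M" "Q \<in> cubes r" "m \<le> r" "Q \<subseteq> region M" "P \<in> cubes r'" "m \<le> r'" "P \<subseteq> region M" "locally_integrable b"
  shows "(LINT x:P|lebesgue. proj m M b x * indicator Q x) = (LINT x:P|lebesgue. b x * indicator Q x)"
proof -
  have e: "(LINT x:P|lebesgue. u x * indicator Q x) = (LINT x:P \<inter> Q|lebesgue. u x)" for u :: "'a \<Rightarrow> real"
    unfolding set_lebesgue_integral_def by (intro Bochner_Integration.integral_cong) (auto simp: indicator_def)
  have "P \<inter> Q = {} \<or> P \<inter> Q = P \<or> P \<inter> Q = Q"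
    using cubes_nested[OF assms(2,5)] cubes_nested[OF assms(5,2)] by (cases "r \<le> r'") auto
  then show ?thesis
    unfolding e using proj_integral[OF assms(1-4) li_set_integrable[OF assms(8,2)]]
      proj_integral[OF assms(1,5-7) li_set_integrable[OF assms(8,5)]]
    by (auto simp: set_lebesgue_integral_def)
qed

text \<open>Only finitely many functions and kernel cubes are involved, so one finest scale and one
  region serve them all.\<close>

lemma exists_perfect_form:
  fixes \<Lambda> :: "('n::finite \<Rightarrow> 'a::euclidean_space \<Rightarrow> real) \<Rightarrow> real" and f :: "'n \<Rightarrow> 'a \<Rightarrow> real"
  assumes "perfect_CZ_form \<Lambda>" "\<And>j. dyadic_test (f j)"
  shows "\<exists>m M (I :: ('a ^ 'n) set set) c T s. perfect_form \<Lambda> m M I c T s \<and> (\<forall>j. step_fun m M (f j))"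
proof -
  have \<Lambda>: "dyadic_decay \<Lambda>" "perfect_smoothness \<Lambda>" "qualitative_truncation \<Lambda>" using assms(1) by (auto simp: perfect_CZ_form_def)
  from kernel_repr[OF \<Lambda>(3)] obtain I :: "('a ^ 'n) set set" and c T s where k: "finite I" "\<And>k j. k \<in> I \<Longrightarrow> T k j \<in> cubes (s k)"
    "\<And>f. (\<forall>j. locally_integrable (f j)) \<Longrightarrow> \<Lambda> f = (\<Sum>k\<in>I. c k * (\<Prod>j\<in>UNIV. (LINT x:T k j|lebesgue. f j x)))"
    by blast
  have "\<forall>j. \<exists>m0 M0. \<forall>m\<le>m0. \<forall>M\<ge>M0. step_fun m M (f j)" using test_step[OF assms(2)] by blast
  then obtain mf Mf where mf: "\<And>j m M. m \<le> mf j \<Longrightarrow> M \<ge> Mf j \<Longrightarrow> step_fun m M (f j)" by metis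
  have "\<forall>k j. \<exists>M0. k \<in> I \<longrightarrow> (\<forall>M\<ge>M0. T k j \<subseteq> region M)" using cube_subset_region[OF k(2)] by blast
  then obtain MT where MT: "\<And>k j M. k \<in> I \<Longrightarrow> M \<ge> MT k j \<Longrightarrow> T k j \<subseteq> region M" by metis
  define m where "m = Min (range mf \<union> s ` I)"
  \<comment> \<open>Inserting \<open>m\<close> secures \<open>m \<le> M\<close>.\<close>
  define M where "M = Max (insert m (range Mf \<union> (\<lambda>(k, j). MT k j) ` (I \<times> UNIV)))"
  have fin: "finite (range mf \<union> s ` I)" "finite (insert m (range Mf \<union> (\<lambda>(k, j). MT k j) ` (I \<times> (UNIV :: 'n set))))"
    using k(1) by auto
  have m: "m \<le> mf j" "k \<in> I \<Longrightarrow> m \<le> s k" for j k unfolding m_def using fin(1) by (auto intro!: Min_le)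
  have M: "m \<le> M" "Mf j \<le> M" "k \<in> I \<Longrightarrow> MT k j \<le> M" for j k
    unfolding M_def by (rule Max_ge[OF fin(2)], force)+
  have "perfect_form \<Lambda> m M I c T s"
    by unfold_locales (use M m k MT \<Lambda> in auto)
  moreover have "\<forall>j. step_fun m M (f j)" using mf m M by blast
  ultimately show ?thesis by blast
qed

theorem theorem1p11:
  fixes p :: "'n::finite \<Rightarrow> real" and B :: real
  assumes "CARD('n) \<ge> 2" and "hoelder_tuple p"
  shows "\<exists>C::real. \<forall>(\<Lambda> :: ('n \<Rightarrow> real ^ 'd::finite \<Rightarrow> real) \<Rightarrow> real) (b :: 'n \<Rightarrow> real ^ 'd \<Rightarrow> real).
    perfect_CZ_form \<Lambda> \<longrightarrow>
    (\<forall>j. b j \<in> borel_measurable lebesgue) \<longrightarrow>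
    (\<forall>j. \<forall>Q\<in>dyadic_cubes. \<bar>mean_on (b j) Q\<bar> \<ge> 1) \<longrightarrow>
    (\<forall>j. Linf_norm (b j) \<le> ereal B) \<longrightarrow>
    (\<forall>Q\<in>dyadic_cubes. \<bar>\<Lambda> (\<lambda>j x. b j x * indicator Q x)\<bar> \<le> B * measure lebesgue Q) \<longrightarrow>
    (\<forall>k g. dyadic_test g \<longrightarrow> ereal \<bar>\<Lambda> (b(k := g))\<bar> \<le> ereal B * H1_norm g) \<longrightarrow>
    (\<forall>f. (\<forall>j. dyadic_test (f j)) \<longrightarrow> \<bar>\<Lambda> f\<bar> \<le> C * (\<Prod>j\<in>UNIV. Lp_norm (p j) (f j)))"
proof -
  let ?D = "2 ^ DIM(real ^ 'd) :: nat"
  \<comment> \<open>The constant is fixed before the form is given. For \<open>B < 1\<close> any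
    value will do, since the accretivity and norm conditions then contradict each other.\<close>
  have "\<exists>Cs\<ge>0. B \<ge> 1 \<longrightarrow> step_constant TYPE((real ^ 'd) set) TYPE('n) (4 * CARD('n)) B (B ^ CARD('n) + B) ?D Cs"
  proof (cases "B \<ge> 1")
    case True
    have "real (4 * CARD('n)) \<ge> 1" using assms(1) by simp
    then show ?thesis using step_constant_exists[of "real (4 * CARD('n))" B "B ^ CARD('n) + B" ?D] True by auto
  qed auto
  then obtain Cs where Cs: "Cs \<ge> 0" "B \<ge> 1 \<Longrightarrow> step_constant TYPE((real ^ 'd) set) TYPE('n) (4 * CARD('n)) B (B ^ CARD('n) + B) ?D Cs"
    by blast
  show ?thesis
  proof (intro exI[of _ "\<bar>tb_tree.C' ?D p (4 * CARD('n)) B Cs + B\<bar> * CARD('n)"] allI impI)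
    fix \<Lambda> :: "('n \<Rightarrow> real ^ 'd \<Rightarrow> real) \<Rightarrow> real" and b f :: "'n \<Rightarrow> real ^ 'd \<Rightarrow> real"
    assume \<Lambda>: "perfect_CZ_form \<Lambda>" and bm: "\<forall>j. b j \<in> borel_measurable lebesgue"
      and acc: "\<forall>j. \<forall>Q\<in>dyadic_cubes. \<bar>mean_on (b j) Q\<bar> \<ge> 1"
      and Linf: "\<forall>j. Linf_norm (b j) \<le> ereal B"
      and wbp: "\<forall>Q\<in>dyadic_cubes. \<bar>\<Lambda> (\<lambda>j x. b j x * indicator Q x)\<bar> \<le> B * measure lebesgue Q"
      and bmo: "\<forall>k g. dyadic_test g \<longrightarrow> ereal \<bar>\<Lambda> (b(k := g))\<bar> \<le> ereal B * H1_norm g"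
      and f: "\<forall>j. dyadic_test (f j)"
    have bB: "AE x in lebesgue. \<bar>b j x\<bar> \<le> B" for j
    proof -
      have "AE x in lebesgue. ereal \<bar>b j x\<bar> \<le> Linf_norm (b j)" unfolding Linf_norm_def by (rule esssup_AE)
      then show ?thesis by (rule eventually_mono) (use Linf order_trans ereal_less_eq(3) in blast)
    qed
    have bli: "locally_integrable (b j)" for j using bounded_li bm bB by blast
    have mb: "\<bar>mean_on (b j) Q\<bar> \<le> B" if "Q \<in> cubes r" for j Q r
      by (rule mean_on_bound[OF bB li_set_integrable[OF bli that] that])
    have B1: "B \<ge> 1"
    proof -
      have Q: "cube_at 0 (0 :: real ^ 'd) \<in> cubes 0" by simp
      have "1 \<le> \<bar>mean_on (b j) (cube_at 0 (0 :: real ^ 'd))\<bar>" for j using acc cubes_imp_dyadic[OF Q] by blast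
      then show ?thesis using mb[OF Q] order_trans by blast
    qed
    obtain m M and I :: "((real ^ 'd) ^ 'n) set set" and c T s where F: "perfect_form \<Lambda> m M I c T s" and fs: "\<And>j. step_fun m M (f j)"
      using exists_perfect_form[OF \<Lambda>, of f] f by blast
    interpret perfect_form \<Lambda> m M I c T s by (rule F)
    \<comment> \<open>By \<open>cong_integrals\<close> the form does not notice the averaging at
      scale \<open>m\<close>, so the conditions on \<open>b\<close> pass to the step functions
      \<open>b'\<close>.\<close>
    define b' where "b' j = proj m M (b j)" for j
    have b's: "step_fun m M (b' j)" for j unfolding b'_def by (rule proj_step[OF mM])
    have "tb_form \<Lambda> m M I c T s b' B"
    proof (unfold_locales)
      show "B \<ge> 1" by fact
      show "step_fun m M (b' j)" for j by (rule b's)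
      show "\<bar>b' j x\<bar> \<le> B" for j x using mb[OF cube_at_in(1)] B1 by (simp add: b'_def proj_def)
      show "1 \<le> \<bar>mean_on (b' j) Q\<bar>" if "Q \<in> cubes r" "m \<le> r" "Q \<subseteq> region M" for j Q r
        using proj_integral[OF mM that li_set_integrable[OF bli that(1)]] acc cubes_imp_dyadic[OF that(1)]
        by (simp add: mean_on_def b'_def)
      show "\<bar>\<Lambda> (\<lambda>j x. b' j x * indicator Q x)\<bar> \<le> B * measure lebesgue Q" if Q: "Q \<in> cubes r" "m \<le> r" "Q \<subseteq> region M" for Q r
      proof -
        have "\<Lambda> (\<lambda>j x. b' j x * indicator Q x) = \<Lambda> (\<lambda>j x. b j x * indicator Q x)"
        proof (rule cong_integrals)
          show "locally_integrable (\<lambda>x. b' j x * indicator Q x)" for j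
            by (rule step_li[OF mM step_mult_indicator[OF b's Q(1,2)]])
          show "locally_integrable (\<lambda>x. b j x * indicator Q x)" for j by (rule li_mult_indicator[OF bli Q(1)])
          fix j r' and P :: "(real ^ 'd) set" assume P: "P \<in> cubes r'" "m \<le> r'" "P \<subseteq> region M"
          show "(LINT x:P|lebesgue. b' j x * indicator Q x) = (LINT x:P|lebesgue. b j x * indicator Q x)"
            unfolding b'_def by (rule proj_indicator_integral[OF mM Q P bli])
        qed
        then show ?thesis using wbp cubes_imp_dyadic[OF Q(1)] by simp
      qed
      show "\<bar>\<Lambda> (b'(k := g))\<bar> \<le> B"
        if g: "step_fun m M g" "Q \<in> cubes r" "supported_on g Q" "(LINT x|lebesgue. g x) = 0" "\<And>x. \<bar>g x\<bar> \<le> 1 / measure lebesgue Q"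
        for g Q r k
      proof -
        have "\<Lambda> (b'(k := g)) = \<Lambda> (b(k := g))"
        proof (rule cong_integrals)
          show "locally_integrable ((b'(k := g)) j)" for j by (auto intro!: step_li[OF mM] b's g(1))
          show "locally_integrable ((b(k := g)) j)" for j using step_li[OF mM g(1)] bli by simp
          fix j r' and P :: "(real ^ 'd) set" assume P: "P \<in> cubes r'" "m \<le> r'" "P \<subseteq> region M"
          show "(LINT x:P|lebesgue. (b'(k := g)) j x) = (LINT x:P|lebesgue. (b(k := g)) j x)"
            using proj_integral[OF mM P li_set_integrable[OF bli P(1)]] by (simp add: b'_def)
        qed
        moreover have "ereal \<bar>\<Lambda> (b(k := g))\<bar> \<le> ereal B * H1_norm g" using bmo step_test[OF mM g(1)] by blast
        moreover have "ereal B * H1_norm g \<le> ereal B * 1"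
          using H1_norm_step_atom[OF mM g] B1 by (intro ereal_mult_left_mono) auto
        ultimately have "ereal \<bar>\<Lambda> (b'(k := g))\<bar> \<le> ereal B * 1" using order_trans by metis
        then show ?thesis by simp
      qed
    qed
    then interpret tb_form \<Lambda> m M I c T s b' B .
    show "\<bar>\<Lambda> f\<bar> \<le> \<bar>tb_tree.C' ?D p (4 * CARD('n)) B Cs + B\<bar> * CARD('n) * (\<Prod>j\<in>UNIV. Lp_norm (p j) (f j))"
      by (rule form_bound_Lp[OF assms(2) Cs(1) Cs(2)[OF B1] fs])
  qed
qed

end
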